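(* Let $q\ge 2$ be a prime power, let $g\in\mathbb{F}_q[x]$ with $\delta=\deg g\ge 1$, and let $n\ge 1$. Let $R(n,g,q)$ be the number of monic polynomials $f\in\mathbb{F}_q[x]$ of degree $n$ that can be written as $f=h+g^k$, where $h$ is a monic irreducible polynomial of degree $n$ in $\mathbb{F}_q[x]$ and $k$ is a nonnegative integer, and put $r(n,g,q)=R(n,g,q)/q^n$. Then $$\frac{1+\delta/n}{\delta}\ \ge\ r(n,g,q)\ >\ \frac{(1-2q^{-n/2})^2\,(1+\delta/n)^{-1}}{\delta+8\,\frac{q}{q-1}\left(1+e^\gamma\min\left\{5\sqrt{\delta/q},\ \frac{\log 6\delta}{\log q}\right\}\right)},$$ where $\gamma$ is Euler's constant.
   Context: $\mathbb{F}_q$ denotes the finite field with $q$ elements. The bounds hold uniformly in $g$, $n\ge1$, $\delta\ge1$, $q\ge2$. *)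

theory Defs
  imports "HOL-Analysis.Analysis" "HOL-Computational_Algebra.Polynomial"
begin

definition shifted_irred_count :: "nat \<Rightarrow> 'a::{field,finite} poly \<Rightarrow> nat" where
  "shifted_irred_count n g = card {f :: 'a poly. lead_coeff f = 1 \<and> degree f = n \<and>
     (\<exists>h k. lead_coeff h = 1 \<and> irreducible h \<and> degree h = n \<and> f = h + g ^ k)}"

end

theory Submission
  imports Defs "HOL-Computational_Algebra.Polynomial_Factorial"
begin

text \<open>
  Let \<open>q\<close> be the size of the field, \<open>\<delta> = degree g\<close>, and let \<open>\<pi>\<close> be the number of monic irreducible
  polynomials of degree \<open>n\<close>. Only the \<open>K\<close> exponents \<open>k\<close> with \<open>k * \<delta> < n\<close> contribute, which
  gives the upper bound \<open>K * \<pi>\<close>. By Cauchy--Schwarz, the number of representable polynomials is at least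
  \<open>(K * \<pi>)\<^sup>2\<close> divided by the number of pairs of representations of the same polynomial. A pair with
  exponents \<open>j < k\<close> amounts to an irreducible \<open>h\<close> for which \<open>h + g ^ k - g ^ j\<close> is irreducible as well.
  Because polynomials of degree \<open>n\<close> are exactly equidistributed modulo every polynomial of degree at most
  \<open>n\<close>, Selberg's sieve has no error term here, and it bounds the number of such \<open>h\<close> by
  \<open>8 * q ^ n / ((n + 1) * (n + 3))\<close> times the Euler factors of the primes dividing \<open>g * (g ^ (k - j) - 1)\<close>.
  Romanoff's argument bounds the average over \<open>j\<close> and \<open>k\<close> of these Euler products by Euler products over
  the primes dividing \<open>g\<close> and all \<open>g ^ i - 1\<close> with \<open>i \<le> y\<close>, averaged over \<open>y\<close> with weights
  \<open>1 / (y * (y + 1))\<close>. Finally, an Euler product over primes of total degree \<open>D\<close> is at most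
  \<open>q / (q - 1) * (1 + exp euler_mascheroni * ln D / ln q)\<close>.
\<close>

section \<open>Residues of polynomials over a finite field\<close>

text \<open>The bounds must hold for all \<open>n\<close>, \<open>q\<close> and
  \<open>\<delta>\<close> with explicit constants, so no step may leave an asymptotic remainder. The
  sieve multiplies two moduli of degree at most n/2, the highest level at which equidistribution in
  degree n stays exact; its denominator is about (n/2)^2 / 2, whence the constant 8. Multiplicative
  orders of \<open>g\<close> modulo primes are never introduced: all that is used of them is that
  the exponents \<open>i\<close> with P dividing \<open>g ^ i - 1\<close> are closed under
  subtraction. The minimum in the theorem comes from two bounds for an Euler product over primes of
  total degree D, both of the shape q/(q-1) (1 + e^\<gamma> u): u = ln D / ln q is always allowed,
  and u = D/q as long as D \<le> q. In the average D is about \<delta> y^2 / 2, and the weights 1/(y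
  (y + 1)) favour small y. Averaging the logarithm therefore costs only the constant 6 inside it,
  while a cut at y of order sqrt(q/\<delta>), where D reaches the order of q, produces the square
  root.\<close>

definition polys_below :: "nat \<Rightarrow> 'a::zero poly set" where
  "polys_below d = {r. r = 0 \<or> degree r < d}"

definition monics :: "nat \<Rightarrow> 'a::{zero,one} poly set" where
  "monics n = {f. lead_coeff f = 1 \<and> degree f = n}"

definition monic_irreds :: "'a::field poly set" where
  "monic_irreds = {f. lead_coeff f = 1 \<and> irreducible f}"

definition irreds_of_degree :: "nat \<Rightarrow> 'a::field poly set" where
  "irreds_of_degree n = {f \<in> monic_irreds. degree f = n}"

lemma polys_below_0 [simp]: "polys_below 0 = {0}"
  by (auto simp: polys_below_def)

lemma polys_below_Suc:
  "polys_below (Suc d) = (\<lambda>(a, r). pCons a r) ` (UNIV \<times> polys_below d)"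
proof (intro equalityI subsetI)
  fix f :: "'a poly" assume f: "f \<in> polys_below (Suc d)"
  obtain a r where ar: "f = pCons a r" by (cases f)
  have "r \<in> polys_below d"
    using f by (cases "r = 0") (auto simp: polys_below_def ar degree_pCons_eq)
  then show "f \<in> (\<lambda>(a, r). pCons a r) ` (UNIV \<times> polys_below d)"
    using ar by auto
qed (auto simp: polys_below_def degree_pCons_eq_if split: if_splits)

lemma card_polys_below:
  "card (polys_below d :: 'a::{zero,finite} poly set) = CARD('a) ^ d \<and>
   finite (polys_below d :: 'a poly set)"
proof (induction d)
  case (Suc d)
  have "inj_on (\<lambda>(a, r). pCons a r) (UNIV \<times> (polys_below d :: 'a poly set))"
    by (auto simp: inj_on_def)
  then show ?case
    using Suc by (simp add: polys_below_Suc card_image card_cartesian_product)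
qed auto

lemma mod_in_polys_below:
  fixes f m :: "'a::field poly"
  assumes "m \<noteq> 0" shows "f mod m \<in> polys_below (degree m)"
  using degree_mod_less[OF assms, of f] by (auto simp: polys_below_def)

lemma mod_polys_below:
  fixes r m :: "'a::field poly"
  assumes "r \<in> polys_below (degree m)" shows "r mod m = r"
  using assms by (auto simp: polys_below_def mod_poly_less)

lemma monics_add_polys_below:
  fixes f r :: "'a::field poly"
  assumes "f \<in> monics n" "r \<in> polys_below n"
  shows "f + r \<in> monics n"
proof (cases "r = 0")
  case False
  then have "degree r < degree f" using assms by (auto simp: polys_below_def monics_def)
  then show ?thesis using assms
    by (auto simp: monics_def degree_add_eq_left coeff_eq_0)
qed (use assms in auto)

lemma monics_mult:
  fixes f h :: "'a::field poly"
  assumes "f \<in> monics i" "h \<in> monics j"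
  shows "f * h \<in> monics (i + j)"
proof -
  have "f \<noteq> 0" "h \<noteq> 0" using assms by (auto simp: monics_def)
  moreover have "lead_coeff (f * h) = 1"
    unfolding lead_coeff_mult using assms by (auto simp: monics_def)
  ultimately show ?thesis using assms by (auto simp: monics_def degree_mult_eq)
qed

text \<open>Division with remainder by a monic polynomial. This is the source of exact
  equidistribution: each residue modulo \<open>m\<close> is hit once for every monic quotient of
  degree \<open>n - d\<close>.\<close>

lemma monics_bij:
  fixes m :: "'a::field poly"
  assumes m: "m \<in> monics d" and d: "d \<le> n"
  shows "bij_betw (\<lambda>(a, r). m * a + r) (monics (n - d) \<times> polys_below d) (monics n)"
proof -
  have m0: "m \<noteq> 0" and dm: "degree m = d" using m by (auto simp: monics_def)
  have divmod: "(m * a + r) div m = a" "(m * a + r) mod m = r" if "r \<in> polys_below d" for a r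
  proof -
    have "r mod m = r" using that dm by (intro mod_polys_below) simp
    then show "(m * a + r) mod m = r" by simp
    have "r div m = 0" using that dm by (auto simp: polys_below_def div_poly_less)
    then show "(m * a + r) div m = a" using m0 by simp
  qed
  show ?thesis
  proof (rule bij_betwI[where g = "\<lambda>f. (f div m, f mod m)"])
    show "(\<lambda>(a, r). m * a + r) \<in> monics (n - d) \<times> polys_below d \<rightarrow> monics n"
    proof (clarsimp)
      fix a r :: "'a poly" assume a: "a \<in> monics (n - d)" and r: "r \<in> polys_below d"
      have "m * a \<in> monics n"
        using monics_mult[OF m a] d by simp
      then show "m * a + r \<in> monics n"
        by (rule monics_add_polys_below) (use r d in \<open>auto simp: polys_below_def\<close>)
    qed
    show "(\<lambda>f. (f div m, f mod m)) \<in> monics n \<rightarrow> monics (n - d) \<times> polys_below d"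
    proof (clarsimp, intro conjI)
      fix f :: "'a poly" assume f: "f \<in> monics n"
      show r: "f mod m \<in> polys_below d" using mod_in_polys_below[OF m0] dm by simp
      show "f div m \<in> monics (n - d)"
      proof -
        define a where "a = f div m"
        have eq: "f = m * a + f mod m" by (simp add: a_def)
        have df: "degree f = n" and lf: "lead_coeff f = 1" using f by (auto simp: monics_def)
        \<comment> \<open>Here \<open>d \<le> n\<close> enters: with quotient 0, \<open>f\<close>
          would be its own remainder and have degree below \<open>d\<close>.\<close>
        have a0: "a \<noteq> 0"
        proof
          assume "a = 0"
          then have "f \<in> polys_below d" using eq r by simp
          moreover have "f \<noteq> 0" using lf by auto
          ultimately show False using df d by (auto simp: polys_below_def)
        qed
        have dma: "degree (m * a) = d + degree a" using m0 a0 dm by (simp add: degree_mult_eq)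
        have "lead_coeff f = lead_coeff (m * a) \<and> degree f = degree (m * a)"
        proof (cases "f mod m = 0")
          case False
          then have less: "degree (f mod m) < degree (m * a)"
            using r dma by (auto simp: polys_below_def)
          then have "degree (m * a + f mod m) = degree (m * a)"
            by (rule degree_add_eq_left)
          moreover have "coeff (m * a + f mod m) (degree (m * a)) = lead_coeff (m * a)"
            using less by (simp add: coeff_eq_0)
          ultimately show ?thesis using eq by metis
        qed (use eq in simp)
        then show ?thesis using df lf dma m by (auto simp: monics_def lead_coeff_mult a_def)
      qed
    qed
  qed (use divmod in auto)
qed

text \<open>Dividing by x^n forces the quotient 1, so a monic polynomial of degree \<open>n\<close>
  is x^n plus an arbitrary remainder.\<close>

lemma card_monics:
  "card (monics n :: 'a::{field,finite} poly set) = CARD('a) ^ n \<and> finite (monics n :: 'a poly set)"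
proof -
  have one: "(monom 1 n :: 'a poly) \<in> monics n"
    by (simp add: monics_def degree_monom_eq lead_coeff_monom)
  have m0: "(monics 0 :: 'a poly set) = {1}"
    by (auto simp: monics_def elim!: degree_eq_zeroE)
  note bij = monics_bij[OF one order_refl, unfolded diff_self_eq_0 m0]
  have "card (monics n :: 'a poly set) = card ({1 :: 'a poly} \<times> (polys_below n :: 'a poly set))"
    using bij_betw_same_card[OF bij] by simp
  moreover have "finite (monics n :: 'a poly set)"
    using bij_betw_finite[OF bij] card_polys_below[of n, where 'a = 'a] by simp
  ultimately show ?thesis
    using card_polys_below[of n, where 'a = 'a] by (simp add: card_cartesian_product)
qed

text \<open>An average over monics of degree \<open>n\<close> equals the average over residues,
  without error, for every modulus of degree up to \<open>n\<close>. This replaces the remainder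
  terms of a sieve over the integers.\<close>

lemma sum_monics_mod:
  fixes m :: "'a::{field,finite} poly" and u :: "'a poly \<Rightarrow> real"
  assumes m: "m \<in> monics d" and d: "d \<le> n"
  shows "(\<Sum>f\<in>monics n. u (f mod m)) = real CARD('a) ^ (n - d) * (\<Sum>r\<in>polys_below d. u r)"
proof -
  have dm: "degree m = d" using m by (auto simp: monics_def)
  have "(\<Sum>f\<in>monics n. u (f mod m))
      = (\<Sum>(a, r)\<in>monics (n - d) \<times> polys_below d. u ((m * a + r) mod m))"
    by (subst sum.reindex_bij_betw[OF monics_bij[OF m d], symmetric]) (simp add: case_prod_unfold)
  also have "\<dots> = (\<Sum>(a :: 'a poly, r)\<in>monics (n - d) \<times> polys_below d. u r)"
    by (rule sum.cong) (auto simp: mod_polys_below dm)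
  also have "\<dots> = real CARD('a) ^ (n - d) * (\<Sum>r\<in>polys_below d. u r)"
    using card_monics[of "n - d", where 'a = 'a] by (simp flip: sum.cartesian_product)
  finally show ?thesis .
qed

section \<open>Monic irreducibles and the Chinese remainder theorem\<close>

lemma monic_irredsD:
  assumes "P \<in> monic_irreds"
  shows "prime_elem P" "P \<noteq> 0" "lead_coeff P = 1" "degree P \<ge> 1" "irreducible P"
proof -
  have P: "lead_coeff P = 1" "irreducible P" using assms by (auto simp: monic_irreds_def)
  show "prime_elem P" using P by (simp add: field_poly_irreducible_imp_prime)
  show "P \<noteq> 0" "lead_coeff P = 1" "irreducible P" using P by auto
  show "degree P \<ge> 1"
  proof (rule ccontr)
    assume "\<not> degree P \<ge> 1"
    then have "is_unit P" using \<open>P \<noteq> 0\<close> by (simp add: is_unit_iff_degree)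
    then show False using P irreducible_not_unit by blast
  qed
qed

lemma monic_irreds_dvd_eq:
  assumes "P \<in> monic_irreds" "R \<in> monic_irreds" "P dvd R"
  shows "P = R"
proof -
  note P = monic_irredsD[OF assms(1)] and R = monic_irredsD[OF assms(2)]
  obtain c where c: "R = P * c" using assms(3) by auto
  have "\<not> is_unit P" using P(5) irreducible_not_unit by blast
  then have "is_unit c" using R(5) c by (auto dest: irreducibleD)
  then obtain a where a: "c = [:a:]" by (auto simp: is_unit_poly_iff)
  have "a = 1" using P(3) R(3) by (simp add: c a lead_coeff_mult split: if_splits)
  then show ?thesis using c a by (simp add: one_pCons)
qed

lemma monic_irred_dvd_prod:
  assumes "finite U" "U \<subseteq> monic_irreds" "P \<in> monic_irreds" "P dvd \<Prod>U"
  shows "P \<in> U"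
proof -
  have "\<exists>R\<in>U. P dvd R"
    using assms(1,4)
  proof (induction U rule: finite_induct)
    case empty
    then show ?case using monic_irredsD(1)[OF assms(3)] prime_elem_not_unit by auto
  qed (auto simp: prime_elem_dvd_mult_iff[OF monic_irredsD(1)[OF assms(3)]])
  then obtain R where "R \<in> U" "P dvd R" by blast
  then show ?thesis using monic_irreds_dvd_eq[of P R] assms by auto
qed

lemma prod_dvd_monic_irreds:
  assumes "finite U" "U \<subseteq> monic_irreds" "\<And>P. P \<in> U \<Longrightarrow> P dvd x"
  shows "\<Prod>U dvd x"
  using assms
proof (induction U rule: finite_induct)
  case (insert P U)
  then have P: "P \<in> monic_irreds" by auto
  obtain c where c: "x = \<Prod>U * c" using insert by (auto elim!: dvdE)
  have "\<not> P dvd \<Prod>U" using monic_irred_dvd_prod[of U P] insert P by auto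
  moreover have "P dvd \<Prod>U * c" using insert.prems c by auto
  ultimately have "P dvd c"
    using monic_irredsD(1)[OF P] by (simp add: prime_elem_dvd_mult_iff)
  then show ?case using insert.hyps by (auto simp: c mult.commute intro: mult_dvd_mono)
qed auto

lemma monics_prod:
  assumes "finite U" "U \<subseteq> monic_irreds"
  shows "\<Prod>U \<in> monics (sum degree U)"
  using assms
proof (induction U rule: finite_induct)
  case (insert P U)
  then have "P \<in> monics (degree P)" using monic_irredsD[of P] by (auto simp: monics_def)
  with insert show ?case using monics_mult by fastforce
qed (auto simp: monics_def)

lemma sum_degree_le:
  fixes x :: "'a::field poly"
  assumes "finite U" "U \<subseteq> monic_irreds" "\<And>P. P \<in> U \<Longrightarrow> P dvd x" "x \<noteq> 0"
  shows "sum degree U \<le> degree x"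
  using dvd_imp_degree_le[OF prod_dvd_monic_irreds[OF assms(1-3)] assms(4)]
    monics_prod[OF assms(1,2)] by (simp add: monics_def)

text \<open>Splitting off one prime at a time, the map to the pair of remainders is injective
  between sets of equal size. Counting makes it bijective, so no explicit inverse is
  constructed.\<close>

lemma chinese_remainder_sum:
  fixes U :: "'a::{field,finite} poly set" and u :: "'a poly \<Rightarrow> 'a poly \<Rightarrow> real"
  assumes "finite U" "U \<subseteq> monic_irreds"
  shows "(\<Sum>r\<in>polys_below (sum degree U). \<Prod>P\<in>U. u P (r mod P))
       = (\<Prod>P\<in>U. \<Sum>r\<in>polys_below (degree P). u P r)"
  using assms
proof (induction U rule: finite_induct)
  case (insert P U)
  define M where "M = \<Prod>U"
  define d where "d = sum degree U"
  have U: "U \<subseteq> monic_irreds" and P: "P \<in> monic_irreds" using insert by auto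
  have M: "M \<in> monics d" using monics_prod[OF insert.hyps(1) U] by (simp add: M_def d_def)
  then have M0: "M \<noteq> 0" "degree M = d" by (auto simp: monics_def)
  note Pd = monic_irredsD[OF P]
  define h where "h = (\<lambda>r. (r mod P, r mod M))"
  have card: "card (polys_below (degree P + d) :: 'a poly set)
      = card ((polys_below (degree P) :: 'a poly set) \<times> (polys_below d :: 'a poly set))"
    using card_polys_below[where 'a = 'a] by (simp add: card_cartesian_product power_add)
  have inj: "inj_on h (polys_below (degree P + d))"
  proof (rule inj_onI)
    fix r s assume rs: "r \<in> polys_below (degree P + d)" "s \<in> polys_below (degree P + d)" "h r = h s"
    have "P dvd r - s" "M dvd r - s" using rs(3) by (auto simp: h_def mod_eq_dvd_iff)
    moreover have "R dvd r - s" if "R \<in> U" for R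
      using that \<open>M dvd r - s\<close> insert.hyps(1) M_def dvd_prod_eqI by (metis dvd_trans dvd_prodI)
    ultimately have dvd: "P * M dvd r - s"
      using prod_dvd_monic_irreds[of "insert P U" "r - s"] insert.hyps insert.prems
      by (auto simp: M_def)
    show "r = s"
    proof (rule ccontr)
      assume "r \<noteq> s"
      then have "degree P + d \<le> degree (r - s)"
        using dvd_imp_degree_le[OF dvd] M0 Pd by (simp add: degree_mult_eq)
      moreover have "degree (r - s) < degree P + d"
        using rs(1,2) Pd(4) by (auto simp: polys_below_def intro: degree_diff_less)
      ultimately show False by simp
    qed
  qed
  have img: "h ` polys_below (degree P + d) = polys_below (degree P) \<times> polys_below d"
  proof (rule card_subset_eq)
    show "finite ((polys_below (degree P) :: 'a poly set) \<times> (polys_below d :: 'a poly set))"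
      using card_polys_below[where 'a = 'a] by auto
    show "h ` polys_below (degree P + d) \<subseteq> polys_below (degree P) \<times> polys_below d"
      using mod_in_polys_below[OF Pd(2)] mod_in_polys_below[OF M0(1)] M0(2) by (auto simp: h_def)
    show "card (h ` polys_below (degree P + d))
        = card ((polys_below (degree P) :: 'a poly set) \<times> (polys_below d :: 'a poly set))"
      using card card_image[OF inj] by simp
  qed
  have bij: "bij_betw h (polys_below (degree P + d)) (polys_below (degree P) \<times> polys_below d)"
    using inj img by (simp add: bij_betw_def)
  have PM: "r mod M mod R = r mod R" if "R \<in> U" for r R
    using that insert.hyps(1) by (intro mod_mod_cancel) (auto simp: M_def)
  have "(\<Sum>r\<in>polys_below (sum degree (insert P U)). \<Prod>R\<in>insert P U. u R (r mod R))
      = (\<Sum>r\<in>polys_below (degree P + d). (\<lambda>(a, b). u P a * (\<Prod>R\<in>U. u R (b mod R))) (h r))"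
    using insert.hyps by (simp add: d_def h_def PM)
  also have "\<dots> = (\<Sum>(a, b)\<in>polys_below (degree P) \<times> polys_below d. u P a * (\<Prod>R\<in>U. u R (b mod R)))"
    by (rule sum.reindex_bij_betw[OF bij])
  also have "\<dots> = (\<Sum>a\<in>polys_below (degree P). u P a)
      * (\<Sum>b\<in>polys_below d. \<Prod>R\<in>U. u R (b mod R))"
    by (simp add: sum_product sum.cartesian_product)
  also have "\<dots> = (\<Prod>P\<in>insert P U. \<Sum>r\<in>polys_below (degree P). u P r)"
    using insert.IH[OF U] insert.hyps by (simp add: d_def)
  finally show ?case .
qed simp

text \<open>Probabilistic independence: for a random monic polynomial of degree \<open>n\<close>,
  the residues modulo distinct primes of total degree at most \<open>n\<close> are independent and
  uniform, so expectations of products factor.\<close>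

lemma sum_monics_prod_mod:
  fixes U :: "'a::{field,finite} poly set" and u :: "'a poly \<Rightarrow> 'a poly \<Rightarrow> real"
  assumes "finite U" "U \<subseteq> monic_irreds" "sum degree U \<le> n"
  shows "(\<Sum>f\<in>monics n. \<Prod>P\<in>U. u P (f mod P))
       = real CARD('a) ^ n * (\<Prod>P\<in>U. (\<Sum>r\<in>polys_below (degree P). u P r) / real CARD('a) ^ degree P)"
proof -
  have eq: "f mod \<Prod>U mod P = f mod P" if "P \<in> U" for f P
    using that assms(1) by (intro mod_mod_cancel) auto
  have "(\<Sum>f\<in>monics n. \<Prod>P\<in>U. u P (f mod P)) = (\<Sum>f\<in>monics n. \<Prod>P\<in>U. u P (f mod \<Prod>U mod P))"
    by (simp add: eq)
  also have "\<dots> = real CARD('a) ^ (n - sum degree U)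
      * (\<Sum>r\<in>polys_below (sum degree U). \<Prod>P\<in>U. u P (r mod P))"
    by (rule sum_monics_mod[OF monics_prod[OF assms(1,2)] assms(3)])
  also have "\<dots> = real CARD('a) ^ (n - sum degree U) * (\<Prod>P\<in>U. \<Sum>r\<in>polys_below (degree P). u P r)"
    by (simp add: chinese_remainder_sum[OF assms(1,2)])
  also have "\<dots> = real CARD('a) ^ n * (\<Prod>P\<in>U. (\<Sum>r\<in>polys_below (degree P). u P r) / real CARD('a) ^ degree P)"
    using assms(3) by (simp add: prod_dividef power_diff power_sum)
  finally show ?thesis .
qed

section \<open>Counting irreducible polynomials\<close>

text \<open>The support of the von Mangoldt function in degree \<open>m\<close>: the pair (P, k)
  stands for the prime power \<open>P ^ k\<close>, whose weight is \<open>degree P\<close>.\<close>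

definition prime_power_pairs :: "nat \<Rightarrow> ('a::field poly \<times> nat) set" where
  "prime_power_pairs m = {(P, k). P \<in> monic_irreds \<and> k \<ge> 1 \<and> k * degree P = m}"

lemma finite_irreds_of_degree [simp]: "finite (irreds_of_degree d :: 'a::{field,finite} poly set)"
  by (rule finite_subset[of _ "monics d"])
     (use card_monics[of d, where 'a = 'a] in \<open>auto simp: irreds_of_degree_def monic_irreds_def monics_def\<close>)

lemma prime_power_pairs_eq:
  assumes "m \<ge> 1"
  shows "prime_power_pairs m = (\<lambda>P. (P, m div degree P)) ` (\<Union>d\<in>{d. d dvd m}. irreds_of_degree d)"
    (is "_ = ?f ` ?A")
proof (intro equalityI subsetI)
  fix x :: "'a poly \<times> nat" assume "x \<in> prime_power_pairs m"
  then obtain P k where x: "x = (P, k)" "P \<in> monic_irreds" "k * degree P = m"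
    by (auto simp: prime_power_pairs_def)
  then show "x \<in> ?f ` ?A"
    using monic_irredsD(4)[OF x(2)] by (intro image_eqI[of _ _ P]) (auto simp: irreds_of_degree_def)
next
  fix x :: "'a poly \<times> nat" assume "x \<in> ?f ` ?A"
  then obtain P where "P \<in> monic_irreds" "degree P dvd m" "x = (P, m div degree P)"
    by (auto simp: irreds_of_degree_def)
  then show "x \<in> prime_power_pairs m"
    using monic_irredsD(4)[of P] assms by (auto simp: prime_power_pairs_def)
qed

lemma prime_power_pairs_sum:
  assumes "m \<ge> 1"
  shows "(\<Sum>(P, k)\<in>prime_power_pairs m. degree (P :: 'a::{field,finite} poly))
       = (\<Sum>d | d dvd m. d * card (irreds_of_degree d :: 'a poly set))"
    and "finite (prime_power_pairs m :: ('a poly \<times> nat) set)"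
proof -
  have fin: "finite {d. d dvd m}" using assms by simp
  have inj: "inj_on (\<lambda>P. (P, m div degree P)) (\<Union>d\<in>{d. d dvd m}. irreds_of_degree d)"
    by (auto simp: inj_on_def)
  have "(\<Sum>(P, k)\<in>prime_power_pairs m. degree (P :: 'a poly))
      = (\<Sum>P\<in>(\<Union>d\<in>{d. d dvd m}. irreds_of_degree d :: 'a poly set). degree P)"
    unfolding prime_power_pairs_eq[OF assms] by (subst sum.reindex[OF inj]) simp
  also have "\<dots> = (\<Sum>d | d dvd m. \<Sum>P\<in>(irreds_of_degree d :: 'a poly set). degree P)"
    by (rule sum.UNION_disjoint[OF fin])
       (use finite_irreds_of_degree in \<open>auto simp: irreds_of_degree_def\<close>)
  also have "\<dots> = (\<Sum>d | d dvd m. d * card (irreds_of_degree d :: 'a poly set))"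
    by (intro sum.cong refl) (simp add: irreds_of_degree_def)
  finally show "(\<Sum>(P, k)\<in>prime_power_pairs m. degree (P :: 'a poly))
       = (\<Sum>d | d dvd m. d * card (irreds_of_degree d :: 'a poly set))" .
  show "finite (prime_power_pairs m :: ('a poly \<times> nat) set)"
    unfolding prime_power_pairs_eq[OF assms] using fin by auto
qed

lemma exists_monic_irred_dvd:
  fixes f :: "'a::field poly"
  assumes "degree f \<ge> 1"
  obtains P where "P \<in> monic_irreds" "P dvd f"
  using assms
proof (induction "degree f" arbitrary: f thesis rule: less_induct)
  case less
  have f0: "f \<noteq> 0" using less.prems by auto
  show ?case
  proof (cases "irreducible f")
    case True
    define P where "P = smult (inverse (lead_coeff f)) f"
    have "lead_coeff P = 1" using f0 by (simp add: P_def)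
    moreover have "irreducible P"
      using True f0 irreducible_mult_unit_left[of "[:inverse (lead_coeff f):]" f]
      by (simp add: P_def is_unit_pCons_iff)
    moreover have "P dvd f" using f0 by (simp add: P_def smult_dvd_iff)
    ultimately show ?thesis using less.prems(1)[of P] by (auto simp: monic_irreds_def)
  next
    case False
    have "\<not> is_unit f" using less.prems(2) f0 by (simp add: is_unit_iff_degree)
    then obtain a b where ab: "f = a * b" "\<not> is_unit a" "\<not> is_unit b"
      using False f0 by (auto simp: irreducible_def)
    have ab0: "a \<noteq> 0" "b \<noteq> 0" using ab f0 by auto
    then have "degree a \<ge> 1" "degree b \<ge> 1" using ab by (auto simp: is_unit_iff_degree)
    then have "degree a < degree f" using ab ab0 by (simp add: degree_mult_eq)
    then obtain P where "P \<in> monic_irreds" "P dvd a"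
      using less.hyps[of a] \<open>degree a \<ge> 1\<close> by blast
    then show ?thesis using less.prems(1)[of P] ab by auto
  qed
qed

text \<open>The identity log = 1 * Lambda, with the degree as logarithm. Write f = P c for a prime
  P: pairs of primes other than P are the same for \<open>f\<close> and \<open>c\<close>, the pairs
  (P, k) of \<open>c\<close> become (P, k + 1), and (P, 1) is new, adding
  \<open>degree P\<close>.\<close>

lemma sum_degree_prime_powers:
  assumes "f \<in> monics n"
  shows "finite {(P, k). P \<in> monic_irreds \<and> k \<ge> 1 \<and> P ^ k dvd f} \<and>
    (\<Sum>(P, k) | P \<in> monic_irreds \<and> k \<ge> 1 \<and> P ^ k dvd f. degree P) = n"
  using assms
proof (induction n arbitrary: f rule: less_induct)
  case (less n)
  define A where "A = (\<lambda>f :: 'a poly. {(P, k). P \<in> monic_irreds \<and> k \<ge> 1 \<and> P ^ k dvd f})"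
  have f0: "f \<noteq> 0" using less.prems by (auto simp: monics_def)
  show ?case
  proof (cases "n = 0")
    case True
    then have "f = 1" using less.prems by (auto simp: monics_def elim!: degree_eq_zeroE)
    have "A f = {}"
    proof -
      have "\<not> P ^ k dvd f" if "P \<in> monic_irreds" "k \<ge> 1" for P k
        using monic_irredsD(1)[OF that(1)] that(2) \<open>f = 1\<close>
        by (auto simp: is_unit_power_iff prime_elem_def)
      then show ?thesis by (auto simp: A_def)
    qed
    then have "finite (A f) \<and> (\<Sum>(P, k)\<in>A f. degree P) = n" using True by simp
    then show ?thesis by (simp add: A_def)
  next
    case False
    then obtain P where P: "P \<in> monic_irreds" "P dvd f"
      using exists_monic_irred_dvd[of f] less.prems by (auto simp: monics_def)
    obtain c where c: "f = P * c" using P by auto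
    note Pd = monic_irredsD[OF P(1)]
    have c0: "c \<noteq> 0" using f0 c by auto
    have "lead_coeff (P * c) = 1" using less.prems unfolding c monics_def by blast
    then have "lead_coeff c = 1" by (metis Pd(3) lead_coeff_mult mult_1)
    moreover have deg: "n = degree P + degree c"
      using less.prems c c0 Pd by (simp add: monics_def degree_mult_eq)
    ultimately have cm: "c \<in> monics (degree c)" by (auto simp: monics_def)
    have "degree c < n" using deg Pd by simp
    from less.IH[OF this cm] have IH: "finite (A c)" "(\<Sum>(P, k)\<in>A c. degree P) = degree c"
      by (auto simp: A_def)
    have other: "R ^ k dvd P * c \<longleftrightarrow> R ^ k dvd c" if "R \<in> monic_irreds" "R \<noteq> P" "k \<ge> 1" for R k
    proof -
      have "\<not> R dvd P" using monic_irreds_dvd_eq[of R P] that P by auto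
      then show ?thesis
        using prime_power_dvd_multD[OF monic_irredsD(1)[OF that(1)], of k P c] that by auto
    qed
    have same: "P ^ k dvd P * c \<longleftrightarrow> P ^ (k - 1) dvd c" if "k \<ge> 1" for k
      using that Pd by (cases k) auto
    define B where "B = {x \<in> A c. fst x \<noteq> P}"
    define C where "C = {x \<in> A c. fst x = P}"
    have Ac: "A c = B \<union> C" "B \<inter> C = {}" by (auto simp: B_def C_def)
    have fin: "finite B" "finite C" using IH(1) Ac by auto
    define C' where "C' = insert (P, 1) ((\<lambda>(R, k). (R, Suc k)) ` C)"
    have Af: "A f = B \<union> C'"
    proof (intro equalityI subsetI)
      fix x assume x: "x \<in> A f"
      obtain R k where Rk: "x = (R, k)" by (cases x)
      show "x \<in> B \<union> C'"
      proof (cases "R = P")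
        case True
        then have k: "k \<ge> 1" "P ^ (k - 1) dvd c" using x Rk same c by (auto simp: A_def)
        show ?thesis
        proof (cases "k = 1")
          case False
          then have "(P, k - 1) \<in> C" using k P by (auto simp: C_def A_def)
          then have "(P, Suc (k - 1)) \<in> C'" by (force simp: C'_def)
          then show ?thesis using k Rk True by simp
        qed (use Rk True in \<open>auto simp: C'_def\<close>)
      qed (use x Rk other c in \<open>auto simp: A_def B_def\<close>)
    next
      fix x assume "x \<in> B \<union> C'"
      then show "x \<in> A f"
        using P other same by (auto simp: A_def B_def C_def C'_def c)
    qed
    have disj: "B \<inter> C' = {}" by (auto simp: B_def C_def C'_def)
    have inj: "inj_on (\<lambda>(R, k). (R, Suc k)) C" by (auto simp: inj_on_def)
    have new: "(P, 1) \<notin> (\<lambda>(R, k). (R, Suc k)) ` C" by (auto simp: C_def A_def)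
    have "(\<Sum>(R, k)\<in>C'. degree R) = degree P + (\<Sum>(R, k)\<in>C. degree R)"
      using fin new unfolding C'_def
      by (subst sum.insert) (simp_all add: sum.reindex[OF inj], simp add: case_prod_unfold)
    moreover have "(\<Sum>(R, k)\<in>A f. degree R) = (\<Sum>(R, k)\<in>B. degree R) + (\<Sum>(R, k)\<in>C'. degree R)"
      unfolding Af using fin disj by (intro sum.union_disjoint) (auto simp: C'_def)
    moreover have "(\<Sum>(R, k)\<in>A c. degree R) = (\<Sum>(R, k)\<in>B. degree R) + (\<Sum>(R, k)\<in>C. degree R)"
      unfolding Ac(1) using fin Ac(2) by (intro sum.union_disjoint) auto
    ultimately have "(\<Sum>(R, k)\<in>A f. degree R) = n" using IH(2) deg by simp
    moreover have "finite (A f)" using fin by (auto simp: Af C'_def)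
    ultimately show ?thesis by (auto simp: A_def)
  qed
qed

lemma card_monic_multiples:
  fixes m :: "'a::{field,finite} poly"
  assumes "m \<in> monics d" "d \<le> n"
  shows "card {f \<in> monics n. m dvd f} = CARD('a) ^ (n - d)"
proof -
  have fin: "finite (polys_below d :: 'a poly set)" "finite (monics n :: 'a poly set)"
    using card_polys_below card_monics by auto
  have "0 \<in> (polys_below d :: 'a poly set)" by (simp add: polys_below_def)
  have "real (card {f \<in> monics n. m dvd f}) = (\<Sum>f\<in>monics n. of_bool (f mod m = 0))"
    using fin by (simp add: dvd_eq_mod_eq_0 Collect_conj_eq Int_commute)
  also have "\<dots> = real CARD('a) ^ (n - d) * (\<Sum>r\<in>polys_below d. of_bool (r = (0 :: 'a poly)))"
    using sum_monics_mod[OF assms, of "\<lambda>r. of_bool (r = 0)"] by simp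
  also have "(\<Sum>r\<in>polys_below d. of_bool (r = (0 :: 'a poly))) = (1 :: real)"
    using fin \<open>0 \<in> polys_below d\<close> by (simp add: of_bool_def sum.delta)
  finally show ?thesis by (simp flip: of_nat_power)
qed

text \<open>Double counting: the degrees of all monics of degree \<open>n\<close> are summed over
  their prime power divisors, and \<open>P ^ k\<close> of degree m has exactly q^(n - m) monic
  multiples of degree \<open>n\<close>.\<close>

lemma mangoldt_convolution:
  "n * CARD('a) ^ n
    = (\<Sum>m = 1..n. CARD('a::{field,finite}) ^ (n - m) * (\<Sum>(P, k)\<in>prime_power_pairs m. degree (P :: 'a poly)))"
proof -
  define A where "A = (\<lambda>f :: 'a poly. {(P, k). P \<in> monic_irreds \<and> k \<ge> 1 \<and> P ^ k dvd f})"
  define Z where "Z = (\<Union>m\<in>{1..n}. prime_power_pairs m :: ('a poly \<times> nat) set)"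
  have finZ: "finite Z" using prime_power_pairs_sum(2)[where 'a = 'a] by (auto simp: Z_def)
  have pow: "P ^ k \<in> monics (k * degree P)" if "P \<in> monic_irreds" for P :: "'a poly" and k
  proof (induction k)
    case (Suc k)
    have "P \<in> monics (degree P)" using monic_irredsD(3)[OF that] by (simp add: monics_def)
    then show ?case using monics_mult Suc by fastforce
  qed (simp add: monics_def)
  have sub: "A f = {x \<in> Z. fst x ^ snd x dvd f}" if "f \<in> monics n" for f
  proof -
    have "(P, k) \<in> Z" if Pk: "P \<in> monic_irreds" "k \<ge> 1" "P ^ k dvd f" for P k
    proof -
      have "f \<noteq> 0" "degree f = n" using \<open>f \<in> monics n\<close> by (auto simp: monics_def)
      then have "k * degree P \<le> n"
        using dvd_imp_degree_le[OF Pk(3)] pow[OF Pk(1), of k] by (auto simp: monics_def)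
      moreover have "1 \<le> k * degree P" using Pk monic_irredsD(4)[OF Pk(1)] by (simp add: Suc_leI)
      ultimately show ?thesis using Pk by (auto simp: Z_def prime_power_pairs_def)
    qed
    then show ?thesis by (auto simp: A_def Z_def prime_power_pairs_def)
  qed
  have finm: "finite (monics n :: 'a poly set)" using card_monics by auto
  have "n * CARD('a) ^ n = (\<Sum>f\<in>(monics n :: 'a poly set). n)"
    using card_monics[of n, where 'a = 'a] by simp
  also have "\<dots> = (\<Sum>f\<in>monics n. \<Sum>(P, k)\<in>A f. degree P)"
    using sum_degree_prime_powers by (intro sum.cong refl) (auto simp: A_def)
  also have "\<dots> = (\<Sum>f\<in>monics n. \<Sum>x\<in>Z. if fst x ^ snd x dvd f then degree (fst x) else 0)"
    by (rule sum.cong[OF refl]) (simp only: sub sum.inter_filter[OF finZ] case_prod_unfold)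
  also have "\<dots> = (\<Sum>x\<in>Z. \<Sum>f\<in>monics n. if fst x ^ snd x dvd f then degree (fst x) else 0)"
    by (rule sum.swap)
  also have "\<dots> = (\<Sum>x\<in>Z. degree (fst x) * CARD('a) ^ (n - snd x * degree (fst x)))"
  proof (intro sum.cong refl)
    fix x assume "x \<in> Z"
    then have x: "fst x \<in> monic_irreds" "snd x * degree (fst x) \<le> n"
      by (auto simp: Z_def prime_power_pairs_def)
    show "(\<Sum>f\<in>monics n. if fst x ^ snd x dvd f then degree (fst x) else 0)
        = degree (fst x) * CARD('a) ^ (n - snd x * degree (fst x))"
      using card_monic_multiples[OF pow[OF x(1)] x(2)] finm
      by (simp flip: sum.inter_filter)
  qed
  also have "\<dots> = (\<Sum>m = 1..n. \<Sum>x\<in>prime_power_pairs m. degree (fst (x :: 'a poly \<times> nat)) * CARD('a) ^ (n - snd x * degree (fst x)))"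
    unfolding Z_def using prime_power_pairs_sum(2)[where 'a = 'a]
    by (intro sum.UNION_disjoint) (auto simp: prime_power_pairs_def)
  also have "\<dots> = (\<Sum>m = 1..n. CARD('a) ^ (n - m) * (\<Sum>(P, k)\<in>prime_power_pairs m. degree (P :: 'a poly)))"
    unfolding sum_distrib_left
    by (intro sum.cong refl) (auto simp: prime_power_pairs_def case_prod_unfold)
  finally show ?thesis .
qed

text \<open>Gauss's formula. Subtracting q times the convolution identity for n from the one for n +
  1 cancels all terms except that of degree n + 1, and leaves (n + 1) q^(n+1) - n q^(n+1) =
  q^(n+1).\<close>

theorem sum_divisors_irreds:
  assumes "m \<ge> 1"
  shows "(\<Sum>d | d dvd m. d * card (irreds_of_degree d :: 'a::{field,finite} poly set)) = CARD('a) ^ m"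
proof -
  obtain n where m: "m = Suc n" using assms by (cases m) auto
  define L where "L = (\<lambda>m. \<Sum>(P, k)\<in>prime_power_pairs m. degree (P :: 'a poly))"
  have "Suc n * CARD('a) ^ Suc n = (\<Sum>m = 1..Suc n. CARD('a) ^ (Suc n - m) * L m)"
    using mangoldt_convolution[of "Suc n", where 'a = 'a] by (simp add: L_def)
  also have "\<dots> = (\<Sum>m = 1..n. CARD('a) ^ (Suc n - m) * L m) + L (Suc n)" by simp
  also have "(\<Sum>m = 1..n. CARD('a) ^ (Suc n - m) * L m) = CARD('a) * (\<Sum>m = 1..n. CARD('a) ^ (n - m) * L m)"
    unfolding sum_distrib_left by (intro sum.cong refl) (auto simp: Suc_diff_le)
  also have "\<dots> = CARD('a) * (n * CARD('a) ^ n)"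
    using mangoldt_convolution[of n, where 'a = 'a] by (simp add: L_def)
  finally have "L (Suc n) = CARD('a) ^ Suc n" by (simp add: algebra_simps)
  then show ?thesis using prime_power_pairs_sum(1)[OF assms, where 'a = 'a] by (simp add: m L_def)
qed

section \<open>Euler products over primes of bounded total degree\<close>

lemma card_field_ge_2: "CARD('a::{field,finite}) \<ge> 2"
  using card_mono[of "UNIV :: 'a set" "{0, 1}"] by simp

lemma card_irreds_of_degree_1: "card (irreds_of_degree 1 :: 'a::{field,finite} poly set) = CARD('a)"
  using sum_divisors_irreds[of 1, where 'a = 'a] by simp

lemma card_irreds_le:
  "d * card (irreds_of_degree d :: 'a::{field,finite} poly set) \<le> CARD('a) ^ d"
proof (cases "d \<ge> 1")
  case True
  have "d * card (irreds_of_degree d :: 'a poly set)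
      \<le> (\<Sum>i | i dvd d. i * card (irreds_of_degree i :: 'a poly set))"
    using True by (intro member_le_sum) auto
  then show ?thesis using sum_divisors_irreds[OF True, where 'a = 'a] by simp
qed (cases d, auto)

text \<open>The divisor 1 accounts for the q linear primes. This small saving gives at most (q^d -
  1)/d primes of degree \<open>d\<close>, which cancels the denominator in -ln(1 - q^-d) \<le>
  1/(q^d - 1) and leaves exactly the harmonic term 1/d.\<close>

lemma card_irreds_add_le:
  assumes "d \<ge> 2"
  shows "d * card (irreds_of_degree d :: 'a::{field,finite} poly set) + CARD('a) \<le> CARD('a) ^ d"
proof -
  have "(\<Sum>i\<in>{1, d}. i * card (irreds_of_degree i :: 'a poly set))
      \<le> (\<Sum>i | i dvd d. i * card (irreds_of_degree i :: 'a poly set))"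
    using assms by (intro sum_mono2) auto
  then show ?thesis
    using sum_divisors_irreds[of d, where 'a = 'a] assms card_irreds_of_degree_1[where 'a = 'a] by simp
qed

text \<open>The primes of degree at most \<open>t\<close> already use up total degree q^t. A set of
  primes of total degree D thus has only D - q^t left to spend beyond them.\<close>

lemma sum_irreds_ge:
  assumes "t \<ge> 1"
  shows "CARD('a) ^ t \<le> (\<Sum>i = 1..t. i * card (irreds_of_degree i :: 'a::{field,finite} poly set))"
proof -
  have "(\<Sum>i | i dvd t. i * card (irreds_of_degree i :: 'a poly set))
      \<le> (\<Sum>i = 1..t. i * card (irreds_of_degree i :: 'a poly set))"
    using assms by (intro sum_mono2) (auto dest: dvd_imp_le intro!: Suc_leI Nat.gr0I)
  then show ?thesis using sum_divisors_irreds[OF assms, where 'a = 'a] by simp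
qed

text \<open>Proper divisors of \<open>n\<close> are at most \<open>n div 2\<close>, so their
  contribution to Gauss's formula is bounded by a geometric sum below 2 q^(n div 2).\<close>

lemma card_irreds_gt:
  assumes "n \<ge> 1"
  shows "CARD('a) ^ n < n * card (irreds_of_degree n :: 'a::{field,finite} poly set) + 2 * CARD('a) ^ (n div 2)"
proof -
  define c where "c = (\<lambda>d. d * card (irreds_of_degree d :: 'a poly set))"
  have geo: "(\<Sum>d = 1..m. CARD('a) ^ d) < 2 * CARD('a) ^ m" for m
  proof (induction m)
    case (Suc m)
    have "2 * CARD('a) ^ m \<le> CARD('a) ^ Suc m"
      unfolding power_Suc using card_field_ge_2[where 'a = 'a] by (rule mult_right_mono) simp
    moreover have "(\<Sum>d = 1..Suc m. CARD('a) ^ d) = (\<Sum>d = 1..m. CARD('a) ^ d) + CARD('a) ^ Suc m"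
      by simp
    ultimately show ?case using Suc by linarith
  qed simp
  have "{d. d dvd n} \<subseteq> insert n {1..n div 2}"
  proof
    fix d assume "d \<in> {d. d dvd n}"
    then obtain k where k: "n = d * k" by auto
    show "d \<in> insert n {1..n div 2}"
    proof (cases "k \<ge> 2")
      case True
      then have "d * 2 \<le> n" using k by simp
      then have "d \<le> n div 2" by simp
      moreover have "d \<ge> 1" using k assms by (cases d) auto
      ultimately show ?thesis by simp
    next
      case False
      then have "k = 1" using k assms by (cases k) auto
      then show ?thesis using k by simp
    qed
  qed
  then have "(\<Sum>d | d dvd n. c d) \<le> (\<Sum>d\<in>insert n {1..n div 2}. c d)"
    by (intro sum_mono2) auto
  also have "\<dots> = c n + (\<Sum>d = 1..n div 2. c d)"
    using assms by (subst sum.insert) auto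
  also have "(\<Sum>d = 1..n div 2. c d) \<le> (\<Sum>d = 1..n div 2. CARD('a) ^ d)"
    using card_irreds_le[where 'a = 'a] by (intro sum_mono) (auto simp: c_def)
  also have "\<dots> < 2 * CARD('a) ^ (n div 2)" by (rule geo)
  finally show ?thesis using sum_divisors_irreds[OF assms, where 'a = 'a] by (simp add: c_def)
qed

text \<open>exp(harm t) is e^\<gamma> (t + 1/2) up to a small error, and e^\<gamma> / 2 is about
  0.89, so the summand 1 absorbs it. For \<open>t \<ge> 2\<close> the shift 1/2 grows at most to 1/2
  + 1/24 < 11/20, and e^\<gamma> * 11/20 is still below 1.\<close>

lemma exp_harm_le: "exp (harm t) \<le> 1 + exp euler_mascheroni * real t"
proof -
  have g: "exp euler_mascheroni \<ge> (1.74 :: real)"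
  proof -
    have "1 + 19/33 + (19/33)\<^sup>2 / 2 \<le> exp (19/33 :: real)"
      by (rule exp_lower_Taylor_quadratic) simp
    also have "\<dots> \<le> exp euler_mascheroni" using euler_mascheroni_gt_19_over_33 by simp
    finally show ?thesis by (simp add: power2_eq_square)
  qed
  have g': "exp euler_mascheroni * (11/20) \<le> (1 :: real)"
  proof -
    have "(11/20 :: real) \<le> (1 - (13/22) / real 64) ^ 64"
      by (simp add: power_divide)
    also have "\<dots> \<le> exp (- (13/22))"
      by (rule exp_ge_one_minus_x_over_n_power_n) auto
    also have "\<dots> \<le> exp (- euler_mascheroni)" using euler_mascheroni_less_13_over_22 by simp
    finally have "exp euler_mascheroni * (11/20) \<le> exp euler_mascheroni * exp (- euler_mascheroni :: real)"
      by (intro mult_left_mono) auto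
    then show ?thesis by (simp flip: exp_add)
  qed
  \<comment> \<open>At t = 1 the expansion would need e^\<gamma> (1/2 + 1/16) \<le> 1, which
    narrowly fails; this case is checked directly from e < 2.72.\<close>
  consider "t = 0" | "t = 1" | n where "t = Suc n" "n \<ge> 1"
  proof (cases t)
    case (Suc n)
    then show ?thesis using that by (cases n) auto
  qed
  then show ?thesis
  proof cases
    case 1
    then show ?thesis by (simp add: harm_def)
  next
    case 2
    have "exp 1 \<le> (2.72 :: real)" using e_less_272 by simp
    then show ?thesis using 2 g by (simp add: harm_expand)
  next
    case 3
    define x :: real where "x = 1 / (2 * (real t + 1))"
    have x: "0 < x" "x \<le> 1/6" using 3 by (auto simp: x_def field_simps)
    have tx: "(real t + 1) * x = 1/2" using x by (simp add: x_def field_simps)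
    have "harm t - ln (real t + 1) + x \<le> euler_mascheroni"
      using euler_mascheroni_lower[of n] 3 by (simp add: x_def algebra_simps)
    then have "harm t \<le> euler_mascheroni + ln (real t + 1) + (- x)" by simp
    then have "exp (harm t) \<le> exp (euler_mascheroni + ln (real t + 1) + (- x))"
      by (subst exp_le_cancel_iff)
    then have "exp (harm t) \<le> exp euler_mascheroni * (real t + 1) * exp (- x)"
      by (simp only: exp_add exp_ln)
    also have "\<dots> \<le> exp euler_mascheroni * (real t + 1) * (1 - x + x\<^sup>2 / 2)"
    proof -
      have pos: "0 < 1 + x + x\<^sup>2 / 2" using x by (simp add: add_pos_nonneg)
      have "exp (- x) * (1 + x + x\<^sup>2 / 2) \<le> exp (- x) * exp x"
        using exp_lower_Taylor_quadratic[of x] x by (intro mult_left_mono) auto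
      also have "\<dots> = 1" by (simp flip: exp_add)
      \<comment> \<open>The quartic 1 + x^4/4 factors into the Taylor quadratics of e^-x and e^x,
        which turns the lower bound for e^x into an upper bound for e^-x.\<close>
      also have "1 \<le> 1 + x ^ 4 / 4" by simp
      also have "\<dots> = (1 - x + x\<^sup>2 / 2) * (1 + x + x\<^sup>2 / 2)"
        by (simp add: algebra_simps power2_eq_square power4_eq_xxxx)
      finally have "exp (- x) \<le> 1 - x + x\<^sup>2 / 2"
        using pos mult_le_cancel_right_pos by blast
      then show ?thesis by (intro mult_left_mono) auto
    qed
    also have "(real t + 1) * (1 - x + x\<^sup>2 / 2) = real t + 1 - 1/2 + x / 4"
    proof -
      have "(real t + 1) * (1 - x + x\<^sup>2 / 2) = (real t + 1) - (real t + 1) * x + ((real t + 1) * x) * x / 2"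
        by (simp add: algebra_simps power2_eq_square add_divide_distrib)
      then show ?thesis unfolding tx by simp
    qed
    then have "exp euler_mascheroni * (real t + 1) * (1 - x + x\<^sup>2 / 2)
        \<le> exp euler_mascheroni * (real t + 11/20)"
      unfolding mult.assoc using x by (intro mult_left_mono) auto
    also have "\<dots> \<le> 1 + exp euler_mascheroni * real t" using g' by (simp add: algebra_simps)
    finally show ?thesis .
  qed
qed

definition euler_factor :: "'a::{field,finite} poly \<Rightarrow> real" where
  "euler_factor P = 1 / (1 - 1 / real CARD('a) ^ degree P)"

text \<open>The Euler product over a set of primes of total degree \<open>D\<close> is largest when the set consists
  of the primes of smallest degree. Mertens' estimate \<open>exp (harm t)\<close> for the primes of degree at most
  \<open>t\<close> together with interpolation between consecutive powers \<open>q ^ t\<close> and \<open>q ^ (t + 1)\<close> of the field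
  size gives the bound.\<close>

lemma prod_euler_factor_le:
  fixes S :: "'a::{field,finite} poly set" and D :: real
  defines "q \<equiv> real CARD('a)"
  assumes S: "finite S" "S \<subseteq> monic_irreds" "real (sum degree S) \<le> D"
    and D: "q ^ t \<le> D" "D \<le> q ^ Suc t"
  shows "(\<Prod>P\<in>S. euler_factor P)
    \<le> q / (q - 1) * (1 + exp euler_mascheroni * (real t + (D - q ^ t) / (q ^ Suc t - q ^ t)))"
proof -
  have q2: "q \<ge> 2" using card_field_ge_2[where 'a = 'a] by (simp add: q_def)
  define w where "w = (\<lambda>d. - ln (1 - 1 / q ^ d))"
  define z where "z = (D - q ^ t) / (q ^ Suc t - q ^ t)"
  define c where "c = (\<lambda>d. real (card (irreds_of_degree d :: 'a poly set)))"
  have qd: "q ^ d \<ge> 2" if "d \<ge> 1" for d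
    using power_increasing[OF that, of q] q2 by simp
  have x: "0 < 1 / q ^ d" "1 / q ^ d \<le> 1/2" if "d \<ge> 1" for d
    using qd[OF that] by (auto simp: field_simps)
  have w_anti: "w e \<le> w d" if "1 \<le> d" "d \<le> e" for d e
  proof -
    have "1 / q ^ e \<le> 1 / q ^ d" using that q2 by (intro divide_left_mono power_increasing) auto
    then show ?thesis using x(2)[of d] x(2)[of e] that by (simp add: w_def)
  qed
  have w_le: "w d \<le> 1 / (q ^ d - 1)" if "d \<ge> 1" for d
  proof -
    have "w d = ln (1 / (1 - 1 / q ^ d))" using x[OF that] by (simp add: w_def ln_div)
    also have "\<dots> \<le> 1 / (1 - 1 / q ^ d) - 1" using x[OF that] by (intro ln_le_minus_one) auto
    also have "\<dots> = 1 / (q ^ d - 1)" using qd[OF that] q2 by (simp add: field_simps)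
    finally show ?thesis .
  qed
  have w_pos: "0 \<le> w d" if "d \<ge> 1" for d
    using x[OF that] by (simp add: w_def)
  have w1: "w 1 = ln (q / (q - 1))"
    using q2 by (simp add: w_def ln_div field_simps flip: ln_inverse)
  have qt: "q ^ t < q ^ Suc t" "1 \<le> q ^ t" using q2 by (auto intro: power_strict_increasing)
  have z: "0 \<le> z" "z \<le> 1" using D qt by (auto simp: z_def field_simps)
  have degS: "degree P \<ge> 1" if "P \<in> S" for P using that S monic_irredsD(4) by auto
  have ef_pos: "euler_factor P > 0" if "P \<in> S" for P
    using x[OF degS[OF that]] by (simp add: euler_factor_def q_def)
  have lnG: "ln (\<Prod>P\<in>S. euler_factor P) = (\<Sum>P\<in>S. w (degree P))"
  proof -
    have "ln (\<Prod>P\<in>S. euler_factor P) = (\<Sum>P\<in>S. ln (euler_factor P))"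
      using S(1) ef_pos by (subst ln_prod) force+
    also have "\<dots> = (\<Sum>P\<in>S. w (degree P))"
      using x degS by (intro sum.cong refl) (simp add: euler_factor_def w_def q_def ln_div)
    finally show ?thesis .
  qed
  have main: "(\<Sum>P\<in>S. w (degree P)) \<le> ln (q / (q - 1)) + (harm t + z / real (Suc t))"
  proof (cases "t = 0")
    case True
    \<comment> \<open>For t = 0 the slope is \<open>w 1\<close> itself. Only the excess D - 1 is
      weakened to slope 1/(q - 1), so the part equal to ln(q/(q-1)) is kept exactly.\<close>
    have "(\<Sum>P\<in>S. w (degree P)) \<le> (\<Sum>P\<in>S. w 1 * real (degree P))"
    proof (rule sum_mono)
      fix P assume "P \<in> S"
      then have "w (degree P) \<le> w 1" "1 \<le> real (degree P)" using w_anti[of 1] degS by auto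
      moreover have "w 1 * 1 \<le> w 1 * real (degree P)"
        using w_pos[of 1] calculation by (intro mult_left_mono) auto
      ultimately show "w (degree P) \<le> w 1 * real (degree P)" by simp
    qed
    also have "\<dots> = w 1 * real (sum degree S)" by (simp add: sum_distrib_left)
    also have "\<dots> \<le> w 1 * D" using S(3) w_pos[of 1] by (intro mult_left_mono) auto
    also have "\<dots> = w 1 + w 1 * (D - 1)" by (simp add: algebra_simps)
    also have "w 1 * (D - 1) \<le> 1 / (q - 1) * (D - 1)"
      using w_le[of 1] D True by (intro mult_right_mono) auto
    finally show ?thesis using True w1 by (simp add: z_def harm_def)
  next
    case False
    then have t: "t \<ge> 1" by simp
    \<comment> \<open>The price of one unit of degree, as a Lagrange multiplier:
      \<open>w d - v * d\<close> is nonnegative for d \<le> t and nonpositive for d > t, so the sum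
      of these differences is largest for the set \<open>B\<close> of all primes of degree at most
      t.\<close>
    define v where "v = w (Suc t) / real (Suc t)"
    have v0: "v \<ge> 0" using w_pos by (simp add: v_def)
    have wv: "w (Suc t) = v * real (Suc t)" by (simp add: v_def)
    define B where "B = (\<Union>i\<in>{1..t}. irreds_of_degree i :: 'a poly set)"
    have finB: "finite B" by (auto simp: B_def)
    have neg: "w (degree P) - v * real (degree P) \<le> 0" if "P \<in> S - B" for P
    proof -
      have "degree P \<ge> Suc t" using that S degS[of P] by (auto simp: B_def irreds_of_degree_def)
      then have "w (degree P) \<le> w (Suc t)" "v * real (Suc t) \<le> v * real (degree P)"
        using w_anti[of "Suc t"] v0 by (auto intro: mult_left_mono)
      then show ?thesis using wv by simp
    qed
    have pos: "w i - v * real i \<ge> 0" if "i \<in> {1..t}" for i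
    proof -
      have "w (Suc t) \<le> w i" "v * real i \<le> v * real (Suc t)"
        using that w_anti[of i "Suc t"] v0 by (auto intro: mult_left_mono)
      then show ?thesis using wv by simp
    qed
    have "(\<Sum>P\<in>S. w (degree P)) = (\<Sum>P\<in>S. w (degree P) - v * real (degree P)) + v * real (sum degree S)"
      by (simp add: sum_subtractf sum_distrib_left)
    also have "(\<Sum>P\<in>S. w (degree P) - v * real (degree P))
        \<le> (\<Sum>P\<in>S \<inter> B. w (degree P) - v * real (degree P))"
      using sum.Int_Diff[OF S(1), of "\<lambda>P. w (degree P) - v * real (degree P)" B]
        sum_nonpos[of "S - B" "\<lambda>P. w (degree P) - v * real (degree P)"] neg by simp
    also have "\<dots> \<le> (\<Sum>P\<in>B. w (degree P) - v * real (degree P))"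
      using finB pos by (intro sum_mono2) (auto simp: B_def irreds_of_degree_def)
    also have "\<dots> = (\<Sum>i = 1..t. \<Sum>P\<in>(irreds_of_degree i :: 'a poly set). w (degree P) - v * real (degree P))"
      unfolding B_def
      by (rule sum.UNION_disjoint) (use finite_irreds_of_degree in \<open>auto simp: irreds_of_degree_def\<close>)
    also have "\<dots> = (\<Sum>i = 1..t. c i * (w i - v * real i))"
      by (intro sum.cong refl) (simp add: irreds_of_degree_def c_def)
    also have "\<dots> = (\<Sum>i = 1..t. c i * w i) - v * (\<Sum>i = 1..t. real i * c i)"
      by (simp add: algebra_simps sum_subtractf sum_distrib_left)
    also have "(\<Sum>i = 1..t. c i * w i) \<le> ln (q / (q - 1)) + harm t"
      using t
    proof (induction t rule: dec_induct)
      case base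
      \<comment> \<open>One copy of \<open>w 1\<close> = ln(q/(q-1)) is set aside; it becomes the
        factor q/(q-1), and the other q - 1 linear primes give the harmonic term 1.\<close>
      have "q * w 1 = w 1 + (q - 1) * w 1" by (simp add: algebra_simps)
      also have "(q - 1) * w 1 \<le> 1" using w_le[of 1] q2 by (simp add: field_simps)
      finally show ?case
        using card_irreds_of_degree_1[where 'a = 'a] w1 by (simp add: c_def harm_expand q_def)
    next
      case (step n)
      have "real (Suc n * card (irreds_of_degree (Suc n) :: 'a poly set) + CARD('a)) \<le> real (CARD('a) ^ Suc n)"
        using card_irreds_add_le[of "Suc n", where 'a = 'a] step by (intro of_nat_mono) auto
      then have le: "c (Suc n) * real (Suc n) \<le> q ^ Suc n - 1"
        using q2 by (simp add: c_def q_def algebra_simps)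
      have "c (Suc n) * w (Suc n) \<le> c (Suc n) * (1 / (q ^ Suc n - 1))"
        using w_le[of "Suc n"] by (intro mult_left_mono) (auto simp: c_def)
      also have "\<dots> \<le> 1 / real (Suc n)"
        using le qd[of "Suc n"] by (simp add: divide_simps mult.commute del: power_Suc)
      finally have "c (Suc n) * w (Suc n) \<le> inverse (real (Suc n))" by (simp add: inverse_eq_divide)
      then show ?case using step by (simp add: harm_Suc del: of_nat_Suc)
    qed
    finally have upper: "(\<Sum>P\<in>S. w (degree P)) \<le> ln (q / (q - 1)) + harm t
        - v * (\<Sum>i = 1..t. real i * c i) + v * real (sum degree S)" by simp
    have "v * q ^ t \<le> v * (\<Sum>i = 1..t. real i * c i)"
    proof (intro mult_left_mono v0)
      have "real (CARD('a) ^ t) \<le> real (\<Sum>i = 1..t. i * card (irreds_of_degree i :: 'a poly set))"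
        using sum_irreds_ge[OF t, where 'a = 'a] by (rule of_nat_mono)
      then show "q ^ t \<le> (\<Sum>i = 1..t. real i * c i)" by (simp add: c_def q_def)
    qed
    moreover have "v * real (sum degree S) \<le> v * D" using v0 S(3) by (intro mult_left_mono)
    ultimately have "(\<Sum>P\<in>S. w (degree P)) \<le> ln (q / (q - 1)) + harm t + v * (D - q ^ t)"
      using upper by (simp add: algebra_simps)
    also have "v * (D - q ^ t) \<le> (1 / (q ^ Suc t - q ^ t) / real (Suc t)) * (D - q ^ t)"
    proof (rule mult_right_mono)
      have "w (Suc t) \<le> 1 / (q ^ Suc t - 1)" by (rule w_le) simp
      also have "\<dots> \<le> 1 / (q ^ Suc t - q ^ t)" using qt by (intro divide_left_mono mult_pos_pos) (auto simp del: power_Suc)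
      finally show "v \<le> 1 / (q ^ Suc t - q ^ t) / real (Suc t)"
        unfolding v_def by (intro divide_right_mono) auto
    qed (use D in simp)
    also have "\<dots> = z / real (Suc t)" by (simp add: z_def)
    finally show ?thesis by simp
  qed
  have "(\<Prod>P\<in>S. euler_factor P) > 0"
    using ef_pos by (intro prod_pos) auto
  then have "(\<Prod>P\<in>S. euler_factor P) = exp (\<Sum>P\<in>S. w (degree P))" by (simp flip: lnG)
  also have "\<dots> \<le> exp (ln (q / (q - 1)) + (harm t + z / real (Suc t)))" using main by simp
  also have "\<dots> = q / (q - 1) * exp (harm t + z / real (Suc t))"
    using q2 by (subst exp_add) simp
  finally have G: "(\<Prod>P\<in>S. euler_factor P) \<le> q / (q - 1) * exp (harm t + z / real (Suc t))" .
  have "exp (harm t + z / real (Suc t)) \<le> 1 + exp euler_mascheroni * (real t + z)"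
  proof -
    \<comment> \<open>The exponent lies between two consecutive harmonic numbers, so by convexity of
      exp it suffices to know the bound at the integers t and t + 1.\<close>
    have "harm t + z / real (Suc t) = (1 - z) *\<^sub>R harm t + z *\<^sub>R harm (Suc t)"
      by (simp add: harm_Suc algebra_simps divide_inverse)
    then have "exp (harm t + z / real (Suc t)) \<le> (1 - z) * exp (harm t) + z * exp (harm (Suc t))"
      using convex_onD[OF exp_convex z, of "harm t" "harm (Suc t)"] by simp
    also have "\<dots> \<le> (1 - z) * (1 + exp euler_mascheroni * real t)
        + z * (1 + exp euler_mascheroni * real (Suc t))"
      using z by (intro add_mono mult_left_mono exp_harm_le) auto
    also have "\<dots> = 1 + exp euler_mascheroni * (real t + z)" by (simp add: algebra_simps)
    finally show ?thesis .
  qed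
  then have "q / (q - 1) * exp (harm t + z / real (Suc t))
      \<le> q / (q - 1) * (1 + exp euler_mascheroni * (real t + z))"
    using q2 by (intro mult_left_mono) auto
  with G show ?thesis by (simp add: z_def)
qed

text \<open>For \<open>D \<le> q\<close> the interpolation used in \<open>prod_euler_factor_le\<close> is the linear one, which is what
  makes the error term small when the field is large.\<close>

lemma prod_euler_factor_le_linear:
  fixes S :: "'a::{field,finite} poly set" and D :: real
  defines "q \<equiv> real CARD('a)"
  assumes "finite S" "S \<subseteq> monic_irreds" "real (sum degree S) \<le> D" "1 \<le> D" "D \<le> q"
  shows "(\<Prod>P\<in>S. euler_factor P) \<le> q / (q - 1) * (1 + exp euler_mascheroni * (D / q))"
proof -
  have q2: "q \<ge> 2" using card_field_ge_2[where 'a = 'a] by (simp add: q_def)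
  have "(D - 1) / (q - 1) \<le> D / q" using assms(6) q2 by (simp add: field_simps)
  moreover have "(\<Prod>P\<in>S. euler_factor P)
      \<le> q / (q - 1) * (1 + exp euler_mascheroni * ((D - 1) / (q - 1)))"
    using prod_euler_factor_le[of S D 0] assms by simp
  ultimately show ?thesis
    using q2 by (elim order_trans) (intro mult_left_mono add_left_mono, auto)
qed

text \<open>With \<open>t\<close> the integer part of log_q D, the interpolated value t + z is the
  chord of log_q between q^t and q^(t+1), and the chord lies below the concave logarithm.\<close>

lemma prod_euler_factor_le_log:
  fixes S :: "'a::{field,finite} poly set" and D :: real
  defines "q \<equiv> real CARD('a)"
  assumes "finite S" "S \<subseteq> monic_irreds" "real (sum degree S) \<le> D" "1 \<le> D"
  shows "(\<Prod>P\<in>S. euler_factor P) \<le> q / (q - 1) * (1 + exp euler_mascheroni * (ln D / ln q))"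
proof -
  have q2: "q \<ge> 2" using card_field_ge_2[where 'a = 'a] by (simp add: q_def)
  define t where "t = nat \<lfloor>log q D\<rfloor>"
  have l0: "log q D \<ge> 0" using assms(5) q2 by simp
  then have t: "real t \<le> log q D" "log q D \<le> real (Suc t)" by (auto simp: t_def) linarith
  have D: "q ^ t \<le> D" "D \<le> q ^ Suc t"
    using t assms(5) q2 by (auto simp: le_log_iff log_le_iff powr_realpow simp del: power_Suc of_nat_Suc)
  define z where "z = (D - q ^ t) / (q ^ Suc t - q ^ t)"
  have qt: "q ^ t < q ^ Suc t" "1 \<le> q ^ t" using q2 by (auto intro: power_strict_increasing)
  have z: "0 \<le> z" "z \<le> 1" using D qt by (auto simp: z_def field_simps)
  have "D = (1 - z) *\<^sub>R q ^ t + z *\<^sub>R q ^ Suc t"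
  proof -
    have "z * (q ^ Suc t - q ^ t) = D - q ^ t" using qt by (simp add: z_def)
    then show ?thesis by (simp add: algebra_simps)
  qed
  then have "ln D \<ge> (1 - z) * ln (q ^ t) + z * ln (q ^ Suc t)"
    using concave_onD[OF ln_concave z, of "q ^ t" "q ^ Suc t"] q2 by simp
  also have "(1 - z) * ln (q ^ t) + z * ln (q ^ Suc t) = (real t + z) * ln q"
    using q2 by (simp add: ln_realpow algebra_simps del: power_Suc)
  finally have "real t + z \<le> ln D / ln q" using q2 by (simp add: field_simps)
  moreover have "(\<Prod>P\<in>S. euler_factor P)
      \<le> q / (q - 1) * (1 + exp euler_mascheroni * (real t + z))"
    using prod_euler_factor_le[of S D t] assms D by (simp add: z_def)
  ultimately show ?thesis
    using q2 by (elim order_trans) (intro mult_left_mono add_left_mono, auto)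
qed

section \<open>The sieve\<close>

text \<open>Selberg's sieve in the form of Bessel's inequality. The functions \<open>\<psi>\<close> have mean zero on residues
  modulo \<open>P\<close> and equal \<open>1\<close> outside \<open>\<Omega> P\<close>, so their products over sets of primes of total degree at most
  \<open>Q\<close> are orthogonal, and a suitable combination of them is constant on the sifted set.\<close>

lemma selberg_sieve:
  fixes Ps :: "'a::{field,finite} poly set" and \<Omega> :: "'a poly \<Rightarrow> 'a poly set" and Q n :: nat
  defines "h \<equiv> \<lambda>P. real (card (\<Omega> P)) / (real CARD('a) ^ degree P - real (card (\<Omega> P)))"
  assumes Ps: "finite Ps" "Ps \<subseteq> monic_irreds"
    and \<Omega>: "\<And>P. P \<in> Ps \<Longrightarrow> \<Omega> P \<subseteq> polys_below (degree P)" "\<And>P. P \<in> Ps \<Longrightarrow> \<Omega> P \<noteq> {}"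
      "\<And>P. P \<in> Ps \<Longrightarrow> card (\<Omega> P) < CARD('a) ^ degree P"
    and Q: "2 * Q \<le> n"
  shows "real (card {f \<in> monics n. \<forall>P\<in>Ps. f mod P \<notin> \<Omega> P})
    * (\<Sum>I | I \<subseteq> Ps \<and> sum degree I \<le> Q. \<Prod>P\<in>I. h P) \<le> real CARD('a) ^ n"
proof -
  define q where "q = real CARD('a)"
  have q2: "q \<ge> 2" using card_field_ge_2[where 'a = 'a] by (simp add: q_def)
  \<comment> \<open>The value on the removed residues is forced by mean zero: 1/h is the number of
    kept residues over the number of removed ones. The second moment then comes out as 1/h.\<close>
  define \<psi> where "\<psi> = (\<lambda>P r. if r \<in> \<Omega> P then - 1 / h P else 1)"
  define \<I> where "\<I> = {I. I \<subseteq> Ps \<and> sum degree I \<le> Q}"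
  define L where "L = (\<Sum>I\<in>\<I>. \<Prod>P\<in>I. h P)"
  define T where "T = (\<lambda>f. \<Sum>I\<in>\<I>. (\<Prod>P\<in>I. h P) * (\<Prod>P\<in>I. \<psi> P (f mod P)))"
  define F where "F = {f \<in> monics n. \<forall>P\<in>Ps. f mod P \<notin> \<Omega> P}"
  have finI: "finite \<I>" using Ps by (auto simp: \<I>_def intro: finite_subset[of _ "Pow Ps"])
  have finM: "finite (monics n :: 'a poly set)" using card_monics by auto
  have fin\<Omega>: "finite (\<Omega> P)" if "P \<in> Ps" for P
    using \<Omega>(1)[OF that] card_polys_below finite_subset by blast
  have card\<Omega>: "0 < real (card (\<Omega> P))" "real (card (\<Omega> P)) < q ^ degree P" if "P \<in> Ps" for P
  proof -
    show "0 < real (card (\<Omega> P))" using \<Omega>(2)[OF that] fin\<Omega>[OF that] by (simp add: card_gt_0_iff)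
    have "real (card (\<Omega> P)) < real (CARD('a) ^ degree P)"
      using \<Omega>(3)[OF that] by (simp only: of_nat_less_iff)
    then show "real (card (\<Omega> P)) < q ^ degree P" by (simp add: q_def)
  qed
  have h_pos: "0 < h P" if "P \<in> Ps" for P
    using card\<Omega>[OF that] by (simp add: h_def q_def)
  have mean: "(\<Sum>r\<in>polys_below (degree P). \<psi> P r) / q ^ degree P = 0"
    "(\<Sum>r\<in>polys_below (degree P). (\<psi> P r)\<^sup>2) / q ^ degree P = 1 / h P" if P: "P \<in> Ps" for P
  proof -
    let ?R = "polys_below (degree P) :: 'a poly set" and ?w = "real (card (\<Omega> P))"
    have finR: "finite ?R" and cardR: "real (card ?R) = q ^ degree P"
      using card_polys_below[of "degree P", where 'a = 'a] by (auto simp: q_def)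
    have split: "(\<Sum>r\<in>?R. g (\<psi> P r)) = ?w * g (- 1 / h P) + (q ^ degree P - ?w) * g 1"
      for g :: "real \<Rightarrow> real"
    proof -
      have "(\<Sum>r\<in>?R. g (\<psi> P r)) = (\<Sum>r\<in>\<Omega> P. g (\<psi> P r)) + (\<Sum>r\<in>?R - \<Omega> P. g (\<psi> P r))"
        using sum.subset_diff[OF \<Omega>(1)[OF P] finR, of "\<lambda>r. g (\<psi> P r)"] by simp
      also have "(\<Sum>r\<in>\<Omega> P. g (\<psi> P r)) = ?w * g (- 1 / h P)" by (simp add: \<psi>_def)
      also have "(\<Sum>r\<in>?R - \<Omega> P. g (\<psi> P r)) = real (card (?R - \<Omega> P)) * g 1"
        by (simp add: \<psi>_def)
      also have "real (card (?R - \<Omega> P)) = q ^ degree P - ?w"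
        using card_mono[OF finR \<Omega>(1)[OF P]] fin\<Omega>[OF P] \<Omega>(1)[OF P] cardR
        by (simp add: card_Diff_subset)
      finally show ?thesis .
    qed
    have h: "1 / h P = (q ^ degree P - ?w) / ?w" by (simp add: h_def q_def)
    have "(\<Sum>r\<in>?R. \<psi> P r) = 0"
      using split[of "\<lambda>x. x"] card\<Omega>[OF P] h by simp
    then show "(\<Sum>r\<in>?R. \<psi> P r) / q ^ degree P = 0" by simp
    have "(\<Sum>r\<in>?R. (\<psi> P r)\<^sup>2) = ?w * (1 / h P)\<^sup>2 + (q ^ degree P - ?w)"
      using split[of "\<lambda>x. x\<^sup>2"] by (simp add: power_divide)
    also have "\<dots> = 1 / h P * q ^ degree P"
      unfolding h using card\<Omega>[OF P] by (simp add: field_simps power2_eq_square)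
    finally show "(\<Sum>r\<in>?R. (\<psi> P r)\<^sup>2) / q ^ degree P = 1 / h P" using q2 by simp
  qed
  \<comment> \<open>The primes of \<open>I \<union> J\<close> have total degree at most 2 Q \<le> n,
    so independence holds exactly. If I and J differ, a prime lying in only one of them contributes
    a factor of mean zero.\<close>
  have orth: "(\<Sum>f\<in>monics n. (\<Prod>P\<in>I. \<psi> P (f mod P)) * (\<Prod>P\<in>J. \<psi> P (f mod P)))
      = (if I = J then q ^ n / (\<Prod>P\<in>I. h P) else 0)" if IJ: "I \<in> \<I>" "J \<in> \<I>" for I J
  proof -
    have sub: "I \<subseteq> Ps" "J \<subseteq> Ps" "sum degree I \<le> Q" "sum degree J \<le> Q"
      using IJ by (auto simp: \<I>_def)
    have fin: "finite I" "finite J" using sub Ps finite_subset by auto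
    define u where "u = (\<lambda>P r. (if P \<in> I then \<psi> P r else 1) * (if P \<in> J then \<psi> P r else 1))"
    have "sum degree (I \<union> J) \<le> sum degree I + sum degree J"
      using sum.union_inter[OF fin, of degree] by linarith
    then have deg: "sum degree (I \<union> J) \<le> n" using sub Q by linarith
    have "(\<Sum>f\<in>monics n. (\<Prod>P\<in>I. \<psi> P (f mod P)) * (\<Prod>P\<in>J. \<psi> P (f mod P)))
        = (\<Sum>f\<in>monics n. \<Prod>P\<in>I \<union> J. u P (f mod P))"
    proof (intro sum.cong refl)
      fix f :: "'a poly"
      have "(\<Prod>P\<in>I. \<psi> P (f mod P)) = (\<Prod>P\<in>I \<union> J. if P \<in> I then \<psi> P (f mod P) else 1)"
        "(\<Prod>P\<in>J. \<psi> P (f mod P)) = (\<Prod>P\<in>I \<union> J. if P \<in> J then \<psi> P (f mod P) else 1)"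
        using fin by (auto intro!: prod.mono_neutral_cong_left)
      then show "(\<Prod>P\<in>I. \<psi> P (f mod P)) * (\<Prod>P\<in>J. \<psi> P (f mod P)) = (\<Prod>P\<in>I \<union> J. u P (f mod P))"
        by (simp add: u_def prod.distrib)
    qed
    also have "\<dots> = q ^ n * (\<Prod>P\<in>I \<union> J. (\<Sum>r\<in>polys_below (degree P). u P r) / q ^ degree P)"
      using sum_monics_prod_mod[of "I \<union> J" n u] fin sub Ps deg by (auto simp: q_def)
    also have "\<dots> = (if I = J then q ^ n / (\<Prod>P\<in>I. h P) else 0)"
    proof (cases "I = J")
      case True
      have "(\<Prod>P\<in>I \<union> J. (\<Sum>r\<in>polys_below (degree P). u P r) / q ^ degree P) = (\<Prod>P\<in>I. 1 / h P)"
        using True sub mean(2) by (intro prod.cong) (auto simp: u_def power2_eq_square)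
      then show ?thesis using True by (simp add: prod_dividef)
    next
      case False
      then obtain P where P: "P \<in> I \<union> J" "\<not> (P \<in> I \<and> P \<in> J)" by auto
      then have "(\<Sum>r\<in>polys_below (degree P). u P r) / q ^ degree P = 0"
        using mean(1)[of P] sub by (auto simp: u_def)
      then have "(\<Prod>P\<in>I \<union> J. (\<Sum>r\<in>polys_below (degree P). u P r) / q ^ degree P) = 0"
        using P(1) fin by (intro prod_zero) auto
      then show ?thesis using False by simp
    qed
    finally show ?thesis .
  qed
  have hI: "(\<Prod>P\<in>I. h P) > 0" if "I \<in> \<I>" for I
    using that h_pos by (intro prod_pos) (auto simp: \<I>_def)
  have L1: "L > 0"
    unfolding L_def by (rule sum_pos2[OF finI, of "{}"]) (use hI in \<open>auto simp: \<I>_def intro: less_imp_le\<close>)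
  have "(\<Sum>f\<in>monics n. (T f)\<^sup>2)
      = (\<Sum>f\<in>monics n. \<Sum>I\<in>\<I>. \<Sum>J\<in>\<I>. (\<Prod>P\<in>I. h P) * (\<Prod>P\<in>J. h P)
          * ((\<Prod>P\<in>I. \<psi> P (f mod P)) * (\<Prod>P\<in>J. \<psi> P (f mod P))))"
    by (simp add: T_def power2_eq_square sum_product mult_ac)
  also have "\<dots> = (\<Sum>I\<in>\<I>. \<Sum>J\<in>\<I>. (\<Prod>P\<in>I. h P) * (\<Prod>P\<in>J. h P)
          * (\<Sum>f\<in>monics n. (\<Prod>P\<in>I. \<psi> P (f mod P)) * (\<Prod>P\<in>J. \<psi> P (f mod P))))"
    by (subst sum.swap, intro sum.cong refl, subst sum.swap) (simp add: sum_distrib_left)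
  also have "\<dots> = (\<Sum>I\<in>\<I>. \<Sum>J\<in>\<I>. if J = I then q ^ n * (\<Prod>P\<in>I. h P) else 0)"
    using hI by (intro sum.cong refl) (auto simp: orth less_imp_neq[symmetric])
  also have "\<dots> = q ^ n * L" using finI by (simp add: L_def sum_distrib_left)
  finally have sq: "(\<Sum>f\<in>monics n. (T f)\<^sup>2) = q ^ n * L" .
  have T: "T f = L" if "f \<in> F" for f
    unfolding T_def L_def
  proof (intro sum.cong refl)
    fix I assume "I \<in> \<I>"
    then have "(\<Prod>P\<in>I. \<psi> P (f mod P)) = 1"
      using that by (intro prod.neutral) (auto simp: \<I>_def F_def \<psi>_def)
    then show "(\<Prod>P\<in>I. h P) * (\<Prod>P\<in>I. \<psi> P (f mod P)) = (\<Prod>P\<in>I. h P)" by simp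
  qed
  \<comment> \<open>The same \<open>L\<close> is the value of \<open>T\<close> on the sifted set
    and, up to q^n, its second moment over all monics; comparing the two leaves one power of L as
    the saving.\<close>
  have "real (card F) * L\<^sup>2 = (\<Sum>f\<in>F. (T f)\<^sup>2)" by (simp add: T)
  also have "\<dots> \<le> (\<Sum>f\<in>monics n. (T f)\<^sup>2)" using finM by (intro sum_mono2) (auto simp: F_def)
  finally have "real (card F) * L * L \<le> q ^ n * L" using sq by (simp add: power2_eq_square)
  then have "real (card F) * L \<le> q ^ n" using L1 by simp
  then show ?thesis by (simp add: F_def L_def \<I>_def q_def)
qed

section \<open>Formal power series for the zeta function and the sieve sum\<close>

unbundle no vec_syntax
unbundle fps_syntax

text \<open>The expansion of 1/(1 - c X^d) for \<open>d \<ge> 1\<close>. With c = q^-d it is a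
  normalised Euler factor of the zeta function.\<close>

definition geom_fps :: "real \<Rightarrow> nat \<Rightarrow> real fps" where
  "geom_fps c d = Abs_fps (\<lambda>m. if d dvd m then c ^ (m div d) else 0)"

lemma geom_fps_eq:
  assumes "d \<ge> 1"
  shows "geom_fps c d = 1 + fps_const c * fps_X ^ d * geom_fps c d"
proof (rule fps_ext)
  fix m
  have "(fps_const c * fps_X ^ d * geom_fps c d) $ m = (if m < d then 0 else c * geom_fps c d $ (m - d))"
    by (simp add: mult.assoc fps_X_power_mult_nth)
  moreover have "d dvd m - d \<longleftrightarrow> d dvd m" "m div d = Suc ((m - d) div d)" if "m \<ge> d"
    using that assms by (auto simp: le_div_geq dvd_minus_self)
  moreover have "d dvd m \<longleftrightarrow> m = 0" if "m < d" using that by (auto dest: dvd_imp_le)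
  ultimately show "geom_fps c d $ m = (1 + fps_const c * fps_X ^ d * geom_fps c d) $ m"
    using assms by (auto simp: geom_fps_def)
qed


text \<open>The logarithmic derivative X g'/g = d (g - 1), cleared of denominators. It follows by
  differentiating g (1 - V) = 1 with V = c X^d, for which X V' = d V.\<close>

lemma geom_fps_deriv:
  "fps_X * fps_deriv (geom_fps c d) = fps_const (real d) * (geom_fps c d - 1) * geom_fps c d"
  if d: "d \<ge> 1"
proof -
  define g where "g = geom_fps c d"
  define V where "V = fps_const c * fps_X ^ d"
  have g: "g = 1 + V * g" using geom_fps_eq[OF d, of c] by (simp add: g_def V_def)
  have V: "fps_X * fps_deriv V = fps_const (real d) * V"
  proof (rule fps_ext)
    fix m
    show "(fps_X * fps_deriv V) $ m = (fps_const (real d) * V) $ m"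
      by (cases m) (auto simp: V_def)
  qed
  define D where "D = fps_X * fps_deriv g"
  have "D = fps_X * fps_deriv (1 + V * g)" using g by (simp add: D_def)
  also have "\<dots> = (fps_X * fps_deriv V) * g + V * D"
    by (simp add: algebra_simps D_def)
  finally have "D - V * D = fps_const (real d) * V * g"
    unfolding V by (metis add_diff_cancel_right')
  then have "g * (D - V * D) = g * (fps_const (real d) * V * g)" by simp
  then have "g * (1 - V) * D = fps_const (real d) * (V * g) * g"
    by (simp add: algebra_simps)
  moreover have "g * (1 - V) = 1" using g by (simp add: algebra_simps)
  moreover have "V * g = g - 1" using g by (metis add_diff_cancel_left')
  ultimately have "D = fps_const (real d) * (g - 1) * g" by (metis mult_1)
  then show ?thesis by (simp add: g_def D_def)
qed

lemma prod_geom_fps_deriv: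
  assumes "finite S" "\<And>P. P \<in> S \<Longrightarrow> d P \<ge> 1"
  shows "fps_X * fps_deriv (\<Prod>P\<in>S. geom_fps (c P) (d P))
    = (\<Prod>P\<in>S. geom_fps (c P) (d P)) * (\<Sum>P\<in>S. fps_const (real (d P)) * (geom_fps (c P) (d P) - 1))"
  using assms
proof (induction S rule: finite_induct)
  case (insert P S)
  define g where "g = geom_fps (c P) (d P)"
  define Z where "Z = (\<Prod>P\<in>S. geom_fps (c P) (d P))"
  define W where "W = (\<Sum>P\<in>S. fps_const (real (d P)) * (geom_fps (c P) (d P) - 1))"
  have "fps_X * fps_deriv (g * Z) = (fps_X * fps_deriv g) * Z + g * (fps_X * fps_deriv Z)"
    by (simp add: algebra_simps)
  also have "fps_X * fps_deriv g = fps_const (real (d P)) * (g - 1) * g"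
    using geom_fps_deriv[of "d P" "c P"] insert by (simp add: g_def)
  also have "fps_X * fps_deriv Z = Z * W" using insert by (simp add: Z_def W_def)
  also have "fps_const (real (d P)) * (g - 1) * g * Z + g * (Z * W)
      = g * Z * (fps_const (real (d P)) * (g - 1) + W)"
    by (simp add: algebra_simps)
  finally show ?case using insert.hyps by (simp add: g_def Z_def W_def)
qed simp

definition primes_upto :: "nat \<Rightarrow> 'a::field poly set" where
  "primes_upto Q = {P \<in> monic_irreds. degree P \<le> Q}"

lemma primes_upto_eq: "primes_upto Q = (\<Union>d\<in>{1..Q}. irreds_of_degree d)"
  using monic_irredsD(4) by (fastforce simp: primes_upto_def irreds_of_degree_def)

lemma finite_primes_upto [simp]: "finite (primes_upto Q :: 'a::{field,finite} poly set)"
  by (simp add: primes_upto_eq)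

text \<open>The zeta function of the polynomial ring, normalised to have all coefficients equal to \<open>1\<close>,
  truncated to primes of degree at most \<open>Q\<close>.\<close>

lemma zeta_coeff:
  fixes Q :: nat
  defines "Z \<equiv> \<Prod>P\<in>(primes_upto Q :: 'a::{field,finite} poly set). geom_fps (1 / real CARD('a) ^ degree P) (degree P)"
  assumes "m \<le> Q"
  shows "Z $ m = 1"
  using assms(2)
proof (induction m rule: less_induct)
  case (less m)
  define q where "q = real CARD('a)"
  have q2: "q \<ge> 2" using card_field_ge_2[where 'a = 'a] by (simp add: q_def)
  define S where "S = (primes_upto Q :: 'a poly set)"
  define g where "g = (\<lambda>P :: 'a poly. geom_fps (1 / q ^ degree P) (degree P))"
  \<comment> \<open>This is X Z'/Z, the von Mangoldt series scaled by q^-i. Up to degree Q the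
    truncation omits no prime, so by Gauss's formula its coefficients are 1.\<close>
  define W where "W = (\<Sum>P\<in>S. fps_const (real (degree P)) * (g P - 1))"
  have ZW: "fps_X * fps_deriv Z = Z * W"
    unfolding Z_def W_def S_def g_def q_def
    by (rule prod_geom_fps_deriv[OF finite_primes_upto])
       (use monic_irredsD(4) in \<open>auto simp: primes_upto_def\<close>)
  have W0: "W $ 0 = 0" by (simp add: W_def g_def geom_fps_def fps_sum_nth)
  have W: "W $ i = 1" if i: "1 \<le> i" "i \<le> Q" for i
  proof -
    have "W $ i = (\<Sum>P\<in>S. if degree P dvd i then real (degree P) * (1 / q ^ i) else 0)"
      unfolding W_def fps_sum_nth
    proof (intro sum.cong refl)
      fix P assume "P \<in> S"
      have "(1 / q ^ degree P) ^ (i div degree P) = 1 / q ^ i" if "degree P dvd i"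
        using that by (simp add: power_divide flip: power_mult)
      then show "(fps_const (real (degree P)) * (g P - 1)) $ i
          = (if degree P dvd i then real (degree P) * (1 / q ^ i) else 0)"
        using i by (simp add: g_def geom_fps_def)
    qed
    also have "\<dots> = (\<Sum>P\<in>{P \<in> S. degree P dvd i}. real (degree P) * (1 / q ^ i))"
      by (subst sum.inter_filter) (auto simp: S_def)
    also have "{P \<in> S. degree P dvd i} = (\<Union>d\<in>{d. d dvd i}. irreds_of_degree d)"
      using i by (auto simp: S_def primes_upto_def irreds_of_degree_def dest: dvd_imp_le)
    also have "(\<Sum>P\<in>(\<Union>d\<in>{d. d dvd i}. irreds_of_degree d :: 'a poly set). real (degree P) * (1 / q ^ i))
        = (\<Sum>d | d dvd i. \<Sum>P\<in>(irreds_of_degree d :: 'a poly set). real (degree P) * (1 / q ^ i))"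
      using i by (intro sum.UNION_disjoint)
        (use finite_irreds_of_degree in \<open>auto simp: irreds_of_degree_def\<close>)
    also have "\<dots> = (\<Sum>d | d dvd i. real (d * card (irreds_of_degree d :: 'a poly set)) * (1 / q ^ i))"
      by (intro sum.cong refl) (simp add: irreds_of_degree_def)
    also have "\<dots> = real (\<Sum>d | d dvd i. d * card (irreds_of_degree d :: 'a poly set)) * (1 / q ^ i)"
      by (simp only: sum_distrib_right of_nat_sum)
    also have "\<dots> = 1"
      using sum_divisors_irreds[OF i(1), where 'a = 'a] q2 by (simp add: q_def)
    finally show ?thesis .
  qed
  show ?case
  proof (cases m)
    case 0
    have "Z $ 0 = (\<Prod>P\<in>S. g P $ 0)"
      unfolding Z_def S_def g_def q_def by (induction rule: infinite_finite_induct) auto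
    then show ?thesis using 0 by (simp add: g_def geom_fps_def)
  next
    case (Suc m')
    \<comment> \<open>Comparing coefficients in X Z' = Z W gives a recursion that determines
      \<open>Z $ m\<close> from the smaller ones; its right-hand side is a sum of m ones.\<close>
    have "real m * Z $ m = (fps_X * fps_deriv Z) $ m" using Suc by simp
    also have "\<dots> = (\<Sum>i = 0..m. Z $ i * W $ (m - i))" by (simp add: ZW fps_mult_nth)
    also have "\<dots> = (\<Sum>i = 0..m'. Z $ i * W $ (m - i))" using Suc W0 by simp
    also have "\<dots> = (\<Sum>i = 0..m'. 1)"
      using less Suc W by (intro sum.cong refl) (simp add: Suc_diff_le)
    also have "\<dots> = real m" using Suc by simp
    finally show ?thesis using Suc by simp
  qed
qed

text \<open>Multiplication by \<open>geom_fps 1 1\<close> forms partial sums. Unlike the coefficientwise order, the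
  order of partial sums relates the Euler factor \<open>geom_fps b d\<close> to a polynomial with the same value
  at \<open>1\<close>, see \<open>geom_fps_sum_le\<close>.\<close>

definition fps_sum_le :: "real fps \<Rightarrow> real fps \<Rightarrow> bool" where
  "fps_sum_le F G \<longleftrightarrow> (\<forall>m. (F * geom_fps 1 1) $ m \<le> (G * geom_fps 1 1) $ m)"

definition fps_nonneg :: "real fps \<Rightarrow> bool" where
  "fps_nonneg F \<longleftrightarrow> (\<forall>m. F $ m \<ge> 0)"

lemma fps_nonneg_mult [intro]: "fps_nonneg F \<Longrightarrow> fps_nonneg G \<Longrightarrow> fps_nonneg (F * G)"
  by (auto simp: fps_nonneg_def fps_mult_nth intro!: sum_nonneg)

lemma fps_nonneg_add [intro]: "fps_nonneg F \<Longrightarrow> fps_nonneg G \<Longrightarrow> fps_nonneg (F + G)"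
  by (auto simp: fps_nonneg_def)

lemma fps_nonneg_basic [simp]:
  "fps_nonneg 1" "fps_nonneg (fps_X ^ k)" "c \<ge> 0 \<Longrightarrow> fps_nonneg (fps_const c)"
  "c \<ge> 0 \<Longrightarrow> fps_nonneg (geom_fps c d)"
  by (auto simp: fps_nonneg_def geom_fps_def)

lemma fps_nonneg_sum: "(\<And>i. i \<in> I \<Longrightarrow> fps_nonneg (F i)) \<Longrightarrow> fps_nonneg (sum F I)"
  by (auto simp: fps_nonneg_def fps_sum_nth intro!: sum_nonneg)

lemma fps_nonneg_prod: "(\<And>i. i \<in> I \<Longrightarrow> fps_nonneg (F i)) \<Longrightarrow> fps_nonneg (prod F I)"
  by (induction I rule: infinite_finite_induct) auto

lemma fps_sum_leI:
  assumes "fps_nonneg D" "(G - F) * geom_fps 1 1 = D" shows "fps_sum_le F G"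
  using assms by (auto simp: fps_sum_le_def fps_nonneg_def algebra_simps fps_eq_iff)

lemma fps_sum_le_trans [trans]: "fps_sum_le F G \<Longrightarrow> fps_sum_le G H \<Longrightarrow> fps_sum_le F H"
  by (auto simp: fps_sum_le_def intro: order_trans)

lemma fps_sum_le_refl [simp]: "fps_sum_le F F"
  by (simp add: fps_sum_le_def)

text \<open>Multiplication by \<open>H\<close> commutes with forming partial sums, so it only takes
  nonnegative combinations of the assumed inequalities.\<close>

lemma fps_sum_le_mult_left:
  assumes "fps_sum_le F G" "fps_nonneg H" shows "fps_sum_le (H * F) (H * G)"
  using assms unfolding fps_sum_le_def fps_nonneg_def mult.assoc fps_mult_nth[of H]
  by (auto intro!: sum_mono mult_left_mono)

lemma fps_sum_le_mult:
  assumes "fps_sum_le F G" "fps_sum_le F' G'" "fps_nonneg F'" "fps_nonneg G"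
  shows "fps_sum_le (F * F') (G * G')"
  using fps_sum_le_trans[OF fps_sum_le_mult_left[OF assms(1,3)], of "G * G'"]
    fps_sum_le_mult_left[OF assms(2,4)] by (simp add: mult.commute)

lemma fps_sum_le_prod:
  assumes "\<And>i. i \<in> I \<Longrightarrow> fps_sum_le (F i) (G i)"
    "\<And>i. i \<in> I \<Longrightarrow> fps_nonneg (F i)" "\<And>i. i \<in> I \<Longrightarrow> fps_nonneg (G i)"
  shows "fps_sum_le (prod F I) (prod G I)"
  using assms
  by (induction I rule: infinite_finite_induct) (auto intro!: fps_sum_le_mult fps_nonneg_prod)

lemma fps_sum_le_nonneg_diff:
  assumes "fps_nonneg (G - F)" shows "fps_sum_le F G"
  by (rule fps_sum_leI[OF _ refl]) (use assms in auto)

lemma geom_fps_one_mult: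
  assumes "d \<ge> 1"
  shows "geom_fps 1 1 * (1 - fps_X ^ d) = (\<Sum>i<d. fps_X ^ i)"
proof -
  have "geom_fps 1 1 * (1 - fps_X) = 1"
    using geom_fps_eq[of 1 1] by (simp add: algebra_simps)
  moreover have "(1 - fps_X ^ d :: real fps) = (1 - fps_X) * (\<Sum>i<d. fps_X ^ i)"
    by (rule one_diff_power_eq)
  ultimately show ?thesis by (metis mult.assoc mult_1)
qed

text \<open>The constant \<open>h\<close> is the value of b/(1 - b X^d) at X = 1, so the difference
  contains the factor 1 - X^d. That factor has a negative coefficient, but forming partial sums
  turns it into 1 + X + ... + X^(d-1). This is why partial sums are compared and not
  coefficients.\<close>

lemma geom_fps_defect:
  assumes "d \<ge> 1" "0 \<le> b" "b < 1"
  defines "h \<equiv> b / (1 - b)"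
  shows "(fps_const h - fps_const b * geom_fps b d) * geom_fps 1 1
    = fps_const (h * b) * geom_fps b d * (\<Sum>i<d. fps_X ^ i)"
proof -
  define g where "g = geom_fps b d"
  have g: "g = 1 + fps_const b * fps_X ^ d * g" using geom_fps_eq[OF assms(1), of b] by (simp add: g_def)
  have "h * (1 - b) = b" using assms(3) by (simp add: h_def)
  then have hb: "b = h - h * b" by (simp add: algebra_simps)
  have "fps_const h - fps_const b * g = fps_const h * (1 - g + fps_const b * g)"
    by (subst hb) (simp add: algebra_simps flip: fps_const_mult fps_const_sub)
  also have "\<dots> = fps_const h * (fps_const b * g - fps_const b * fps_X ^ d * g)"
  proof -
    have "1 - g = - (fps_const b * fps_X ^ d * g)"
      using g by (metis add_diff_cancel_left' minus_diff_eq)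
    then show ?thesis by simp
  qed
  also have "\<dots> = fps_const (h * b) * g * (1 - fps_X ^ d)"
    by (simp add: algebra_simps flip: fps_const_mult)
  finally have "(fps_const h - fps_const b * g) * geom_fps 1 1
      = fps_const (h * b) * g * (geom_fps 1 1 * (1 - fps_X ^ d))"
    by (simp add: mult_ac)
  then show ?thesis unfolding g_def geom_fps_one_mult[OF assms(1)] .
qed

text \<open>Both differences are nonnegative multiples of the defect h - b g, namely by X^d and by
  1/b; the latter requires the separate case b = 0.\<close>

lemma geom_fps_sum_le:
  assumes "d \<ge> 1" "0 \<le> b" "b < 1"
  shows "fps_sum_le (geom_fps b d) (1 + fps_const (b / (1 - b)) * fps_X ^ d)"
    and "fps_sum_le (geom_fps b d) (fps_const (1 / (1 - b)))"
proof -
  define h where "h = b / (1 - b)"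
  define g where "g = geom_fps b d"
  define D where "D = fps_const (h * b) * g * (\<Sum>i<d. fps_X ^ i)"
  have g: "g = 1 + fps_const b * fps_X ^ d * g" using geom_fps_eq[OF assms(1), of b] by (simp add: g_def)
  have h0: "h \<ge> 0" using assms by (simp add: h_def)
  have D: "(fps_const h - fps_const b * g) * geom_fps 1 1 = D"
    using geom_fps_defect[OF assms] by (simp add: D_def g_def h_def)
  have nn: "fps_nonneg D"
    unfolding D_def g_def using h0 assms by (intro fps_nonneg_mult fps_nonneg_sum) auto
  have "1 + fps_const h * fps_X ^ d - g = fps_X ^ d * (fps_const h - fps_const b * g)"
    by (subst (1) g) (simp add: algebra_simps)
  then have "(1 + fps_const h * fps_X ^ d - g) * geom_fps 1 1 = fps_X ^ d * D"
    using D by (simp add: mult.assoc)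
  then show "fps_sum_le (geom_fps b d) (1 + fps_const (b / (1 - b)) * fps_X ^ d)"
    unfolding h_def[symmetric] g_def[symmetric]
    by (rule fps_sum_leI[rotated]) (use nn in auto)
  show "fps_sum_le (geom_fps b d) (fps_const (1 / (1 - b)))"
  proof (cases "b = 0")
    case True
    have "geom_fps 0 d = 1" using geom_fps_eq[OF assms(1), of 0] by simp
    then show ?thesis using True by simp
  next
    case False
    have "fps_const (1 / (1 - b)) = fps_const (1 / b) * fps_const h"
      using False by (simp add: h_def)
    moreover have "g = fps_const (1 / b) * (fps_const b * g)"
      using False by (simp add: mult.assoc[symmetric])
    ultimately have "fps_const (1 / (1 - b)) - g = fps_const (1 / b) * (fps_const h - fps_const b * g)"
      by (simp add: right_diff_distrib)
    then have "(fps_const (1 / (1 - b)) - g) * geom_fps 1 1 = fps_const (1 / b) * D"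
      using D by (simp add: mult.assoc)
    then show ?thesis
      unfolding g_def[symmetric]
      by (rule fps_sum_leI[rotated]) (use nn assms in auto)
  qed
qed

text \<open>Since (1 - V)^2 exceeds 1 - 2 V by V^2, the square of 1/(1 - V) is coefficientwise at
  most 1/(1 - 2 V). For c = q^-d the resulting 2c/(1 - 2c) is the sieve density 2/(q^d - 2) of two
  removed residues.\<close>

lemma geom_fps_square_sum_le:
  assumes "d \<ge> 1" "0 \<le> c" "2 * c < 1"
  shows "fps_sum_le (geom_fps c d * geom_fps c d) (1 + fps_const (2 * c / (1 - 2 * c)) * fps_X ^ d)"
proof -
  define g where "g = geom_fps c d"
  define G where "G = geom_fps (2 * c) d"
  define V where "V = fps_const c * fps_X ^ d"
  have g: "g * (1 - V) = 1" using geom_fps_eq[OF assms(1), of c] by (simp add: g_def V_def algebra_simps)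
  have G: "G * (1 - 2 * V) = 1"
    using geom_fps_eq[OF assms(1), of "2 * c"]
    by (simp add: G_def V_def algebra_simps numeral_fps_const flip: fps_const_mult)
  have "G = G * (g * (1 - V)) * (g * (1 - V))" by (simp add: g)
  also have "\<dots> = (G * (1 - 2 * V)) * (g * g) + V * V * G * (g * g)"
    by (simp add: algebra_simps)
  also have "\<dots> = g * g + V * V * G * (g * g)" by (simp add: G)
  finally have "G - g * g = V * V * G * (g * g)" by (metis add_diff_cancel_left')
  then have "fps_nonneg (G - g * g)"
    using assms(2) by (simp add: V_def G_def g_def fps_nonneg_mult)
  then have "fps_sum_le (g * g) G" by (rule fps_sum_le_nonneg_diff)
  also have "fps_sum_le G (1 + fps_const (2 * c / (1 - 2 * c)) * fps_X ^ d)"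
    unfolding G_def using assms by (intro geom_fps_sum_le(1)) auto
  finally show ?thesis by (simp add: g_def)
qed

text \<open>The left-hand side is the sum of the first \<open>Q + 1\<close> coefficients of the square of the zeta function.
  At a prime in \<open>B\<close>, where only one residue class is removed, one of the two zeta factors is replaced by
  its value, the Euler factor.\<close>

lemma sieve_sum_ge:
  fixes Q :: nat and B :: "'a::{field,finite} poly set"
  defines "q \<equiv> real CARD('a)"
  defines "h \<equiv> \<lambda>P :: 'a poly. if P \<in> B then 1 / (q ^ degree P - 1) else 2 / (q ^ degree P - 2)"
  assumes B: "\<And>P :: 'a poly. P \<in> primes_upto Q \<Longrightarrow> P \<notin> B \<Longrightarrow> q ^ degree P > 2"
  shows "real (Q + 1) * real (Q + 2) / 2 \<le> (\<Prod>P\<in>primes_upto Q \<inter> B. euler_factor P)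
    * (\<Sum>I | I \<subseteq> primes_upto Q \<and> sum degree I \<le> Q. \<Prod>P\<in>I. h P)"
proof -
  define Ps where "Ps = (primes_upto Q :: 'a poly set)"
  have finPs: "finite Ps" by (simp add: Ps_def)
  have q2: "q \<ge> 2" using card_field_ge_2[where 'a = 'a] by (simp add: q_def)
  define c where "c = (\<lambda>P :: 'a poly. 1 / q ^ degree P)"
  define \<kappa> where "\<kappa> = (\<lambda>P :: 'a poly. if P \<in> B then euler_factor P else 1)"
  define g where "g = (\<lambda>P :: 'a poly. geom_fps (c P) (degree P))"
  define Z where "Z = (\<Prod>P\<in>Ps. g P)"
  have deg: "degree P \<ge> 1" if "P \<in> Ps" for P using that monic_irredsD(4) by (auto simp: Ps_def primes_upto_def)
  have qd: "q ^ degree P \<ge> 2" if "P \<in> Ps" for P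
    using power_increasing[OF deg[OF that], of q] q2 by simp
  have h0: "h P \<ge> 0" if "P \<in> Ps" for P
    using B[of P] qd[OF that] that by (auto simp: h_def Ps_def)
  have \<kappa>0: "\<kappa> P \<ge> 0" if "P \<in> Ps" for P
    using qd[OF that] by (auto simp: \<kappa>_def euler_factor_def q_def)
  have loc: "fps_sum_le (g P * g P) (fps_const (\<kappa> P) * (1 + fps_const (h P) * fps_X ^ degree P))"
    if P: "P \<in> Ps" for P
  proof (cases "P \<in> B")
    case True
    have c: "0 \<le> c P" "c P < 1" using qd[OF P] by (auto simp: c_def field_simps)
    have "h P = c P / (1 - c P)" using True qd[OF P] q2 by (simp add: h_def c_def field_simps)
    moreover have "\<kappa> P = 1 / (1 - c P)" using True by (simp add: \<kappa>_def euler_factor_def c_def q_def)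
    moreover have "fps_sum_le (g P * g P)
        (fps_const (1 / (1 - c P)) * (1 + fps_const (c P / (1 - c P)) * fps_X ^ degree P))"
      unfolding g_def using geom_fps_sum_le[OF deg[OF P] c] c by (intro fps_sum_le_mult) auto
    ultimately show ?thesis by simp
  next
    case False
    have q: "q ^ degree P > 2" using B[of P] P False by (simp add: Ps_def)
    have c: "0 \<le> c P" "2 * c P < 1" using q by (auto simp: c_def field_simps)
    have "h P = 2 * c P / (1 - 2 * c P)" using False q q2 by (simp add: h_def c_def field_simps)
    then show ?thesis
      using geom_fps_square_sum_le[OF deg[OF P] c] False by (simp add: \<kappa>_def g_def)
  qed
  have "fps_sum_le (\<Prod>P\<in>Ps. g P * g P) (\<Prod>P\<in>Ps. fps_const (\<kappa> P) * (1 + fps_const (h P) * fps_X ^ degree P))"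
    using loc h0 \<kappa>0 q2 by (intro fps_sum_le_prod fps_nonneg_mult fps_nonneg_add) (auto simp: g_def c_def)
  also have "(\<Prod>P\<in>Ps. g P * g P) = Z * Z" by (simp add: Z_def prod.distrib)
  also have "(\<Prod>P\<in>Ps. fps_const (\<kappa> P) * (1 + fps_const (h P) * fps_X ^ degree P))
      = fps_const (\<Prod>P\<in>Ps. \<kappa> P) * (\<Sum>I\<in>Pow Ps. fps_const (\<Prod>P\<in>I. h P) * fps_X ^ sum degree I)"
  proof -
    have const: "(\<Prod>P\<in>I. fps_const (u P)) = fps_const (\<Prod>P\<in>I. u P)" if "finite I" for I and u :: "'a poly \<Rightarrow> real"
      using that by (induction I rule: finite_induct) auto
    have "(\<Prod>P\<in>Ps. fps_const (h P) * fps_X ^ degree P + 1)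
        = (\<Sum>I\<in>Pow Ps. (\<Prod>P\<in>I. fps_const (h P) * fps_X ^ degree P) * (\<Prod>P\<in>Ps - I. 1))"
      using finPs by (rule prod_add)
    also have "\<dots> = (\<Sum>I\<in>Pow Ps. fps_const (\<Prod>P\<in>I. h P) * fps_X ^ sum degree I)"
      using finPs by (intro sum.cong refl) (auto simp: prod.distrib power_sum const finite_subset)
    finally show ?thesis using finPs by (simp add: prod.distrib const add.commute)
  qed
  \<comment> \<open>The partial sum up to Q is exactly what imposes the constraint
    \<open>sum degree I \<le> Q\<close> on the expanded product.\<close>
  finally have "(Z * Z * geom_fps 1 1) $ Q \<le> (fps_const (\<Prod>P\<in>Ps. \<kappa> P)
      * (\<Sum>I\<in>Pow Ps. fps_const (\<Prod>P\<in>I. h P) * fps_X ^ sum degree I) * geom_fps 1 1) $ Q"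
    by (simp add: fps_sum_le_def)
  also have "(fps_const (\<Prod>P\<in>Ps. \<kappa> P)
      * (\<Sum>I\<in>Pow Ps. fps_const (\<Prod>P\<in>I. h P) * fps_X ^ sum degree I) * geom_fps 1 1) $ Q
      = (\<Prod>P\<in>Ps. \<kappa> P) * (\<Sum>I\<in>Pow Ps. if sum degree I \<le> Q then (\<Prod>P\<in>I. h P) else 0)"
  proof -
    have "((\<Sum>I\<in>Pow Ps. fps_const (\<Prod>P\<in>I. h P) * fps_X ^ sum degree I) * geom_fps 1 1) $ Q
        = (\<Sum>I\<in>Pow Ps. (fps_const (\<Prod>P\<in>I. h P) * (fps_X ^ sum degree I * geom_fps 1 1)) $ Q)"
      by (simp add: sum_distrib_right fps_sum_nth mult.assoc)
    also have "\<dots> = (\<Sum>I\<in>Pow Ps. if sum degree I \<le> Q then (\<Prod>P\<in>I. h P) else 0)"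
      by (intro sum.cong refl) (auto simp: fps_X_power_mult_nth geom_fps_def)
    finally show ?thesis by (simp add: mult.assoc)
  qed
  also have "(\<Prod>P\<in>Ps. \<kappa> P) = (\<Prod>P\<in>Ps \<inter> B. euler_factor P)"
    using finPs by (simp add: \<kappa>_def prod.inter_restrict)
  also have "(\<Sum>I\<in>Pow Ps. if sum degree I \<le> Q then (\<Prod>P\<in>I. h P) else 0)
      = (\<Sum>I | I \<subseteq> Ps \<and> sum degree I \<le> Q. \<Prod>P\<in>I. h P)"
    using finPs by (subst sum.inter_filter[symmetric]) (auto intro!: sum.cong)
  also have "(Z * Z * geom_fps 1 1) $ Q = real (Q + 1) * real (Q + 2) / 2"
  proof -
    have Z1: "Z $ i = 1" if "i \<le> Q" for i
      using zeta_coeff[OF that, where 'a = 'a] by (simp add: Z_def Ps_def g_def c_def q_def)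
    have "(Z * Z * geom_fps 1 1) $ Q = (\<Sum>m = 0..Q. \<Sum>i = 0..m. Z $ i * Z $ (m - i))"
      by (simp add: fps_mult_nth[of "Z * Z"] fps_mult_nth[of Z Z] geom_fps_def)
    also have "\<dots> = (\<Sum>m = 0..Q. real m + 1)"
      using Z1 by (intro sum.cong refl) simp
    also have "\<dots> = real (Q + 1) * real (Q + 2) / 2"
      by (induction Q) (auto simp: field_simps)
    finally show ?thesis .
  qed
  finally show ?thesis by (simp add: Ps_def)
qed

text \<open>The residues 0 and -A are removed modulo every prime of degree at most n/2; they
  coincide exactly when P divides \<open>A\<close>, where only the density of one class is gained.
  Since \<open>n div 2 < n\<close>, no counted polynomial is itself a sieving prime, and none is
  lost.\<close>

lemma card_irreducible_pairs_le:
  fixes A :: "'a::{field,finite} poly" and n :: nat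
  assumes n: "n \<ge> 1" and A: "A \<in> polys_below n"
  shows "real (card {h \<in> irreds_of_degree n. irreducible (h + A)})
      * (real (n div 2 + 1) * real (n div 2 + 2) / 2)
    \<le> real CARD('a) ^ n * (\<Prod>P | P \<in> primes_upto (n div 2) \<and> P dvd A. euler_factor P)"
proof -
  define q where "q = real CARD('a)"
  define Q where "Q = n div 2"
  define N where "N = {h \<in> irreds_of_degree n. irreducible (h + A)}"
  define Ps where "Ps = (primes_upto Q :: 'a poly set)"
  have Qn: "Q < n" "2 * Q \<le> n" using n by (auto simp: Q_def)
  define \<Omega> where "\<Omega> = (\<lambda>P :: 'a poly. {0, (- A) mod P})"
  have PsD: "P \<in> monic_irreds" "degree P \<le> Q" "P \<noteq> 0" "degree P \<ge> 1" if "P \<in> Ps" for P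
    using that monic_irredsD(2,4) by (auto simp: Ps_def primes_upto_def)
  have sift: "f mod P \<notin> \<Omega> P" if f: "f \<in> N" and P: "P \<in> Ps" for f P
  proof
    have fm: "f \<in> monics n" "f \<in> monic_irreds" "irreducible (f + A)"
      using f by (auto simp: N_def irreds_of_degree_def monic_irreds_def monics_def)
    then have "f + A \<in> monics n" using A monics_add_polys_below by blast
    then have fA: "f + A \<in> monic_irreds" "degree (f + A) = n"
      using fm by (auto simp: monic_irreds_def monics_def)
    assume "f mod P \<in> \<Omega> P"
    then have "f mod P = 0 \<or> f mod P = (- A) mod P" by (simp only: \<Omega>_def insert_iff empty_iff simp_thms)
    then have "P dvd f \<or> P dvd f + A"
      using mod_eq_dvd_iff[of f P "- A"] by (auto simp: mod_eq_0_iff_dvd)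
    then have "P = f \<or> P = f + A"
      using monic_irreds_dvd_eq PsD(1)[OF P] fm fA by blast
    then show False using PsD(2)[OF P] Qn fA fm by (auto simp: monics_def)
  qed
  have prod_eq: "(\<Prod>P | P \<in> primes_upto (n div 2) \<and> P dvd A. euler_factor P)
      = (\<Prod>P\<in>Ps \<inter> {P. P dvd A}. euler_factor P)"
    by (rule prod.cong) (auto simp: Ps_def Q_def)
  have card\<Omega>: "card (\<Omega> P) = (if P dvd A then 1 else 2)" for P
    by (auto simp: \<Omega>_def mod_eq_0_iff_dvd card_insert_if)
  have ef0: "euler_factor P \<ge> 0" for P :: "'a poly"
  proof -
    have "real CARD('a) ^ degree P \<ge> 1" by (simp add: one_le_power)
    then show ?thesis by (simp add: euler_factor_def)
  qed
  show ?thesis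
  proof (cases "\<forall>P\<in>Ps. P \<notin> {P. P dvd A} \<longrightarrow> q ^ degree P > 2")
    case True
    have q2: "q \<ge> 2" using card_field_ge_2[where 'a = 'a] by (simp add: q_def)
    have qd: "q ^ degree P \<ge> 2" if "P \<in> Ps" for P
      using power_increasing[OF PsD(4)[OF that], of q] q2 by simp
    define h where "h = (\<lambda>P. real (card (\<Omega> P)) / (q ^ degree P - real (card (\<Omega> P))))"
    define L where "L = (\<Sum>I | I \<subseteq> Ps \<and> sum degree I \<le> Q. \<Prod>P\<in>I. h P)"
    have "real (card {f \<in> monics n. \<forall>P\<in>Ps. f mod P \<notin> \<Omega> P}) * L \<le> q ^ n"
      unfolding L_def h_def q_def
    proof (rule selberg_sieve)
      fix P assume P: "P \<in> Ps"
      show "\<Omega> P \<subseteq> polys_below (degree P)"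
        using mod_in_polys_below[OF PsD(3)[OF P]] by (auto simp: \<Omega>_def polys_below_def)
      show "\<Omega> P \<noteq> {}" by (simp add: \<Omega>_def)
      have "real (card (\<Omega> P)) < q ^ degree P" using True P qd[OF P] by (auto simp: card\<Omega>)
      then have "real (card (\<Omega> P)) < real (CARD('a) ^ degree P)" by (simp add: q_def)
      then show "card (\<Omega> P) < CARD('a) ^ degree P" by (simp only: of_nat_less_iff)
    qed (use PsD Qn in \<open>auto simp: Ps_def\<close>)
    moreover have "real (card N) \<le> real (card {f \<in> monics n. \<forall>P\<in>Ps. f mod P \<notin> \<Omega> P})"
    proof (intro of_nat_mono card_mono)
      show "finite {f \<in> monics n. \<forall>P\<in>Ps. f mod P \<notin> \<Omega> P}"
        using card_monics[of n, where 'a = 'a] by simp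
      show "N \<subseteq> {f \<in> monics n. \<forall>P\<in>Ps. f mod P \<notin> \<Omega> P}"
        using sift by (auto simp: N_def irreds_of_degree_def monic_irreds_def monics_def)
    qed
    moreover have L: "real (Q + 1) * real (Q + 2) / 2 \<le> (\<Prod>P\<in>Ps \<inter> {P. P dvd A}. euler_factor P) * L"
    proof -
      have "(\<Sum>I | I \<subseteq> Ps \<and> sum degree I \<le> Q. \<Prod>P\<in>I. if P \<in> {P. P dvd A}
          then 1 / (q ^ degree P - 1) else 2 / (q ^ degree P - 2)) = L"
        unfolding L_def h_def by (intro sum.cong prod.cong refl) (auto simp: card\<Omega>)
      then show ?thesis
        using sieve_sum_ge[of Q "{P. P dvd A}"] True unfolding Ps_def q_def by auto
    qed
    moreover have "L \<ge> 0"
    proof -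
      have "h P \<ge> 0" if "P \<in> Ps" for P
        using qd[OF that] by (simp add: h_def card\<Omega>)
      then show ?thesis unfolding L_def by (intro sum_nonneg prod_nonneg) auto
    qed
    ultimately have NL: "real (card N) * L \<le> q ^ n" by (meson mult_right_mono order_trans)
    have "real (card N) * (real (Q + 1) * real (Q + 2) / 2)
        \<le> real (card N) * ((\<Prod>P\<in>Ps \<inter> {P. P dvd A}. euler_factor P) * L)"
      using L by (intro mult_left_mono) auto
    also have "\<dots> = (real (card N) * L) * (\<Prod>P\<in>Ps \<inter> {P. P dvd A}. euler_factor P)" by simp
    also have "\<dots> \<le> q ^ n * (\<Prod>P\<in>Ps \<inter> {P. P dvd A}. euler_factor P)"
      using NL ef0 by (intro mult_right_mono prod_nonneg) auto
    finally show ?thesis by (simp only: N_def Q_def q_def prod_eq)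
  next
    case False
    text \<open>Here \<open>q = 2\<close>, and both residue classes modulo some linear prime are removed.\<close>
    then obtain P where P: "P \<in> Ps" "\<not> P dvd A" "q ^ degree P \<le> 2" by auto
    have "polys_below (degree P) = \<Omega> P"
    proof (rule sym, rule card_subset_eq)
      show "finite (polys_below (degree P) :: 'a poly set)" using card_polys_below by blast
      show sub: "\<Omega> P \<subseteq> polys_below (degree P)"
        using mod_in_polys_below[OF PsD(3)[OF P(1)]] by (auto simp: \<Omega>_def polys_below_def)
      have "real (CARD('a) ^ degree P) \<le> real 2" using P(3) by (simp add: q_def)
      then have "CARD('a) ^ degree P \<le> 2" by (simp only: of_nat_le_iff)
      moreover have "card (\<Omega> P) \<le> card (polys_below (degree P) :: 'a poly set)"
        using sub card_polys_below by (intro card_mono) auto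
      ultimately show "card (\<Omega> P) = card (polys_below (degree P) :: 'a poly set)"
        using card_polys_below[of "degree P", where 'a = 'a] P by (simp add: card\<Omega>)
    qed
    then have "N = {}" using sift P(1) mod_in_polys_below[OF PsD(3)[OF P(1)]] by blast
    then show ?thesis using ef0 unfolding N_def[symmetric] by (simp add: prod_nonneg)
  qed
qed

section \<open>The average Euler product\<close>

lemma sum_telescope_inverse:
  assumes "1 \<le> e" "e \<le> K"
  shows "(\<Sum>y = e..<K. 1 / (real y * real (y + 1))) + 1 / real K = 1 / real e"
  using assms(2)
proof (induction K rule: dec_induct)
  case (step n)
  have "real n > 0" using step assms by simp
  then have "1 / (real n * real (n + 1)) + 1 / real (Suc n) = 1 / real n"
    by (simp add: divide_simps)
  then show ?case using step by (simp add: sum.atLeastLessThan_Suc)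
qed simp

text \<open>With r multiples of \<open>e\<close> below \<open>K\<close>, completing the square shows
  that the sum falls short of the bound by (K - e r)^2 / (2 e) + e r / 2.\<close>

lemma sum_multiples_le:
  assumes "e \<ge> 1"
  shows "(\<Sum>m | m \<in> {1..<K} \<and> e dvd m. real K - real m) \<le> (real K)\<^sup>2 / (2 * real e)"
proof (cases "K = 0")
  case False
  define r where "r = (K - 1) div e"
  have set: "{m \<in> {1..<K}. e dvd m} = (\<lambda>i. e * i) ` {1..r}"
  proof (intro equalityI subsetI)
    fix m assume "m \<in> {m \<in> {1..<K}. e dvd m}"
    then obtain i where i: "m = e * i" "1 \<le> m" "m \<le> K - 1" by auto
    then have "i \<le> r" using assms by (simp add: r_def less_eq_div_iff_mult_less_eq mult.commute)
    moreover have "i \<ge> 1" using i by (cases i) auto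
    ultimately show "m \<in> (\<lambda>i. e * i) ` {1..r}" using i by auto
  next
    fix m assume "m \<in> (\<lambda>i. e * i) ` {1..r}"
    then obtain i where i: "m = e * i" "1 \<le> i" "i \<le> r" unfolding image_iff by (metis atLeastAtMost_iff)
    then have "e * i \<le> K - 1" using assms by (simp add: r_def less_eq_div_iff_mult_less_eq mult.commute)
    moreover have "e * i \<ge> 1" using i assms by (simp add: Suc_le_eq)
    ultimately show "m \<in> {m \<in> {1..<K}. e dvd m}" using i False by auto
  qed
  have "(\<Sum>m | m \<in> {1..<K} \<and> e dvd m. real K - real m) = (\<Sum>i = 1..r. real K - real (e * i))"
    unfolding set using assms by (subst sum.reindex) (auto simp: inj_on_def)
  also have "\<dots> = real r * real K - real e * (real r * (real r + 1) / 2)"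
    by (induction r) (auto simp: field_simps)
  also have "\<dots> \<le> (real K)\<^sup>2 / (2 * real e)"
  proof -
    have "(real K)\<^sup>2 / (2 * real e) - (real r * real K - real e * (real r * (real r + 1) / 2))
        = (real K - real e * real r)\<^sup>2 / (2 * real e) + real e * real r / 2"
      using assms by (simp add: field_simps power2_eq_square)
    then show ?thesis by (smt (verit) divide_nonneg_nonneg mult_nonneg_nonneg of_nat_0_le_iff zero_le_power2)
  qed
  finally show ?thesis .
qed simp

text \<open>The averaging argument of Romanoff: expand the products over subsets \<open>I\<close>. The \<open>m\<close> with
  \<open>I \<subseteq> S m\<close> are the multiples of the least one, \<open>e\<close>, and \<open>1 / e\<close> is written as the telescoping sum
  \<open>sum_telescope_inverse\<close> over \<open>y \<ge> e\<close>, where \<open>I\<close> is a subset of the union of the \<open>S i\<close> with \<open>i \<le> y\<close>.\<close>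

lemma weighted_product_average:
  fixes S :: "nat \<Rightarrow> 'b set" and w :: "'b \<Rightarrow> real" and K :: nat
  defines "U \<equiv> \<lambda>y. \<Union>i\<in>{1..y}. S i"
  assumes K: "K \<ge> 1" and fin: "\<And>m. m \<ge> 1 \<Longrightarrow> finite (S m)" and w: "\<And>x. x \<in> U (K - 1) \<Longrightarrow> w x \<ge> 0"
    and diff: "\<And>e m I. I \<subseteq> S e \<Longrightarrow> I \<subseteq> S m \<Longrightarrow> 1 \<le> e \<Longrightarrow> e < m \<Longrightarrow> I \<subseteq> S (m - e)"
  shows "(\<Sum>m = 1..<K. (real K - real m) * (\<Prod>x\<in>S m. 1 + w x))
    \<le> (real K)\<^sup>2 / 2 * ((\<Sum>y = 1..<K. (\<Prod>x\<in>U y. 1 + w x) / (real y * real (y + 1)))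
        + (\<Prod>x\<in>U (K - 1). 1 + w x) / real K)"
proof -
  define T where "T = U (K - 1)"
  define W where "W = (\<lambda>I. \<Prod>x\<in>I. w x)"
  have finU: "finite (U y)" for y using fin by (auto simp: U_def)
  have finT: "finite (Pow T)" using finU by (simp add: T_def)
  have UT: "U y \<subseteq> T" if "y < K" for y using that by (force simp: U_def T_def)
  have ST: "S m \<subseteq> T" if "1 \<le> m" "m < K" for m
  proof -
    have "m \<in> {1..K - 1}" using that by auto
    then show ?thesis by (auto simp: U_def T_def)
  qed
  have expand: "(\<Prod>x\<in>A. 1 + w x) = (\<Sum>I\<in>Pow T. if I \<subseteq> A then W I else 0)" if "A \<subseteq> T" for A
  proof -
    have "finite A" using that finT finite_subset by auto
    then have "(\<Prod>x\<in>A. w x + 1) = (\<Sum>I\<in>Pow A. W I)" by (simp add: prod_add W_def)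
    also have "\<dots> = (\<Sum>I\<in>Pow T. if I \<subseteq> A then W I else 0)"
      using that finT by (intro sum.mono_neutral_cong_left) auto
    finally show ?thesis by (simp add: add.commute)
  qed
  have W0: "W I \<ge> 0" if "I \<in> Pow T" for I
    unfolding W_def using that w by (intro prod_nonneg) (auto simp: T_def)
  define c where "c = (\<lambda>I. \<Sum>m = 1..<K. if I \<subseteq> S m then real K - real m else 0)"
  \<comment> \<open>The summand 1/K is the telescoped tail over y \<ge> K. There the union is frozen
    at \<open>U (K - 1)\<close>, which contains every set that can occur.\<close>
  define d where "d = (\<lambda>I. (\<Sum>y = 1..<K. if I \<subseteq> U y then 1 / (real y * real (y + 1)) else 0) + 1 / real K)"
  have cd: "c I \<le> (real K)\<^sup>2 / 2 * d I" for I
  proof (cases "\<exists>m. 1 \<le> m \<and> m < K \<and> I \<subseteq> S m")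
    case False
    have "c I = 0" unfolding c_def by (rule sum.neutral) (use False in auto)
    moreover have "d I \<ge> 0" unfolding d_def by (intro add_nonneg_nonneg sum_nonneg) auto
    ultimately show ?thesis by simp
  next
    case True
    define e where "e = (LEAST m. 1 \<le> m \<and> I \<subseteq> S m)"
    have ex: "\<exists>m. 1 \<le> m \<and> I \<subseteq> S m" using True by auto
    have e: "1 \<le> e" "I \<subseteq> S e" using LeastI_ex[OF ex] by (auto simp: e_def)
    have least: "e \<le> m" if "1 \<le> m" "I \<subseteq> S m" for m
      using that unfolding e_def by (intro Least_le) auto
    have eK: "e < K" using True least by (meson le_less_trans)
    \<comment> \<open>Subtracting \<open>e\<close> repeatedly must end at \<open>e\<close> itself by
      minimality, as for the order of a group element.\<close>
    have mult: "e dvd m" if "1 \<le> m" "I \<subseteq> S m" for m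
      using that
    proof (induction m rule: less_induct)
      case (less m)
      show ?case
      proof (cases "m = e")
        case False
        then have "e < m" using least[OF less.prems] by simp
        then have "e dvd m - e"
          using less.IH[of "m - e"] diff[OF e(2) less.prems(2) e(1)] e(1) by simp
        then have "e dvd (m - e) + e" by (intro dvd_add) auto
        then show ?thesis using \<open>e < m\<close> by simp
      qed simp
    qed
    have "c I = (\<Sum>m | m \<in> {1..<K} \<and> I \<subseteq> S m. real K - real m)"
      unfolding c_def by (subst sum.inter_filter) auto
    also have "\<dots> \<le> (\<Sum>m | m \<in> {1..<K} \<and> e dvd m. real K - real m)"
      using mult by (intro sum_mono2) auto
    also have "\<dots> \<le> (real K)\<^sup>2 / 2 * (1 / real e)" using sum_multiples_le[OF e(1), of K] by simp
    also have "1 / real e \<le> d I"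
    proof -
      have "(\<Sum>y = e..<K. 1 / (real y * real (y + 1))) = (\<Sum>y = e..<K. if I \<subseteq> U y then 1 / (real y * real (y + 1)) else 0)"
        using e by (intro sum.cong refl) (auto simp: U_def)
      also have "\<dots> \<le> (\<Sum>y = 1..<K. if I \<subseteq> U y then 1 / (real y * real (y + 1)) else 0)"
        using e by (intro sum_mono2) auto
      finally show ?thesis using sum_telescope_inverse[OF e(1), of K] eK by (simp add: d_def)
    qed
    finally show ?thesis by (simp add: mult_left_mono)
  qed
  have "(\<Sum>m = 1..<K. (real K - real m) * (\<Prod>x\<in>S m. 1 + w x))
      = (\<Sum>m = 1..<K. \<Sum>I\<in>Pow T. W I * (if I \<subseteq> S m then real K - real m else 0))"
    using ST by (intro sum.cong refl) (auto simp: expand sum_distrib_left intro!: sum.cong)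
  also have "\<dots> = (\<Sum>I\<in>Pow T. W I * c I)"
    by (subst sum.swap) (simp add: c_def sum_distrib_left)
  also have "\<dots> \<le> (\<Sum>I\<in>Pow T. W I * ((real K)\<^sup>2 / 2 * d I))"
    using cd W0 by (intro sum_mono mult_left_mono) auto
  also have "\<dots> = (real K)\<^sup>2 / 2 * (\<Sum>I\<in>Pow T. W I * d I)"
    by (simp add: sum_distrib_left mult_ac)
  also have "(\<Sum>I\<in>Pow T. W I * d I)
      = (\<Sum>y = 1..<K. \<Sum>I\<in>Pow T. W I * (if I \<subseteq> U y then 1 / (real y * real (y + 1)) else 0))
        + (\<Sum>I\<in>Pow T. W I) / real K"
    unfolding d_def distrib_left sum.distrib sum_distrib_left sum_divide_distrib
    by (subst sum.swap) simp
  also have "(\<Sum>y = 1..<K. \<Sum>I\<in>Pow T. W I * (if I \<subseteq> U y then 1 / (real y * real (y + 1)) else 0))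
      = (\<Sum>y = 1..<K. (\<Prod>x\<in>U y. 1 + w x) / (real y * real (y + 1)))"
    using UT by (intro sum.cong refl) (auto simp: expand sum_divide_distrib intro!: sum.cong)
  also have "(\<Sum>I\<in>Pow T. W I) = (\<Prod>x\<in>U (K - 1). 1 + w x)"
    using expand[of T] by (simp add: T_def)
  finally show ?thesis .
qed

section \<open>Prime divisors of g and of the polynomials g ^ m - 1\<close>

definition prime_divisors :: "'a::field poly \<Rightarrow> 'a poly set" where
  "prime_divisors f = {P \<in> monic_irreds. P dvd f}"

lemma finite_prime_divisors:
  fixes f :: "'a::{field,finite} poly"
  assumes "f \<noteq> 0" shows "finite (prime_divisors f)"
  by (rule finite_subset[OF _ finite_primes_upto[of "degree f"]])
     (use dvd_imp_degree_le assms in \<open>auto simp: prime_divisors_def primes_upto_def\<close>)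

lemma degree_power_minus_1:
  fixes g :: "'a::field poly"
  assumes "degree g \<ge> 1" "m \<ge> 1"
  shows "degree (g ^ m - 1) = m * degree g" "g ^ m - 1 \<noteq> 0"
proof -
  have dg: "degree (g ^ m) = m * degree g" using assms by (subst degree_power_eq) auto
  then have pos: "degree (1 :: 'a poly) < degree (g ^ m)" using assms by simp
  show d: "degree (g ^ m - 1) = m * degree g"
    using degree_add_eq_left[of "- 1 :: 'a poly" "g ^ m"] pos dg by simp
  show "g ^ m - 1 \<noteq> 0" using d assms by (metis degree_0 mult_is_0 not_one_le_zero)
qed

text \<open>The factor \<open>g - 1\<close> common to all \<open>g ^ i - 1\<close> is counted only once. Without this saving the constant
  \<open>6\<close> in \<open>log_average_le\<close> would be barely attained.\<close>

lemma sum_degree_prime_divisors_le: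
  fixes g :: "'a::{field,finite} poly"
  assumes g: "degree g \<ge> 1" and y: "y \<ge> 1"
  shows "real (sum degree (prime_divisors g \<union> (\<Union>i\<in>{1..y}. prime_divisors (g ^ i - 1))))
    \<le> real (degree g) * (2 + real y * (real y - 1) / 2)"
proof -
  define \<Psi> where "\<Psi> = (\<lambda>i. \<Sum>j<i. g ^ j)"
  \<comment> \<open>A common multiple of \<open>g\<close> and all \<open>g ^ i - 1\<close>: the
    factors g and g - 1 give the 2, and the quotients of degree (i - 1) \<delta> give y (y -
    1)/2.\<close>
  define H where "H = g * (g - 1) * (\<Prod>i\<in>{2..y}. \<Psi> i)"
  have \<Psi>: "g ^ i - 1 = (g - 1) * \<Psi> i" for i
    unfolding \<Psi>_def by (rule power_diff_1_eq)
  have g0: "g \<noteq> 0" using g by auto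
  have g1: "g - 1 \<noteq> 0" "degree (g - 1) = degree g" using degree_power_minus_1[OF g, of 1] by auto
  have \<Psi>0: "\<Psi> i \<noteq> 0 \<and> degree (\<Psi> i) = (i - 1) * degree g" if "i \<ge> 1" for i
  proof -
    have "\<Psi> i \<noteq> 0" using degree_power_minus_1(2)[OF g that] \<Psi>[of i] by auto
    then have "i * degree g = degree g + degree (\<Psi> i)"
      using degree_power_minus_1(1)[OF g that] \<Psi>[of i] g1 by (simp add: degree_mult_eq)
    then show ?thesis using \<open>\<Psi> i \<noteq> 0\<close> by (simp add: diff_mult_distrib)
  qed
  have H0: "H \<noteq> 0" using g0 g1 \<Psi>0 by (simp add: H_def)
  have dvd: "g * (g - 1) dvd H" "\<And>i. i \<in> {2..y} \<Longrightarrow> (g - 1) * \<Psi> i dvd H"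
    unfolding H_def by (auto simp: mult.assoc intro!: dvd_mult mult_dvd_mono)
  have i_dvd: "g ^ i - 1 dvd H" if "i \<in> {1..y}" for i
  proof (cases "i = 1")
    case True
    then show ?thesis using dvd(1) by (auto intro: dvd_mult_right)
  next
    case False
    then show ?thesis using dvd(2)[of i] that \<Psi>[of i] by auto
  qed
  have "sum degree (prime_divisors g \<union> (\<Union>i\<in>{1..y}. prime_divisors (g ^ i - 1))) \<le> degree H"
  proof (rule sum_degree_le)
    show "finite (prime_divisors g \<union> (\<Union>i\<in>{1..y}. prime_divisors (g ^ i - 1)))"
      using finite_prime_divisors g0 degree_power_minus_1(2)[OF g] by auto
    fix P assume "P \<in> prime_divisors g \<union> (\<Union>i\<in>{1..y}. prime_divisors (g ^ i - 1))"
    then show "P dvd H"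
      using dvd(1) i_dvd by (auto simp: prime_divisors_def intro: dvd_trans dvd_mult_left)
  qed (use H0 in \<open>auto simp: prime_divisors_def\<close>)
  also have "\<dots> \<le> degree (g * (g - 1)) + degree (\<Prod>i\<in>{2..y}. \<Psi> i)"
    unfolding H_def by (rule degree_mult_le)
  also have "degree (g * (g - 1)) = 2 * degree g" using g0 g1 by (simp add: degree_mult_eq)
  also have "degree (\<Prod>i\<in>{2..y}. \<Psi> i) \<le> (\<Sum>i\<in>{2..y}. (i - 1) * degree g)"
    using degree_prod_sum_le[of "{2..y}" \<Psi>] \<Psi>0 by simp
  finally have "real (sum degree (prime_divisors g \<union> (\<Union>i\<in>{1..y}. prime_divisors (g ^ i - 1))))
      \<le> real (2 * degree g + (\<Sum>i\<in>{2..y}. (i - 1) * degree g))"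
    by (simp only: of_nat_le_iff add_le_cancel_left)
  also have "(\<Sum>i\<in>{2..y}. (i - 1) * degree g) = (\<Sum>i\<in>{2..y}. i - 1) * degree g"
    by (simp add: sum_distrib_right)
  also have "real (\<Sum>i\<in>{2..y}. i - 1) = real y * (real y - 1) / 2"
    using y by (induction y rule: dec_induct) (auto simp: field_simps)
  then have "real (2 * degree g + (\<Sum>i\<in>{2..y}. i - 1) * degree g)
      = real (degree g) * (2 + real y * (real y - 1) / 2)"
    by (simp only: of_nat_add of_nat_mult of_nat_numeral) (simp add: algebra_simps)
  finally show ?thesis .
qed

lemma euler_factor_ge_1:
  fixes P :: "'a::{field,finite} poly"
  assumes "P \<in> monic_irreds" shows "euler_factor P \<ge> 1"
proof -
  define q where "q = real CARD('a)"
  have q2: "q \<ge> 2" using card_field_ge_2[where 'a = 'a] by (simp add: q_def)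
  have "q ^ 1 \<le> q ^ degree P" using monic_irredsD(4)[OF assms] q2 by (intro power_increasing) auto
  then have "q ^ degree P \<ge> 2" using q2 by simp
  then show ?thesis by (simp add: euler_factor_def flip: q_def)
qed

text \<open>The growth function \<open>f\<close> is abstract because it is instantiated both by a
  logarithm and by a variant that is linear at first. Primes of \<open>g\<close> divide no
  \<open>g ^ m - 1\<close>, so their product \<open>G\<close> is pulled out before averaging and
  rejoined to each \<open>U y\<close>. The averaging weights add up to 1, so the constant 1 is
  preserved.\<close>

lemma euler_factor_average_le:
  fixes g :: "'a::{field,finite} poly" and f :: "nat \<Rightarrow> real" and C E M :: real
  assumes g: "degree g \<ge> 1" and K: "K \<ge> 2" and CE: "C \<ge> 0" "E \<ge> 0"
    and f: "\<And>y S. 1 \<le> y \<Longrightarrow> finite S \<Longrightarrow> S \<subseteq> monic_irreds \<Longrightarrow>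
        real (sum degree S) \<le> real (degree g) * (2 + real y * (real y - 1) / 2) \<Longrightarrow>
        (\<Prod>P\<in>(S :: 'a poly set). euler_factor P) \<le> C * (1 + E * f y)"
    and M: "(\<Sum>y = 1..<K. f y / (real y * real (y + 1))) + f (K - 1) / real K \<le> M"
  shows "(\<Sum>m = 1..<K. (real K - real m) * (\<Prod>P\<in>prime_divisors g \<union> prime_divisors (g ^ m - 1). euler_factor P))
    \<le> (real K)\<^sup>2 / 2 * (C * (1 + E * M))"
proof -
  define S where "S = (\<lambda>m. prime_divisors (g ^ m - 1))"
  define U where "U = (\<lambda>y. \<Union>i\<in>{1..y}. S i)"
  define G where "G = (\<Prod>P\<in>prime_divisors g. euler_factor P)"
  have finS: "finite (S m)" if "m \<ge> 1" for m
    unfolding S_def by (rule finite_prime_divisors[OF degree_power_minus_1(2)[OF g that]])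
  then have finU: "finite (U y)" for y by (auto simp: U_def)
  have fing: "finite (prime_divisors g)" using g by (intro finite_prime_divisors) auto
  have irr: "S m \<subseteq> monic_irreds" for m by (auto simp: S_def prime_divisors_def)
  have cop: "prime_divisors g \<inter> S m = {}" if "m \<ge> 1" for m
  proof -
    have "\<not> P dvd g ^ m - 1" if "P \<in> monic_irreds" "P dvd g" for P
    proof
      assume "P dvd g ^ m - 1"
      moreover have "P dvd g ^ m" using that \<open>m \<ge> 1\<close> by (intro dvd_trans[OF that(2)] dvd_power) auto
      ultimately have "P dvd g ^ m - (g ^ m - 1)" by (rule dvd_diff[rotated])
      then have "P dvd 1" by simp
      then show False using monic_irredsD(1)[OF that(1)] prime_elem_not_unit by blast
    qed
    then show ?thesis by (auto simp: S_def prime_divisors_def)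
  qed
  have copU: "prime_divisors g \<inter> U y = {}" for y using cop by (fastforce simp: U_def)
  have G0: "G \<ge> 0"
    unfolding G_def using euler_factor_ge_1 by (intro prod_nonneg) (force simp: prime_divisors_def)
  have diff: "I \<subseteq> S (m - e)" if I: "I \<subseteq> S e" "I \<subseteq> S m" and em: "1 \<le> e" "e < m" for e m I
  proof
    fix P assume "P \<in> I"
    then have P: "P \<in> monic_irreds" "P dvd g ^ e - 1" "P dvd g ^ m - 1"
      using I by (auto simp: S_def prime_divisors_def)
    have "g ^ m - 1 = g ^ (m - e) * (g ^ e - 1) + (g ^ (m - e) - 1)"
      using em by (simp add: algebra_simps flip: power_add)
    then have "P dvd g ^ (m - e) - 1"
      using P by (metis dvd_add_right_iff dvd_mult)
    then show "P \<in> S (m - e)" using P by (simp add: S_def prime_divisors_def)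
  qed
  have w0: "euler_factor P - 1 \<ge> 0" if "P \<in> U (K - 1)" for P
    using that irr euler_factor_ge_1 by (force simp: U_def)
  have GU: "G * (\<Prod>P\<in>U y. euler_factor P) \<le> C * (1 + E * f y)" if "y \<ge> 1" for y
  proof -
    have "G * (\<Prod>P\<in>U y. euler_factor P) = (\<Prod>P\<in>prime_divisors g \<union> U y. euler_factor P)"
      unfolding G_def using fing finU copU by (subst prod.union_disjoint) auto
    also have "\<dots> \<le> C * (1 + E * f y)"
      using sum_degree_prime_divisors_le[OF g that] fing finU that irr
      by (intro f) (auto simp: U_def S_def prime_divisors_def)
    finally show ?thesis .
  qed
  have "(\<Sum>m = 1..<K. (real K - real m) * (\<Prod>P\<in>prime_divisors g \<union> prime_divisors (g ^ m - 1). euler_factor P))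
      = (\<Sum>m = 1..<K. G * ((real K - real m) * (\<Prod>P\<in>S m. 1 + (euler_factor P - 1))))"
  proof (intro sum.cong refl)
    fix m assume "m \<in> {1..<K}"
    then have "(\<Prod>P\<in>prime_divisors g \<union> S m. euler_factor P) = G * (\<Prod>P\<in>S m. euler_factor P)"
      unfolding G_def using fing finS cop by (subst prod.union_disjoint) auto
    then show "(real K - real m) * (\<Prod>P\<in>prime_divisors g \<union> prime_divisors (g ^ m - 1). euler_factor P)
        = G * ((real K - real m) * (\<Prod>P\<in>S m. 1 + (euler_factor P - 1)))"
      by (simp add: S_def)
  qed
  also have "\<dots> \<le> G * ((real K)\<^sup>2 / 2 * ((\<Sum>y = 1..<K. (\<Prod>P\<in>U y. 1 + (euler_factor P - 1)) / (real y * real (y + 1)))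
        + (\<Prod>P\<in>U (K - 1). 1 + (euler_factor P - 1)) / real K))"
    unfolding sum_distrib_left[symmetric] U_def
  proof (intro mult_left_mono G0 weighted_product_average)
    show "1 \<le> K" using K by simp
    show "0 \<le> euler_factor x - 1" if "x \<in> (\<Union>i\<in>{1..K - 1}. S i)" for x
      using w0 that by (simp add: U_def)
  qed (use finS diff in auto)
  also have "\<dots> = (real K)\<^sup>2 / 2 * ((\<Sum>y = 1..<K. G * (\<Prod>P\<in>U y. euler_factor P) / (real y * real (y + 1)))
        + G * (\<Prod>P\<in>U (K - 1). euler_factor P) / real K)"
    by (simp add: distrib_left sum_distrib_left mult_ac)
  also have "\<dots> \<le> (real K)\<^sup>2 / 2 * ((\<Sum>y = 1..<K. C * (1 + E * f y) / (real y * real (y + 1)))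
        + C * (1 + E * f (K - 1)) / real K)"
    using GU K by (intro mult_left_mono add_mono sum_mono divide_right_mono) auto
  also have "\<dots> = (real K)\<^sup>2 / 2 * (C * (((\<Sum>y = 1..<K. 1 / (real y * real (y + 1))) + 1 / real K)
      + E * ((\<Sum>y = 1..<K. f y / (real y * real (y + 1))) + f (K - 1) / real K)))"
    by (simp add: distrib_left sum_distrib_left sum.distrib add_divide_distrib mult_ac)
  also have "(\<Sum>y = 1..<K. 1 / (real y * real (y + 1))) + 1 / real K = 1"
    using sum_telescope_inverse[of 1 K] K by simp
  also have "(real K)\<^sup>2 / 2 * (C * (1 + E * ((\<Sum>y = 1..<K. f y / (real y * real (y + 1))) + f (K - 1) / real K)))
      \<le> (real K)\<^sup>2 / 2 * (C * (1 + E * M))"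
    using M CE by (intro mult_left_mono add_left_mono) auto
  finally show ?thesis .
qed

section \<open>The logarithmic averages\<close>

lemma sum_telescope_le:
  fixes f \<psi> :: "nat \<Rightarrow> real"
  assumes "Y \<le> K" "1 \<le> Y"
    and "\<And>y. Y \<le> y \<Longrightarrow> f y / (real y * real (y + 1)) \<le> \<psi> y - \<psi> (y + 1)"
  shows "(\<Sum>y = Y..<K. f y / (real y * real (y + 1))) \<le> \<psi> Y - \<psi> K"
  using assms(1)
proof (induction K rule: dec_induct)
  case (step n)
  then show ?case using assms(3)[of n] by (simp add: sum.atLeastLessThan_Suc)
qed simp

text \<open>The function (ln(a y^2) + 2)/y is the integral of ln(a u^2)/u^2 from y to infinity. In
  the discrete version ln(1 + 1/y) \<le> 1/y makes the algebra close exactly.\<close>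

lemma log_tail_step:
  assumes y: "y \<ge> 1" and "a > 0"
  shows "ln (a * (real y)\<^sup>2) / (real y * real (y + 1))
    \<le> (ln (a * (real y)\<^sup>2) + 2) / real y - (ln (a * (real (y + 1))\<^sup>2) + 2) / real (y + 1)"
proof -
  define l where "l = ln (a * (real y)\<^sup>2)"
  have y0: "real y > 0" using y by simp
  have "ln (a * (real (y + 1))\<^sup>2) = l + 2 * ln (real (y + 1) / real y)"
    using y0 assms by (simp add: l_def ln_mult ln_realpow ln_div algebra_simps)
  also have "ln (real (y + 1) / real y) \<le> real (y + 1) / real y - 1"
    using y0 by (intro ln_le_minus_one) auto
  also have "\<dots> = 1 / real y" using y0 by (simp add: field_simps)
  finally have "ln (a * (real (y + 1))\<^sup>2) \<le> l + 2 / real y" by simp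
  then have "(l + 2) / real y - (ln (a * (real (y + 1))\<^sup>2) + 2) / real (y + 1)
      \<ge> (l + 2) / real y - (l + 2 / real y + 2) / real (y + 1)"
    by (intro diff_left_mono divide_right_mono) auto
  also have "(l + 2) / real y - (l + 2 / real y + 2) / real (y + 1) = l / (real y * real (y + 1))"
    using y0 by (simp add: divide_simps) (simp add: algebra_simps)
  finally show ?thesis by (simp add: l_def)
qed

text \<open>The averaged quantity increases with \<open>K\<close>, so K \<ge> 4 may be assumed. From
  y = 4 on, 2 + y (y - 1)/2 is at most y^2/2 and the tail telescopes; what remains is a numerical
  comparison of ln 2, ln 3 and ln 5 with ln 6. The parameter \<open>a\<close> only adds ln a, as the
  weights sum to 1.\<close>

lemma log_average_le:
  assumes K: "K \<ge> 2" and a: "a \<ge> 1"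
  defines "f \<equiv> \<lambda>y. ln (a * (2 + real y * (real y - 1) / 2))"
  shows "(\<Sum>y = 1..<K. f y / (real y * real (y + 1))) + f (K - 1) / real K \<le> ln (6 * a)"
proof -
  define d where "d = (\<lambda>y. 2 + real y * (real y - 1) / 2)"
  define V where "V = (\<lambda>K. (\<Sum>y = 1..<K. f y / (real y * real (y + 1))) + f (K - 1) / real K)"
  have d1: "d y \<ge> 1" for y
    by (cases y) (auto simp: d_def)
  have d_mono: "d y \<le> d (Suc y)" for y
    by (simp add: d_def field_simps)
  have f_mono: "f y \<le> f (Suc y)" for y
  proof -
    have "0 < a * d y" "a * d y \<le> a * d (Suc y)"
      using a d1[of y] d_mono[of y] by (auto intro: mult_left_mono)
    then show ?thesis by (simp add: f_def d_def)
  qed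
  have f_ln: "f y = ln a + ln (d y)" for y
    using a d1[of y] by (simp add: f_def d_def ln_mult)
  have V_mono: "V k \<le> V (Suc k)" if k: "k \<ge> 1" for k
  proof -
    have "V (Suc k) - V k = f k / (real k * real (k + 1)) + f k / real (Suc k) - f (k - 1) / real k"
      using k by (simp add: V_def sum.atLeastLessThan_Suc)
    also have "f k / (real k * real (k + 1)) + f k / real (Suc k) = f k / real k"
      using k by (simp add: divide_simps) (simp add: algebra_simps)
    also have "f k / real k - f (k - 1) / real k \<ge> 0"
      using f_mono[of "k - 1"] k by (simp add: divide_right_mono)
    finally show ?thesis by simp
  qed
  define K' where "K' = max K 4"
  have K': "K' \<ge> 4" "K \<le> K'" by (auto simp: K'_def)
  have "V K \<le> V K'"
    using K'(2) by (induction K' rule: dec_induct) (use V_mono K in \<open>auto intro: order_trans\<close>)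
  also have "V K' \<le> ln (6 * a)"
  proof -
    define F where "F = (\<lambda>y. ln (d y))"
    define \<psi> where "\<psi> = (\<lambda>y. (ln (1/2 * (real y)\<^sup>2) + 2) / real y)"
    have dle: "d y \<le> 1/2 * (real y)\<^sup>2" if "y \<ge> 4" for y
      using that by (simp add: d_def field_simps power2_eq_square)
    have Fle: "F y \<le> ln (1/2 * (real y)\<^sup>2)" if "y \<ge> 4" for y
      unfolding F_def using d1[of y] dle[OF that] by (intro ln_mono) linarith+
    have tail: "(\<Sum>y = 4..<K'. F y / (real y * real (y + 1))) \<le> \<psi> 4 - \<psi> K'"
    proof (rule sum_telescope_le)
      fix y :: nat assume y: "4 \<le> y"
      have "F y / (real y * real (y + 1)) \<le> ln (1/2 * (real y)\<^sup>2) / (real y * real (y + 1))"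
        using Fle[OF y] by (intro divide_right_mono) auto
      also have "\<dots> \<le> \<psi> y - \<psi> (y + 1)"
        unfolding \<psi>_def by (rule log_tail_step) (use y in auto)
      finally show "F y / (real y * real (y + 1)) \<le> \<psi> y - \<psi> (y + 1)" .
    qed (use K' in auto)
    have last: "F (K' - 1) / real K' \<le> \<psi> K'"
    proof -
      have "d (K' - 1) \<le> d (Suc (K' - 1))" by (rule d_mono)
      then have "F (K' - 1) \<le> F K'" using d1[of "K' - 1"] K' by (simp add: F_def)
      also have "\<dots> \<le> ln (1/2 * (real K')\<^sup>2) + 2" using Fle[OF K'(1)] by simp
      finally show ?thesis by (simp add: \<psi>_def divide_right_mono)
    qed
    have "(\<Sum>y = 1..<K'. F y / (real y * real (y + 1)))
        = (\<Sum>y = 1..<4. F y / (real y * real (y + 1))) + (\<Sum>y = 4..<K'. F y / (real y * real (y + 1)))"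
      using K' by (intro sum.atLeastLessThan_concat[symmetric]) auto
    also have "(\<Sum>y = 1..<4. F y / (real y * real (y + 1))) = ln 2 / 2 + ln 3 / 6 + ln 5 / 12"
      by (simp add: numeral_eq_Suc F_def d_def)
    finally have "(\<Sum>y = 1..<K'. F y / (real y * real (y + 1))) + F (K' - 1) / real K'
        \<le> ln 2 / 2 + ln 3 / 6 + ln 5 / 12 + \<psi> 4"
      using tail last by simp
    also have "\<psi> 4 = (3 * ln 2 + 2) / 4"
    proof -
      have "ln 8 = 3 * ln (2 :: real)" using ln_realpow[of 2 3] by simp
      then show ?thesis by (simp add: \<psi>_def)
    qed
    also have "ln 2 / 2 + ln 3 / 6 + ln 5 / 12 + (3 * ln 2 + 2) / 4 \<le> ln (6 :: real)"
    proof -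
      \<comment> \<open>Multiplied by 12 and cleared of common terms, the inequality reads 3 ln 2 +
        ln 5 + 6 \<le> 10 ln 3, that is 40 e^6 \<le> 3^10, for which e < 3 is enough.\<close>
      have "exp (6 :: real) = exp 1 ^ 6" by (simp flip: exp_of_nat_mult)
      also have "\<dots> \<le> 3 ^ 6" using e_less_272 by (intro power_mono) auto
      finally have "2 ^ 3 * 5 * exp (6 :: real) \<le> 3 ^ 10" by simp
      then have "ln (2 ^ 3 * 5 * exp (6 :: real)) \<le> ln (3 ^ 10)"
        by (intro ln_mono) auto
      also have "ln (3 ^ 10) = 10 * ln (3 :: real)" by (subst ln_realpow) auto
      also have "ln (2 ^ 3 * 5 * exp (6 :: real)) = ln (2 ^ 3) + ln 5 + 6"
        by (simp only: ln_mult ln_exp) (simp add: ln_mult)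
      also have "ln (2 ^ 3) = 3 * ln (2 :: real)" by (subst ln_realpow) auto
      finally have "3 * ln 2 + ln 5 + 6 \<le> 10 * ln (3 :: real)" .
      moreover have "ln (6 :: real) = ln 2 + ln 3" using ln_mult[of "2 :: real" 3] by simp
      moreover have "a / 2 + b / 6 + c / 12 + (3 * a + 2) / 4 \<le> a + b"
        if "3 * a + c + 6 \<le> 10 * b" for a b c :: real
        using that by (simp add: field_simps)
      ultimately show ?thesis by metis
    qed
    finally have *: "(\<Sum>y = 1..<K'. F y / (real y * real (y + 1))) + F (K' - 1) / real K' \<le> ln 6" .
    have "V K' = ln a * ((\<Sum>y = 1..<K'. 1 / (real y * real (y + 1))) + 1 / real K')
        + ((\<Sum>y = 1..<K'. F y / (real y * real (y + 1))) + F (K' - 1) / real K')"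
      by (simp add: V_def f_ln F_def add_divide_distrib sum.distrib distrib_left sum_distrib_left)
    also have "(\<Sum>y = 1..<K'. 1 / (real y * real (y + 1))) + 1 / real K' = 1"
      using sum_telescope_inverse[of 1 K'] K' by simp
    finally show ?thesis using * a by (simp add: ln_mult)
  qed
  finally show ?thesis by (simp add: V_def)
qed

text \<open>Put s = sqrt(\<delta>/q) and cut at 1/s, where \<delta> y^2 reaches q. Below the cut
  each weighted term is at most s^2, in total s. Beyond it f y \<le> 1 + ln(s^2 y^2)/ln q; the 1
  contributes s, and the logarithm 2 s / ln q \<le> 3 s because ln q \<ge> 2/3. Hence the constant
  5.\<close>

lemma truncated_log_average_le:
  fixes q \<delta> :: real
  assumes K: "K \<ge> 2" and q: "q \<ge> 2" and \<delta>: "\<delta> \<ge> 1" "6 * \<delta> < q"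
  defines "d \<equiv> \<lambda>y. \<delta> * (2 + real y * (real y - 1) / 2)"
  defines "f \<equiv> \<lambda>y. if d y \<le> q then d y / q else ln (d y) / ln q"
  shows "(\<Sum>y = 1..<K. f y / (real y * real (y + 1))) + f (K - 1) / real K \<le> 5 * sqrt (\<delta> / q)"
proof -
  define s where "s = sqrt (\<delta> / q)"
  have s: "s > 0" "s\<^sup>2 = \<delta> / q" using \<delta> q by (auto simp: s_def)
  have s1: "s < 1" using s \<delta> q by (auto simp: s_def)
  define Y where "Y = nat \<lfloor>1 / s\<rfloor>"
  have Y: "real Y \<le> 1 / s" "1 / s < real Y + 1" using s by (auto simp: Y_def)
  have "1 \<le> \<lfloor>1 / s\<rfloor>" using s s1 by (simp add: le_floor_iff)
  then have Y1: "Y \<ge> 1" unfolding Y_def by linarith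
  have lnq: "ln q \<ge> 2/3" using q ln2_ge_two_thirds by (smt (verit) ln_le_cancel_iff)
  have d_le: "d y \<le> \<delta> * (real y)\<^sup>2" if "y \<ge> 2" for y
  proof -
    have "0 \<le> (real y - 2) * (real y + 3) + 2" using that by (intro add_nonneg_nonneg mult_nonneg_nonneg) auto
    then have "2 + real y * (real y - 1) / 2 \<le> (real y)\<^sup>2" by (simp add: field_simps power2_eq_square)
    then show ?thesis using \<delta> by (simp add: d_def)
  qed
  have d_le': "d y \<le> \<delta> * (real y * real (y + 1))" if "y \<ge> 1" for y
  proof -
    have "0 \<le> (real y - 1) * (real y + 4)" using that by (intro mult_nonneg_nonneg) auto
    then have "2 + real y * (real y - 1) / 2 \<le> real y * real (y + 1)" by (simp add: field_simps)
    then show ?thesis using \<delta> by (simp add: d_def)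
  qed
  have d1: "d y \<ge> 1" for y
  proof -
    have "1 \<le> 2 + real y * (real y - 1) / 2" by (cases y) auto
    then show ?thesis unfolding d_def using \<delta> mult_mono[of 1 \<delta> 1] by simp
  qed
  have small: "f y \<le> s\<^sup>2 * (real y * real (y + 1))" if y: "1 \<le> y" "y \<le> Y" for y
  proof -
    have "d y \<le> q"
    \<comment> \<open>At y = 1 the bound d y \<le> \<delta> y^2 fails, since d 1 = 2 \<delta>; there
      the hypothesis 6 \<delta> < q is used instead.\<close>
    proof (cases "y = 1")
      case True
      then show ?thesis using \<delta> by (simp add: d_def)
    next
      case False
      have "real y \<le> 1 / s" using y Y by simp
      then have "real y * s \<le> 1" using s by (simp add: field_simps)
      then have "(real y * s)\<^sup>2 \<le> 1" using s by (simp add: power_le_one)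
      then have "\<delta> * (real y)\<^sup>2 \<le> q" using s(2) q by (simp add: power_mult_distrib field_simps)
      then show ?thesis using d_le[of y] y False by simp
    qed
    then have "f y = d y / q" by (simp add: f_def)
    also have "\<dots> \<le> \<delta> * (real y * real (y + 1)) / q"
      using d_le'[OF y(1)] q by (intro divide_right_mono) auto
    finally show ?thesis by (simp add: s(2))
  qed
  have small_sum: "(\<Sum>y = 1..<k. f y / (real y * real (y + 1))) \<le> s\<^sup>2 * (real k - 1)"
    if "k \<ge> 1" "k \<le> Y + 1" for k
  proof -
    have "(\<Sum>y = 1..<k. f y / (real y * real (y + 1))) \<le> (\<Sum>y = 1..<k. s\<^sup>2)"
      using small that by (intro sum_mono) (simp add: divide_simps mult.commute)
    also have "\<dots> = s\<^sup>2 * (real k - 1)" using that by (simp add: of_nat_diff)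
    finally show ?thesis .
  qed
  have sY: "s\<^sup>2 * real Y \<le> s"
  proof -
    have "s * real Y \<le> 1" using Y(1) s(1) by (simp add: field_simps)
    then have "s * (s * real Y) \<le> s * 1" using s(1) by (intro mult_left_mono) auto
    then show ?thesis by (simp add: power2_eq_square)
  qed
  show ?thesis
  proof (cases "K \<le> Y + 1")
    case True
    have "f (K - 1) / real K \<le> s\<^sup>2 * real Y"
    proof -
      have "f (K - 1) \<le> s\<^sup>2 * (real (K - 1) * real K)"
        using small[of "K - 1"] K True by simp
      then have "f (K - 1) / real K \<le> s\<^sup>2 * real (K - 1)" using K by (simp add: field_simps)
      also have "\<dots> \<le> s\<^sup>2 * real Y" using True by (intro mult_left_mono) auto
      finally show ?thesis .
    qed
    moreover have "(\<Sum>y = 1..<K. f y / (real y * real (y + 1))) \<le> s\<^sup>2 * real Y"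
      using small_sum[of K] K True mult_left_mono[of "real K - 1" "real Y" "s\<^sup>2"] by simp
    ultimately show ?thesis using sY s unfolding s_def[symmetric] by linarith
  next
    case False
    define \<psi> where "\<psi> = (\<lambda>y. 1 / real y + (ln (s\<^sup>2 * (real y)\<^sup>2) + 2) / real y / ln q)"
    have large: "f y \<le> 1 + ln (s\<^sup>2 * (real y)\<^sup>2) / ln q" if y: "y \<ge> Y + 1" for y
    proof -
      have "1 / s \<le> real y" using y Y by linarith
      then have "1 \<le> s * real y" using s by (simp add: field_simps)
      then have "1 \<le> s\<^sup>2 * (real y)\<^sup>2" by (simp add: power_mult_distrib[symmetric] one_le_power)
      then have l0: "ln (s\<^sup>2 * (real y)\<^sup>2) \<ge> 0" by simp
      show ?thesis
      proof (cases "d y \<le> q")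
        case True
        then have "f y \<le> 1" using q by (simp add: f_def)
        then show ?thesis using l0 lnq by (smt (verit) divide_nonneg_nonneg)
      next
        case False
        have "ln (d y) \<le> ln (\<delta> * (real y)\<^sup>2)"
          using d1[of y] d_le[of y] y Y1 by simp
        also have "\<delta> * (real y)\<^sup>2 = q * (s\<^sup>2 * (real y)\<^sup>2)" using q by (simp add: s(2))
        also have "ln \<dots> = ln q + ln (s\<^sup>2 * (real y)\<^sup>2)"
          using q s(1) y by (subst ln_mult) auto
        finally show ?thesis using False lnq by (simp add: f_def field_simps)
      qed
    qed
    have "(\<Sum>y = Y + 1..<K. f y / (real y * real (y + 1))) \<le> \<psi> (Y + 1) - \<psi> K"
    proof (rule sum_telescope_le)
      fix y assume y: "Y + 1 \<le> y"
      have "f y / (real y * real (y + 1))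
          \<le> (1 + ln (s\<^sup>2 * (real y)\<^sup>2) / ln q) / (real y * real (y + 1))"
        using large[OF y] by (intro divide_right_mono) auto
      also have "\<dots> = 1 / (real y * real (y + 1)) + ln (s\<^sup>2 * (real y)\<^sup>2) / (real y * real (y + 1)) / ln q"
        by (simp add: add_divide_distrib mult_ac)
      also have "\<dots> \<le> (1 / real y - 1 / real (y + 1))
          + ((ln (s\<^sup>2 * (real y)\<^sup>2) + 2) / real y - (ln (s\<^sup>2 * (real (y + 1))\<^sup>2) + 2) / real (y + 1)) / ln q"
      proof (intro add_mono divide_right_mono log_tail_step)
        show "1 / (real y * real (y + 1)) \<le> 1 / real y - 1 / real (y + 1)"
          using y by (simp add: field_simps)
        show "0 < s\<^sup>2" using s(1) by simp
      qed (use y lnq in auto)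
      also have "\<dots> = \<psi> y - \<psi> (y + 1)" by (simp add: \<psi>_def diff_divide_distrib)
      finally show "f y / (real y * real (y + 1)) \<le> \<psi> y - \<psi> (y + 1)" .
    qed (use False in auto)
    moreover have "f (K - 1) / real K \<le> \<psi> K"
    proof -
      have "f (K - 1) \<le> 1 + ln (s\<^sup>2 * (real (K - 1))\<^sup>2) / ln q" using large[of "K - 1"] False by simp
      also have "\<dots> \<le> 1 + (ln (s\<^sup>2 * (real K)\<^sup>2) + 2) / ln q"
      proof (intro add_left_mono divide_right_mono)
        have "0 < s\<^sup>2 * (real (K - 1))\<^sup>2" using s(1) K by (intro mult_pos_pos zero_less_power) auto
        moreover have "s\<^sup>2 * (real (K - 1))\<^sup>2 \<le> s\<^sup>2 * (real K)\<^sup>2"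
          by (intro mult_left_mono power_mono) auto
        ultimately show "ln (s\<^sup>2 * (real (K - 1))\<^sup>2) \<le> ln (s\<^sup>2 * (real K)\<^sup>2) + 2"
          by (smt (verit) ln_mono)
      qed (use lnq in simp)
      finally have "f (K - 1) / real K \<le> (1 + (ln (s\<^sup>2 * (real K)\<^sup>2) + 2) / ln q) / real K"
        by (intro divide_right_mono) auto
      then show ?thesis by (simp add: \<psi>_def add_divide_distrib mult_ac)
    qed
    moreover have "(\<Sum>y = 1..<Y + 1. f y / (real y * real (y + 1))) \<le> s"
      using small_sum[of "Y + 1"] sY by simp
    moreover have "(\<Sum>y = 1..<K. f y / (real y * real (y + 1)))
        = (\<Sum>y = 1..<Y + 1. f y / (real y * real (y + 1))) + (\<Sum>y = Y + 1..<K. f y / (real y * real (y + 1)))"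
      using False by (intro sum.atLeastLessThan_concat[symmetric]) auto
    moreover have "\<psi> (Y + 1) \<le> 4 * s"
    proof -
      define u where "u = s * real (Y + 1)"
      have u: "u \<ge> 1" using Y(2) s by (simp add: u_def field_simps)
      have ln: "ln (s\<^sup>2 * (real (Y + 1))\<^sup>2) = 2 * ln u"
        using u by (simp add: u_def power_mult_distrib[symmetric] ln_realpow)
      have inv: "1 / real (Y + 1) \<le> s" using u by (simp add: u_def field_simps)
      \<comment> \<open>The 2 produced by the telescoping primitive is absorbed here: 2 ln u + 2
        \<le> 2 u, and u/(Y + 1) is s.\<close>
      have "ln u \<le> u - 1" using u by (intro ln_le_minus_one) auto
      then have "(2 * ln u + 2) / real (Y + 1) \<le> 2 * u / real (Y + 1)"
        by (intro divide_right_mono) auto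
      also have "\<dots> = 2 * s" by (simp add: u_def)
      finally have "(2 * ln u + 2) / real (Y + 1) / ln q \<le> 2 * s / ln q"
        using lnq by (intro divide_right_mono) auto
      also have "\<dots> \<le> 2 * s / (2/3)" using lnq s by (intro divide_left_mono) auto
      finally show ?thesis using inv unfolding \<psi>_def ln by simp
    qed
    ultimately show ?thesis unfolding s_def[symmetric] by linarith
  qed
qed

text \<open>In the range 6 \<delta> \<ge> q the minimum is the logarithmic term, so one Euler
  product bound suffices there. With s = sqrt(6 \<delta>/q) the logarithm is ln q + 2 ln s, and the
  tangent of ln at 2 with ln 2 \<le> 3/4 gives ln s \<le> s/2 - 1/4. The resulting constant 2 sqrt 6
  is just below 5.\<close>

lemma log_le_sqrt:
  fixes q \<delta> :: real
  assumes q: "q \<ge> 2" and \<delta>: "\<delta> \<ge> 1" "6 * \<delta> \<ge> q"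
  shows "ln (6 * \<delta>) / ln q \<le> 5 * sqrt (\<delta> / q)"
proof -
  define s where "s = sqrt (6 * \<delta> / q)"
  have s: "s \<ge> 1" "s\<^sup>2 = 6 * \<delta> / q" using \<delta> q by (auto simp: s_def)
  have lnq: "ln q \<ge> 2/3" using q ln2_ge_two_thirds by (smt (verit) ln_le_cancel_iff)
  have "6 * \<delta> = q * s\<^sup>2" using q by (simp add: s(2))
  then have "ln (6 * \<delta>) = ln q + 2 * ln s" using q s(1) by (simp only:) (simp add: ln_mult ln_realpow)
  moreover have "ln s \<le> s / 2 - 1/4"
  proof -
    have "ln (s / 2) \<le> s / 2 - 1" using s by (intro ln_le_minus_one) auto
    moreover have "ln (2 :: real) \<le> 3/4"
    proof -
      have "1 + 3/4 + (3/4)\<^sup>2 / 2 \<le> exp (3/4 :: real)" by (rule exp_lower_Taylor_quadratic) simp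
      then have "2 \<le> exp (3/4 :: real)" by (simp add: power2_eq_square)
      then have "ln 2 \<le> ln (exp (3/4 :: real))" by (intro ln_mono) auto
      then show ?thesis by simp
    qed
    ultimately show ?thesis using s by (simp add: ln_div)
  qed
  ultimately have "ln (6 * \<delta>) \<le> ln q + (s - 1/2)" by simp
  also have "\<dots> \<le> ln q * (2 * s)"
  proof -
    have "2/3 * (2 * s - 1) \<le> ln q * (2 * s - 1)" using lnq s by (intro mult_right_mono) auto
    then show ?thesis using s(1) by (simp add: field_simps)
  qed
  finally have "ln (6 * \<delta>) / ln q \<le> 2 * s" using lnq by (simp add: field_simps)
  also have "\<dots> \<le> 5 * sqrt (\<delta> / q)"
  proof -
    have "s = sqrt 6 * sqrt (\<delta> / q)" by (simp add: s_def flip: real_sqrt_mult)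
    moreover have "sqrt 6 \<le> 5/2" by (rule real_le_lsqrt) (auto simp: power2_eq_square)
    ultimately show ?thesis using \<delta> q mult_right_mono[of "sqrt 6" "5/2" "sqrt (\<delta> / q)"] by simp
  qed
  finally show ?thesis .
qed

section \<open>Counting representations\<close>

text \<open>Each difference m \<ge> 1 occurs for K - m pairs in either order. The nested
  \<open>if\<close> spells out the absolute difference, as subtraction of naturals
  truncates.\<close>

lemma sum_pairs_by_difference:
  fixes a :: real and b :: "nat \<Rightarrow> real"
  shows "(\<Sum>j<K. \<Sum>k<K. if j = k then a else b (if j < k then k - j else j - k))
    = real K * a + 2 * (\<Sum>m = 1..<K. (real K - real m) * b m)"
proof (induction K)
  case (Suc K)
  define c where "c = (\<lambda>j k. if j = k then a else b (if j < k then k - j else j - k))"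
  have edge: "(\<Sum>j<K. b (K - j)) = (\<Sum>m = 1..<Suc K. b m)"
    by (rule sum.reindex_bij_witness[of _ "\<lambda>m. K - m" "\<lambda>j. K - j"]) auto
  have "(\<Sum>j<Suc K. \<Sum>k<Suc K. c j k)
      = (\<Sum>j<K. \<Sum>k<K. c j k) + (\<Sum>j<K. c j K) + (\<Sum>k<K. c K k) + c K K"
    by (simp add: sum.distrib)
  also have "(\<Sum>j<K. c j K) = (\<Sum>m = 1..<Suc K. b m)"
    unfolding edge[symmetric] by (intro sum.cong refl) (auto simp: c_def)
  also have "(\<Sum>k<K. c K k) = (\<Sum>m = 1..<Suc K. b m)"
    unfolding edge[symmetric] by (intro sum.cong refl) (auto simp: c_def)
  also have "(\<Sum>j<K. \<Sum>k<K. c j k) = real K * a + 2 * (\<Sum>m = 1..<K. (real K - real m) * b m)"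
    using Suc.IH by (simp add: c_def)
  also have "(\<Sum>m = 1..<K. (real K - real m) * b m) = (\<Sum>m = 1..<Suc K. (real K - real m) * b m)"
    by (cases "K = 0") (simp_all add: sum.atLeastLessThan_Suc)
  finally have "(\<Sum>j<Suc K. \<Sum>k<Suc K. c j k) = real (Suc K) * a
      + 2 * ((\<Sum>m = 1..<Suc K. (real K - real m) * b m) + (\<Sum>m = 1..<Suc K. b m))"
    by (simp add: c_def algebra_simps del: sum.op_ivl_Suc)
  also have "(\<Sum>m = 1..<Suc K. (real K - real m) * b m) + (\<Sum>m = 1..<Suc K. b m)
      = (\<Sum>m = 1..<Suc K. (real (Suc K) - real m) * b m)"
    by (simp add: algebra_simps flip: sum.distrib del: sum.op_ivl_Suc)
  finally show ?case by (simp only: c_def)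
qed simp

lemma square_card_le_representations:
  fixes r :: "'k \<Rightarrow> 'b \<Rightarrow> bool"
  assumes "finite X" "finite J" "\<And>j x. j \<in> J \<Longrightarrow> r j x \<Longrightarrow> x \<in> X"
  shows "(\<Sum>j\<in>J. real (card {x. r j x}))\<^sup>2
    \<le> real (card X) * (\<Sum>j\<in>J. \<Sum>k\<in>J. real (card {x. r j x \<and> r k x}))"
proof -
  define \<rho> where "\<rho> = (\<lambda>x. \<Sum>j\<in>J. of_bool (r j x) :: real)"
  have card: "real (card {x. R x}) = (\<Sum>x\<in>X. of_bool (R x))" if "\<And>x. R x \<Longrightarrow> x \<in> X" for R
  proof -
    have "{x. R x} = X \<inter> {x. R x}" using that by auto
    then show ?thesis using assms(1) by simp
  qed
  have "(\<Sum>j\<in>J. real (card {x. r j x})) = (\<Sum>x\<in>X. 1 * \<rho> x)"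
    using assms(3) by (simp add: \<rho>_def card sum.swap[of _ J X] del: sum_of_bool_eq)
  also have "(\<Sum>x\<in>X. 1 * \<rho> x)\<^sup>2 \<le> (\<Sum>x\<in>X. 1\<^sup>2) * (\<Sum>x\<in>X. (\<rho> x)\<^sup>2)"
    by (rule Cauchy_Schwarz_ineq_sum)
  also have "(\<Sum>x\<in>X. (\<rho> x)\<^sup>2) = (\<Sum>x\<in>X. \<Sum>j\<in>J. \<Sum>k\<in>J. of_bool (r j x \<and> r k x))"
    by (simp add: \<rho>_def power2_eq_square sum_product of_bool_conj del: sum_of_bool_eq)
  also have "\<dots> = (\<Sum>j\<in>J. \<Sum>k\<in>J. \<Sum>x\<in>X. of_bool (r j x \<and> r k x))"
    by (subst sum.swap, intro sum.cong refl, subst sum.swap) simp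
  also have "\<dots> = (\<Sum>j\<in>J. \<Sum>k\<in>J. real (card {x. r j x \<and> r k x}))"
    using assms(3) by (intro sum.cong refl card[symmetric]) auto
  finally show ?thesis by simp
qed

lemma power_in_polys_below:
  fixes g :: "'a::field poly"
  assumes "degree g \<ge> 1" "k * degree g < n"
  shows "g ^ k \<in> polys_below n"
proof -
  have "degree (g ^ k) = k * degree g" using assms by (subst degree_power_eq) auto
  then show ?thesis using assms by (simp add: polys_below_def)
qed

lemma polys_below_diff:
  fixes r s :: "'a::field poly"
  assumes "r \<in> polys_below n" "s \<in> polys_below n" shows "r - s \<in> polys_below n"
  using assms by (cases "r = 0"; cases "s = 0") (auto simp: polys_below_def intro: degree_diff_less)

text \<open>A summand \<open>g ^ k\<close> of degree \<open>n\<close> would make the leading coefficient of \<open>h + g ^ k\<close> different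
  from \<open>1\<close>, and one of larger degree would change the degree.\<close>

lemma shifted_irreds_eq:
  fixes g :: "'a::{field,finite} poly"
  assumes g: "degree g \<ge> 1" and n: "n \<ge> 1"
  shows "{f :: 'a poly. lead_coeff f = 1 \<and> degree f = n \<and>
      (\<exists>h k. lead_coeff h = 1 \<and> irreducible h \<and> degree h = n \<and> f = h + g ^ k)}
    = (\<Union>k\<in>{k. k * degree g < n}. (\<lambda>h. h + g ^ k) ` irreds_of_degree n)"
proof (intro equalityI subsetI)
  fix f assume "f \<in> {f :: 'a poly. lead_coeff f = 1 \<and> degree f = n \<and>
      (\<exists>h k. lead_coeff h = 1 \<and> irreducible h \<and> degree h = n \<and> f = h + g ^ k)}"
  then obtain h k where f: "lead_coeff f = 1" "degree f = n" "f = h + g ^ k"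
    and h: "lead_coeff h = 1" "irreducible h" "degree h = n" by blast
  have dg: "degree (g ^ k) = k * degree g" using g by (subst degree_power_eq) auto
  have "k * degree g < n"
  proof (rule ccontr)
    assume "\<not> k * degree g < n"
    then consider "k * degree g = n" | "k * degree g > n" by linarith
    then show False
    proof cases
      case 1
      have "coeff (h + g ^ k) n = 1" using f(1) f(2) by (simp only: f(3))
      moreover have "coeff h n = 1" using h(1) unfolding h(3) .
      ultimately have "coeff h n + coeff (g ^ k) n = coeff h n" unfolding coeff_add by simp
      then have "lead_coeff (g ^ k) = 0" unfolding dg 1 by (simp only: add_cancel_left_right)
      then have "g ^ k = 0" by (simp only: leading_coeff_0_iff)
      then show False using g by auto
    next
      case 2
      then have "degree (h + g ^ k) = k * degree g"
        using h dg by (subst degree_add_eq_right) auto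
      then show False using 2 f by simp
    qed
  qed
  then show "f \<in> (\<Union>k\<in>{k. k * degree g < n}. (\<lambda>h. h + g ^ k) ` irreds_of_degree n)"
    using f h by (auto simp: irreds_of_degree_def monic_irreds_def)
next
  fix f assume "f \<in> (\<Union>k\<in>{k. k * degree g < n}. (\<lambda>h. h + g ^ k) ` irreds_of_degree n)"
  then obtain h k where k: "k * degree g < n" and h: "h \<in> irreds_of_degree n" and f: "f = h + g ^ k"
    by auto
  have "h \<in> monics n" using h by (auto simp: irreds_of_degree_def monic_irreds_def monics_def)
  then have "f \<in> monics n" using monics_add_polys_below power_in_polys_below[OF g k] f by blast
  then show "f \<in> {f :: 'a poly. lead_coeff f = 1 \<and> degree f = n \<and>
      (\<exists>h k. lead_coeff h = 1 \<and> irreducible h \<and> degree h = n \<and> f = h + g ^ k)}"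
    using h f by (auto simp: irreds_of_degree_def monic_irreds_def monics_def)
qed

text \<open>The shift A = g^k - g^j equals g^j (g^(k-j) - 1). Admitting the primes of
  \<open>g\<close> even for j = 0 makes the bound depend on \<open>k - j\<close> only, as the
  averaging requires. The denominator comes from n div 2 \<ge> (n - 1)/2.\<close>

lemma card_representation_pairs_le:
  fixes g :: "'a::{field,finite} poly" and n :: nat
  assumes g: "degree g \<ge> 1" and n: "n \<ge> 1" and jk: "j < k" "k * degree g < n"
  shows "real (card {f. f - g ^ j \<in> irreds_of_degree n \<and> f - g ^ k \<in> irreds_of_degree n})
    \<le> 8 / (real (n + 1) * real (n + 3)) * (real CARD('a) ^ n *
        (\<Prod>P\<in>prime_divisors g \<union> prime_divisors (g ^ (k - j) - 1). euler_factor P))"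
proof -
  define A where "A = g ^ k - g ^ j"
  define D where "D = prime_divisors g \<union> prime_divisors (g ^ (k - j) - 1)"
  have "j * degree g < n" using jk g by (meson le_less_trans less_imp_le mult_le_mono1)
  then have A: "A \<in> polys_below n"
    unfolding A_def using power_in_polys_below[OF g] jk(2) by (intro polys_below_diff) auto
  have A_eq: "A = g ^ j * (g ^ (k - j) - 1)"
    using jk by (simp add: A_def algebra_simps flip: power_add)
  have "card {f. f - g ^ j \<in> irreds_of_degree n \<and> f - g ^ k \<in> irreds_of_degree n}
      \<le> card {h \<in> irreds_of_degree n. irreducible (h + A)}"
  proof (rule card_inj_on_le[of "\<lambda>f. f - g ^ k"])
    show "(\<lambda>f. f - g ^ k) ` {f. f - g ^ j \<in> irreds_of_degree n \<and> f - g ^ k \<in> irreds_of_degree n}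
        \<subseteq> {h \<in> irreds_of_degree n. irreducible (h + A)}"
      by (auto simp: A_def irreds_of_degree_def monic_irreds_def)
  qed (auto simp: inj_on_def)
  then have "real (card {f. f - g ^ j \<in> irreds_of_degree n \<and> f - g ^ k \<in> irreds_of_degree n})
      \<le> real (card {h \<in> irreds_of_degree n. irreducible (h + A)})" by simp
  moreover have "real (card {h \<in> irreds_of_degree n. irreducible (h + A)}) * (real (n + 1) * real (n + 3) / 8)
      \<le> real CARD('a) ^ n * (\<Prod>P\<in>D. euler_factor P)"
  proof -
    have half: "real (n + 1) / 2 \<le> real (n div 2 + 1)" "real (n + 3) / 2 \<le> real (n div 2 + 2)"
    proof -
      have "n \<le> 2 * (n div 2) + 1" by simp
      then have "real n \<le> real (2 * (n div 2) + 1)" by (simp only: of_nat_le_iff)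
      then have "real n \<le> 2 * real (n div 2) + 1" by simp
      then show "real (n + 1) / 2 \<le> real (n div 2 + 1)" "real (n + 3) / 2 \<le> real (n div 2 + 2)"
        by auto
    qed
    have "real (n + 1) * real (n + 3) / 8 = (real (n + 1) / 2) * (real (n + 3) / 2) / 2" by simp
    also have "\<dots> \<le> real (n div 2 + 1) * real (n div 2 + 2) / 2"
      using half by (intro divide_right_mono mult_mono) auto
    finally have "real (card {h \<in> irreds_of_degree n. irreducible (h + A)}) * (real (n + 1) * real (n + 3) / 8)
        \<le> real (card {h \<in> irreds_of_degree n. irreducible (h + A)}) * (real (n div 2 + 1) * real (n div 2 + 2) / 2)"
      by (intro mult_left_mono) auto
    also have "\<dots> \<le> real CARD('a) ^ n * (\<Prod>P | P \<in> primes_upto (n div 2) \<and> P dvd A. euler_factor P)"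
      by (rule card_irreducible_pairs_le[OF n A])
    also have "(\<Prod>P | P \<in> primes_upto (n div 2) \<and> P dvd A. euler_factor P) \<le> (\<Prod>P\<in>D. euler_factor P)"
    proof (rule prod_mono2)
      show "finite D"
        unfolding D_def using g jk degree_power_minus_1(2)[OF g, of "k - j"]
        by (intro finite_UnI finite_prime_divisors) auto
      show "{P \<in> primes_upto (n div 2). P dvd A} \<subseteq> D"
      proof
        fix P assume "P \<in> {P \<in> primes_upto (n div 2). P dvd A}"
        then have P: "P \<in> monic_irreds" "P dvd A" by (auto simp: primes_upto_def)
        then have "P dvd g ^ j \<or> P dvd g ^ (k - j) - 1"
          using monic_irredsD(1)[OF P(1)] by (simp add: A_eq prime_elem_dvd_mult_iff)
        then show "P \<in> D"
          using P monic_irredsD(1)[OF P(1)] prime_elem_dvd_power by (auto simp: D_def prime_divisors_def)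
      qed
      show "1 \<le> euler_factor P" if "P \<in> D - {P \<in> primes_upto (n div 2). P dvd A}" for P
        using that euler_factor_ge_1 by (auto simp: D_def prime_divisors_def)
      show "0 \<le> euler_factor P" if "P \<in> {P \<in> primes_upto (n div 2). P dvd A}" for P
        using that euler_factor_ge_1[of P] by (auto simp: primes_upto_def)
    qed
    finally show ?thesis by (simp add: mult_left_mono)
  qed
  moreover have "(0 :: real) < real (n + 1) * real (n + 3) / 8" by simp
  ultimately have "real (card {f. f - g ^ j \<in> irreds_of_degree n \<and> f - g ^ k \<in> irreds_of_degree n})
      * (real (n + 1) * real (n + 3) / 8) \<le> real CARD('a) ^ n * (\<Prod>P\<in>D. euler_factor P)"
    by (meson less_imp_le mult_right_mono order_trans)
  moreover have "N \<le> 8 / Z * M" if "N * (Z / 8) \<le> M" "Z > 0" for N Z M :: real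
    using that by (simp add: field_simps)
  ultimately show ?thesis by (simp add: D_def del: of_nat_add)
qed

text \<open>The logarithmic bound is available for every q. The square root bound is proved only for
  6 \<delta> < q, because otherwise it is not the smaller one.\<close>

lemma euler_factor_power_average_le:
  fixes g :: "'a::{field,finite} poly"
  defines "q \<equiv> real CARD('a)" and "\<delta> \<equiv> real (degree g)"
  assumes g: "degree g \<ge> 1" and K: "K \<ge> 2"
  shows "(\<Sum>m = 1..<K. (real K - real m) * (\<Prod>P\<in>prime_divisors g \<union> prime_divisors (g ^ m - 1). euler_factor P))
    \<le> (real K)\<^sup>2 / 2 * (q / (q - 1) *
        (1 + exp euler_mascheroni * min (5 * sqrt (\<delta> / q)) (ln (6 * \<delta>) / ln q)))"
proof -
  let ?S = "\<Sum>m = 1..<K. (real K - real m) * (\<Prod>P\<in>prime_divisors g \<union> prime_divisors (g ^ m - 1). euler_factor P)"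
  have q2: "q \<ge> 2" using card_field_ge_2[where 'a = 'a] by (simp add: q_def)
  have \<delta>1: "\<delta> \<ge> 1" using g by (simp add: \<delta>_def)
  have C: "q / (q - 1) \<ge> 0" using q2 by simp
  define d where "d = (\<lambda>y. \<delta> * (2 + real y * (real y - 1) / 2))"
  have d1: "d y \<ge> 1" for y
  proof -
    have "1 \<le> 2 + real y * (real y - 1) / 2" by (cases y) auto
    then show ?thesis unfolding d_def using \<delta>1 mult_mono[of 1 \<delta> 1] by simp
  qed
  have log: "?S \<le> (real K)\<^sup>2 / 2 * (q / (q - 1) * (1 + exp euler_mascheroni * (ln (6 * \<delta>) / ln q)))"
  proof (rule euler_factor_average_le[OF g K C exp_ge_zero])
    fix y :: nat and S :: "'a poly set"
    assume "finite S" "S \<subseteq> monic_irreds"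
      "real (sum degree S) \<le> real (degree g) * (2 + real y * (real y - 1) / 2)"
    then show "(\<Prod>P\<in>S. euler_factor P) \<le> q / (q - 1) * (1 + exp euler_mascheroni * (ln (d y) / ln q))"
      using prod_euler_factor_le_log[of S "d y"] d1[of y] by (simp add: q_def d_def \<delta>_def)
  next
    have "(\<Sum>y = 1..<K. ln (d y) / ln q / (real y * real (y + 1))) + ln (d (K - 1)) / ln q / real K
        = ((\<Sum>y = 1..<K. ln (d y) / (real y * real (y + 1))) + ln (d (K - 1)) / real K) / ln q"
      by (simp add: add_divide_distrib sum_divide_distrib mult_ac)
    also have "\<dots> \<le> ln (6 * \<delta>) / ln q"
      using log_average_le[OF K \<delta>1] q2 by (intro divide_right_mono) (auto simp: d_def)
    finally show "(\<Sum>y = 1..<K. ln (d y) / ln q / (real y * real (y + 1))) + ln (d (K - 1)) / ln q / real K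
        \<le> ln (6 * \<delta>) / ln q" .
  qed
  show ?thesis
  proof (cases "6 * \<delta> < q")
    case True
    define f where "f = (\<lambda>y. if d y \<le> q then d y / q else ln (d y) / ln q)"
    have "?S \<le> (real K)\<^sup>2 / 2 * (q / (q - 1) * (1 + exp euler_mascheroni * (5 * sqrt (\<delta> / q))))"
    proof (rule euler_factor_average_le[OF g K C exp_ge_zero])
      fix y :: nat and S :: "'a poly set"
      assume "finite S" "S \<subseteq> monic_irreds"
        "real (sum degree S) \<le> real (degree g) * (2 + real y * (real y - 1) / 2)"
      then show "(\<Prod>P\<in>S. euler_factor P) \<le> q / (q - 1) * (1 + exp euler_mascheroni * f y)"
        using prod_euler_factor_le_log[of S "d y"] prod_euler_factor_le_linear[of S "d y"] d1[of y]
        by (auto simp: q_def d_def \<delta>_def f_def)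
    next
      show "(\<Sum>y = 1..<K. f y / (real y * real (y + 1))) + f (K - 1) / real K \<le> 5 * sqrt (\<delta> / q)"
        using truncated_log_average_le[OF K q2 \<delta>1 True] by (simp only: f_def d_def)
    qed
    with log show ?thesis by (simp add: min_def)
  next
    case False
    then have "ln (6 * \<delta>) / ln q \<le> 5 * sqrt (\<delta> / q)" using log_le_sqrt[OF q2 \<delta>1] by simp
    then have "min (5 * sqrt (\<delta> / q)) (ln (6 * \<delta>) / ln q) = ln (6 * \<delta>) / ln q" by (rule min.absorb2)
    then show ?thesis using log by simp
  qed
qed

lemma less_number_of_shifts_iff:
  fixes \<delta> n k :: nat
  assumes "\<delta> \<ge> 1" "n \<ge> 1"
  shows "k * \<delta> < n \<longleftrightarrow> k < (n - 1) div \<delta> + 1"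
proof -
  have "k * \<delta> < n \<longleftrightarrow> k * \<delta> \<le> n - 1" using assms by linarith
  also have "\<dots> \<longleftrightarrow> k \<le> (n - 1) div \<delta>" using assms by (simp add: less_eq_div_iff_mult_less_eq)
  finally show ?thesis by linarith
qed

text \<open>The absolute value is needed because the theorem squares 1 - 2 q^(-n/2), which is
  negative for n = 1 and q < 4. For n = 1 all monics are irreducible and p = 1; for n \<ge> 2 the
  quantity is already nonnegative.\<close>

lemma irreducible_proportion_bounds:
  assumes n: "n \<ge> 1"
  defines "q \<equiv> real CARD('a::{field,finite})"
  defines "p \<equiv> real n * real (card (irreds_of_degree n :: 'a poly set)) / q ^ n"
  shows "p \<le> 1" "p > 0" "\<bar>1 - 2 * q powr (- real n / 2)\<bar> \<le> p"
proof -
  define c where "c = card (irreds_of_degree n :: 'a poly set)"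
  have q2: "q \<ge> 2" using card_field_ge_2[where 'a = 'a] by (simp add: q_def)
  have qn: "q ^ n > 0" using q2 by simp
  have "real (n * c) \<le> real (CARD('a) ^ n)"
    using card_irreds_le[of n, where 'a = 'a] unfolding c_def by (simp only: of_nat_le_iff)
  then show "p \<le> 1" using qn by (simp add: p_def c_def q_def)
  have "real (CARD('a) ^ n) < real (n * c + 2 * CARD('a) ^ (n div 2))"
    using card_irreds_gt[OF n, where 'a = 'a] unfolding c_def by (simp only: of_nat_less_iff)
  then have lower: "q ^ n < real n * real c + 2 * q ^ (n div 2)" by (simp add: q_def)
  have lower': "1 - 2 * q powr (- real n / 2) \<le> p"
  proof -
    have "q ^ (n div 2) = q powr real (n div 2)" using q2 by (simp add: powr_realpow)
    also have "\<dots> \<le> q powr (real n / 2)" using q2 by (intro powr_mono) linarith+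
    also have "\<dots> = q powr (- real n / 2) * q ^ n"
      using q2 by (simp add: powr_realpow[symmetric] flip: powr_add)
    finally have "q ^ n - 2 * (q powr (- real n / 2) * q ^ n) \<le> real n * real c"
      using lower by linarith
    then have "(1 - 2 * q powr (- real n / 2)) * q ^ n \<le> real n * real c" by (simp add: algebra_simps)
    then show ?thesis using qn by (simp add: p_def c_def pos_le_divide_eq)
  qed
  have "p > 0 \<and> \<bar>1 - 2 * q powr (- real n / 2)\<bar> \<le> p"
  proof (cases "n = 1")
    case True
    have "p = 1" using card_irreds_of_degree_1[where 'a = 'a] q2 by (simp add: p_def True q_def)
    moreover have "q powr (- 1 / 2) \<le> q powr 0" using q2 by (intro powr_mono) auto
    moreover have "q powr (- 1 / 2) \<ge> 0" by simp
    ultimately show ?thesis using True q2 by (auto simp: abs_le_iff)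
  next
    case False
    then have n2: "n \<ge> 2" using n by simp
    have "2 * q ^ (n div 2) \<le> q * q ^ (n div 2)" using q2 by (intro mult_right_mono) auto
    also have "\<dots> = q ^ Suc (n div 2)" by simp
    also have "\<dots> \<le> q ^ n"
      using n2 q2 by (intro power_increasing) auto
    finally have "real n * real c > 0" using lower by linarith
    then have "p > 0" using qn by (simp add: p_def c_def)
    moreover have "q powr (- real n / 2) \<le> 1/2"
    proof -
      have "q powr (- real n / 2) \<le> q powr (- 1)" using q2 n2 by (intro powr_mono) auto
      also have "\<dots> = 1 / q" using q2 by (simp add: powr_minus_divide)
      also have "\<dots> \<le> 1/2" using q2 by (simp add: field_simps)
      finally show ?thesis .
    qed
    ultimately show ?thesis using lower' by (auto simp: abs_le_iff)
  qed
  then show "p > 0" "\<bar>1 - 2 * q powr (- real n / 2)\<bar> \<le> p" by auto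
qed

theorem theorem1:
  fixes g :: "'a::{field,finite} poly" and n :: nat
  assumes "degree g \<ge> 1" and "n \<ge> 1"
  shows "let q = real CARD('a); \<delta> = real (degree g);
             r = real (shifted_irred_count n g) / q ^ n
         in (1 + \<delta> / real n) / \<delta> \<ge> r \<and>
            r > (1 - 2 * q powr (- real n / 2))\<^sup>2 * inverse (1 + \<delta> / real n) /
                (\<delta> + 8 * (q / (q - 1)) *
                   (1 + exp euler_mascheroni * min (5 * sqrt (\<delta> / q)) (ln (6 * \<delta>) / ln q)))"
proof -
  define q where "q = real CARD('a)"
  define \<delta> where "\<delta> = real (degree g)"
  define r where "r = real (shifted_irred_count n g) / q ^ n"
  define K where "K = (n - 1) div degree g + 1"
  define c where "c = real (card (irreds_of_degree n :: 'a poly set))"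
  define p where "p = real n * c / q ^ n"
  define C where "C = q / (q - 1) *
    (1 + exp euler_mascheroni * min (5 * sqrt (\<delta> / q)) (ln (6 * \<delta>) / ln q))"
  define X where "X = (\<Union>k<K. (\<lambda>h. h + g ^ k) ` (irreds_of_degree n :: 'a poly set))"
  have q2: "q \<ge> 2" using card_field_ge_2[where 'a = 'a] by (simp add: q_def)
  have qn: "q ^ n > 0" using q2 by simp
  have \<delta>1: "\<delta> \<ge> 1" using assms by (simp add: \<delta>_def)
  have n1: "real n \<ge> 1" using assms by simp
  have K1: "K \<ge> 1" by (simp add: K_def)
  have C0: "C > 0"
    unfolding C_def using q2 \<delta>1 by (intro mult_pos_pos add_pos_nonneg mult_nonneg_nonneg divide_nonneg_nonneg) auto
  note p = irreducible_proportion_bounds[OF assms(2), where 'a = 'a, folded q_def c_def, folded p_def]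
  have shifts: "k * degree g < n \<longleftrightarrow> k < K" for k
    unfolding K_def by (rule less_number_of_shifts_iff[OF assms])
  have X: "shifted_irred_count n g = card X"
    unfolding shifted_irred_count_def shifted_irreds_eq[OF assms] X_def by (simp add: shifts lessThan_def)
  have finX: "finite X" by (simp add: X_def)
  have K_le: "real K \<le> real n / \<delta> + 1"
  proof -
    have "(K - 1) * degree g < n" using shifts[of "K - 1"] K1 by simp
    then have "real ((K - 1) * degree g) \<le> real n" by (simp only: of_nat_le_iff)
    then have "(real K - 1) * \<delta> \<le> real n" using K1 by (simp add: \<delta>_def of_nat_diff)
    then show ?thesis using \<delta>1 by (simp add: field_simps)
  qed
  have K_ge: "real n / real K \<le> \<delta>"
  proof -
    have "n \<le> K * degree g" using shifts[of K] by simp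
    then have "real n \<le> real (K * degree g)" by (simp only: of_nat_le_iff)
    then show ?thesis using K1 by (simp add: \<delta>_def field_simps)
  qed
  have upper: "r \<le> (1 + \<delta> / real n) / \<delta>"
  proof -
    have "card X \<le> (\<Sum>k<K. card ((\<lambda>h. h + g ^ k) ` (irreds_of_degree n :: 'a poly set)))"
      unfolding X_def by (rule card_UN_le) simp
    also have "\<dots> \<le> (\<Sum>k<K. card (irreds_of_degree n :: 'a poly set))"
      by (intro sum_mono card_image_le) simp
    also have "\<dots> = K * card (irreds_of_degree n :: 'a poly set)" by simp
    finally have "real (card X) \<le> real (K * card (irreds_of_degree n :: 'a poly set))"
      by (simp only: of_nat_le_iff)
    then have "r \<le> real K * c / q ^ n" using qn by (simp add: r_def X c_def divide_right_mono)
    also have "\<dots> = real K * p / real n" using n1 by (simp add: p_def)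
    also have "\<dots> \<le> real K * 1 / real n" using p by (intro divide_right_mono mult_left_mono) auto
    also have "\<dots> \<le> (real n / \<delta> + 1) / real n" using K_le by (simp add: divide_right_mono)
    also have "\<dots> = (1 + \<delta> / real n) / \<delta>" using \<delta>1 n1 by (simp add: field_simps)
    finally show ?thesis .
  qed
  have r0: "r \<ge> 0" using qn by (simp add: r_def)
  define B where "B = 8 / (real (n + 1) * real (n + 3))"
  have main: "(real K * c)\<^sup>2 \<le> real (card X) * (real K * c + B * q ^ n * (real K)\<^sup>2 * C)"
  proof -
    define rep where "rep = (\<lambda>k f. f - g ^ k \<in> irreds_of_degree n)"
    have card_rep: "real (card {f. rep k f}) = c" for k
    proof -
      have "bij_betw (\<lambda>h. h + g ^ k) (irreds_of_degree n) {f. rep k f}"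
        by (rule bij_betwI[where g = "\<lambda>f. f - g ^ k"]) (auto simp: rep_def)
      then show ?thesis by (simp add: c_def bij_betw_same_card)
    qed
    have rep_X: "f \<in> X" if "k \<in> {..<K}" "rep k f" for k f
      using that unfolding X_def rep_def by (auto intro!: bexI[of _ k] image_eqI[of _ _ "f - g ^ k"])
    define b where "b = (\<lambda>m. B * (q ^ n * (\<Prod>P\<in>prime_divisors g \<union> prime_divisors (g ^ m - 1). euler_factor P)))"
    have pair: "real (card {f. rep j f \<and> rep k f}) \<le> b (k - j)" if "j < k" "k < K" for j k
      using card_representation_pairs_le[OF assms that(1)] that(2) shifts
      by (simp add: rep_def b_def B_def q_def)
    have "(\<Sum>j<K. \<Sum>k<K. real (card {f. rep j f \<and> rep k f}))
        \<le> (\<Sum>j<K. \<Sum>k<K. if j = k then c else b (if j < k then k - j else j - k))"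
    proof (intro sum_mono)
      fix j k assume jk: "j \<in> {..<K}" "k \<in> {..<K}"
      consider "j = k" | "j < k" | "k < j" by linarith
      then show "real (card {f. rep j f \<and> rep k f})
          \<le> (if j = k then c else b (if j < k then k - j else j - k))"
      proof cases
        case 3
        then show ?thesis using pair[of k j] jk by (simp add: conj_commute)
      qed (use pair[of j k] jk card_rep in auto)
    qed
    also have "\<dots> = real K * c + 2 * (\<Sum>m = 1..<K. (real K - real m) * b m)"
      by (rule sum_pairs_by_difference)
    finally have pairs: "(\<Sum>j<K. \<Sum>k<K. real (card {f. rep j f \<and> rep k f}))
        \<le> real K * c + 2 * (\<Sum>m = 1..<K. (real K - real m) * b m)" .
    have "(\<Sum>m = 1..<K. (real K - real m) * b m) = B * q ^ n *
        (\<Sum>m = 1..<K. (real K - real m) * (\<Prod>P\<in>prime_divisors g \<union> prime_divisors (g ^ m - 1). euler_factor P))"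
      by (simp add: b_def sum_distrib_left mult_ac)
    also have "\<dots> \<le> B * q ^ n * ((real K)\<^sup>2 / 2 * C)"
    proof (intro mult_left_mono)
      show "(\<Sum>m = 1..<K. (real K - real m) * (\<Prod>P\<in>prime_divisors g \<union> prime_divisors (g ^ m - 1). euler_factor P))
          \<le> (real K)\<^sup>2 / 2 * C"
      proof (cases "K \<ge> 2")
        case True
        then show ?thesis
          using euler_factor_power_average_le[OF assms(1), of K] by (simp add: C_def q_def \<delta>_def)
      next
        case False
        then have "K = 1" using K1 by simp
        then show ?thesis using C0 by simp
      qed
    qed (use qn in \<open>simp add: B_def\<close>)
    finally have "(\<Sum>j<K. \<Sum>k<K. real (card {f. rep j f \<and> rep k f}))
        \<le> real K * c + B * q ^ n * (real K)\<^sup>2 * C"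
      using pairs by simp
    then have "real (card X) * (\<Sum>j<K. \<Sum>k<K. real (card {f. rep j f \<and> rep k f}))
        \<le> real (card X) * (real K * c + B * q ^ n * (real K)\<^sup>2 * C)"
      by (intro mult_left_mono) auto
    moreover have "(\<Sum>k<K. real (card {f. rep k f}))\<^sup>2
        \<le> real (card X) * (\<Sum>j<K. \<Sum>k<K. real (card {f. rep j f \<and> rep k f}))"
      using finX rep_X by (intro square_card_le_representations) auto
    ultimately show ?thesis by (simp add: card_rep)
  qed
  \<comment> \<open>Scaling by (n / (K q^n))^2 turns all counts into densities. The pairs of equal
    exponents leave n/K, at most \<delta>, and the mixed pairs leave the sieve constant.\<close>
  have "p\<^sup>2 \<le> r * (real n / real K * p + B * (real n)\<^sup>2 * C)"
  proof -
    have c: "c = p * q ^ n / real n" using q2 n1 by (simp add: p_def)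
    have "(real n / (real K * q ^ n))\<^sup>2 * (real K * c)\<^sup>2
        \<le> (real n / (real K * q ^ n))\<^sup>2 * (real (card X) * (real K * c + B * q ^ n * (real K)\<^sup>2 * C))"
      using main by (rule mult_left_mono) simp
    also have "(real n / (real K * q ^ n))\<^sup>2 * (real K * c)\<^sup>2 = p\<^sup>2"
      unfolding c using q2 n1 K1 by (simp flip: power_mult_distrib)
    also have "(real n / (real K * q ^ n))\<^sup>2 * (real (card X) * (real K * c + B * q ^ n * (real K)\<^sup>2 * C))
        = r * (real n / real K * p + B * (real n)\<^sup>2 * C)"
      unfolding c r_def X using q2 n1 K1
      by (simp add: divide_simps power2_eq_square) (simp add: algebra_simps)
    finally show ?thesis .
  qed
  moreover have "real n / real K * p + B * (real n)\<^sup>2 * C < \<delta> + 8 * C"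
  proof -
    have "real n / real K * p \<le> real n / real K * 1" using p by (intro mult_left_mono) auto
    \<comment> \<open>The strictness of the lower bound comes from n^2 < (n + 1)(n + 3).\<close>
    moreover have "B * (real n)\<^sup>2 < 8"
    proof -
      have "(real n)\<^sup>2 < real (n + 1) * real (n + 3)" by (simp add: power2_eq_square algebra_simps)
      then show ?thesis by (simp add: B_def divide_simps)
    qed
    then have "B * (real n)\<^sup>2 * C < 8 * C" using C0 by (rule mult_strict_right_mono)
    ultimately show ?thesis using K_ge by linarith
  qed
  \<comment> \<open>Positivity lets the strict inequality survive multiplication by r; it rests on
    the existence of an irreducible polynomial of degree n.\<close>
  moreover have "r > 0"
  proof -
    have "p\<^sup>2 > 0" using p(2) by simp
    then have "r \<noteq> 0" using calculation(1) by auto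
    then show ?thesis using r0 by simp
  qed
  ultimately have "p\<^sup>2 < r * (\<delta> + 8 * C)"
    by (meson le_less_trans mult_strict_left_mono)
  then have "p\<^sup>2 / (\<delta> + 8 * C) < r" using \<delta>1 C0 by (simp add: pos_divide_less_eq)
  moreover have "(1 - 2 * q powr (- real n / 2))\<^sup>2 * inverse (1 + \<delta> / real n) / (\<delta> + 8 * C) \<le> p\<^sup>2 / (\<delta> + 8 * C)"
  proof (rule divide_right_mono)
    have "(1 - 2 * q powr (- real n / 2))\<^sup>2 \<le> p\<^sup>2"
      using p(3) by (intro abs_le_square_iff[THEN iffD1]) simp
    moreover have "inverse (1 + \<delta> / real n) \<le> 1" using \<delta>1 by (intro inverse_le_1_iff[THEN iffD2]) auto
    moreover have "inverse (1 + \<delta> / real n) \<ge> 0" using \<delta>1 by simp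
    ultimately have "(1 - 2 * q powr (- real n / 2))\<^sup>2 * inverse (1 + \<delta> / real n) \<le> p\<^sup>2 * 1"
      by (intro mult_mono) auto
    then show "(1 - 2 * q powr (- real n / 2))\<^sup>2 * inverse (1 + \<delta> / real n) \<le> p\<^sup>2" by simp
  qed (use \<delta>1 C0 in simp)
  ultimately have "(1 - 2 * q powr (- real n / 2))\<^sup>2 * inverse (1 + \<delta> / real n) / (\<delta> + 8 * C) < r"
    by linarith
  then show ?thesis
    using upper unfolding Let_def q_def[symmetric] \<delta>_def[symmetric] r_def[symmetric] C_def
    by (simp only: mult.assoc simp_thms)
qed

end
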